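(* Let $a,b>0$ be such that $a^2/b^2$ is irrational, and let $\mathcal{R}(a,b)=(0,a)\times(0,b)$. Consider the Dirichlet eigenvalue problem $-\Delta u=\lambda u$ in $\mathcal{R}(a,b)$, $u=0$ on $\partial\mathcal{R}(a,b)$. Then $$\mathfrak{N}(\mathcal{R}(a,b))=2\,\mathfrak{P}(\mathcal{R}(a,b))=\frac{4}{\pi}.$$
   Context: Let $\Omega$ be a bounded planar domain (here the rectangle $\Omega=\mathcal{R}(a,b)$ with $\Gamma^D=\partial\Omega$). $\{\lambda_k\}_{k\ge1}$ is the nondecreasing sequence of Dirichlet eigenvalues (counted with multiplicity) and $u_k$ is an eigenfunction corresponding to $\lambda_k$. Define $$\mathfrak{N}(\Omega)=\limsup_{k\to+\infty}\frac{\mu(u_k)}{k},\qquad \mathfrak{P}(\Omega)=\limsup_{k\to+\infty}\frac{\varpi(u_k)}{k},$$ where $\mu(u_k)$ is the number of Neumann domains of $u_k$ and $\varpi(u_k)$ is the number of nodal domains (connected components of $\Omega\setminus u_k^{-1}(0)$) of $u_k$. Neumann domains of an eigenfunction $u$: $u$ is analytically extended to a neighborhood of $\overline\Omega$; critical points, local extrema and saddle points (critical points that are not local extrema) are understood for this extension. $\mathcal{M}_-,\mathcal{M}_+,\mathcal{S}$ are the sets of local minimum, local maximum and saddle points of $u$ in $\overline\Omega$. For $z_0\in\overline\Omega$, $\gamma(\cdot,z_0)$ is the solution of $\dot z=-\nabla u(z)$, $z(0)=z_0$, on the maximal time interval on which it stays in $\overline\Omega$; $\gamma(\pm\infty,z_0)=\lim_{t\to\pm\infty}\gamma(t,z_0)$.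 For a critical point $z_0$, $W^{\mathfrak s}(z_0)=\{z\in\overline\Omega:\gamma(+\infty,z)=z_0\}$, $W^{\mathfrak u}(z_0)=\{z\in\overline\Omega:\gamma(-\infty,z)=z_0\}$. Put $G=\{z\in\Omega:\gamma(t_z,z)\in\Gamma^D\text{ for some }t_z\in\mathbb{R}\}$, $W=\Omega\cap\bigcup_{q\in\mathcal{M}_-}\bigcup_{p\in\mathcal{M}_+}(W^{\mathfrak s}(q)\cap W^{\mathfrak u}(p))$, $L(r)=W^{\mathfrak s}(r)\cup W^{\mathfrak u}(r)$ for $r\in\mathcal{S}$, $L=\bigcup_{r\in\mathcal{S}}\overline{L(r)}$. A Neumann domain of $u$ is any connected component of $(G\cup W\cup\mathrm{Int}(L))\setminus\bigcup_{r\in\mathcal{S}}\partial L(r)$ (boundaries and interiors in $\mathbb{R}^2$). *)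

theory Defs
  imports "HOL-Analysis.Analysis" "HOL-Library.Function_Algebras"
begin

section \<open>Functions on the plane\<close>

definition pdx :: "(real \<times> real \<Rightarrow> real) \<Rightarrow> real \<times> real \<Rightarrow> real" where
  "pdx u = (\<lambda>(x, y). deriv (\<lambda>s. u (s, y)) x)"

definition pdy :: "(real \<times> real \<Rightarrow> real) \<Rightarrow> real \<times> real \<Rightarrow> real" where
  "pdy u = (\<lambda>(x, y). deriv (\<lambda>s. u (x, s)) y)"

definition gradient :: "(real \<times> real \<Rightarrow> real) \<Rightarrow> real \<times> real \<Rightarrow> real \<times> real" where
  "gradient u z = (pdx u z, pdy u z)"

definition laplacian :: "(real \<times> real \<Rightarrow> real) \<Rightarrow> real \<times> real \<Rightarrow> real" where
  "laplacian u z = pdx (pdx u) z + pdy (pdy u) z"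

text \<open>Both classes of functions are meant for open sets \<open>S\<close>.\<close>

definition C1_on :: "(real \<times> real) set \<Rightarrow> (real \<times> real \<Rightarrow> real) \<Rightarrow> bool" where
  "C1_on S u \<longleftrightarrow>
     (\<forall>(x, y)\<in>S. (\<lambda>s. u (s, y)) differentiable (at x) \<and> (\<lambda>s. u (x, s)) differentiable (at y)) \<and>
     continuous_on S (pdx u) \<and> continuous_on S (pdy u)"

definition C2_on :: "(real \<times> real) set \<Rightarrow> (real \<times> real \<Rightarrow> real) \<Rightarrow> bool" where
  "C2_on S u \<longleftrightarrow> C1_on S u \<and> C1_on S (pdx u) \<and> C1_on S (pdy u)"

definition real_analytic_on :: "(real \<times> real \<Rightarrow> real) \<Rightarrow> (real \<times> real) set \<Rightarrow> bool"
    (infixl "real'_analytic'_on" 50) where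
  "f real_analytic_on S \<longleftrightarrow>
     (\<forall>z\<in>S. \<exists>c :: nat \<Rightarrow> nat \<Rightarrow> real. \<exists>\<rho>>0. \<forall>h k. \<bar>h\<bar> < \<rho> \<longrightarrow> \<bar>k\<bar> < \<rho> \<longrightarrow>
        ((\<lambda>(i, j). c i j * h ^ i * k ^ j) has_sum f (z + (h, k))) UNIV)"

interpretation fun_vs: vector_space "\<lambda>(c::real) (u :: real \<times> real \<Rightarrow> real) z. c * u z"
  by unfold_locales (auto simp: fun_eq_iff algebra_simps)


section \<open>The Dirichlet problem\<close>

text \<open>Classical solutions of \<open>- \<Delta>u = t u\<close> in \<open>\<Omega>\<close>, \<open>u = 0\<close> on \<open>\<partial>\<Omega>\<close>, including the zero
  function. To represent functions on the closure of \<open>\<Omega>\<close> uniquely by total functions,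
  so that the dimension of the space is meaningful, they are set to 0 outside \<open>\<Omega>\<close>.\<close>

definition dirichlet_eigenspace ::
    "(real \<times> real) set \<Rightarrow> real \<Rightarrow> (real \<times> real \<Rightarrow> real) set" where
  "dirichlet_eigenspace \<Omega> t =
     {u. C2_on \<Omega> u \<and> continuous_on (closure \<Omega>) u \<and>
         (\<forall>z\<in>\<Omega>. - laplacian u z = t * u z) \<and> (\<forall>z. z \<notin> \<Omega> \<longrightarrow> u z = 0)}"

definition dirichlet_eigenfunction ::
    "(real \<times> real) set \<Rightarrow> real \<Rightarrow> (real \<times> real \<Rightarrow> real) \<Rightarrow> bool" where
  "dirichlet_eigenfunction \<Omega> t u \<longleftrightarrow> u \<in> dirichlet_eigenspace \<Omega> t \<and> (\<exists>z\<in>\<Omega>. u z \<noteq> 0)"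

definition has_multiplicity :: "(real \<times> real) set \<Rightarrow> real \<Rightarrow> nat \<Rightarrow> bool" where
  "has_multiplicity \<Omega> t m \<longleftrightarrow>
     (\<exists>B. finite B \<and> card B = m \<and> fun_vs.independent B \<and>
          fun_vs.span B = dirichlet_eigenspace \<Omega> t)"

text \<open>\<open>ev 1 \<le> ev 2 \<le> \<dots>\<close> are the eigenvalues, each repeated according to its multiplicity;
  a real number of multiplicity 0 is not an eigenvalue. The value \<open>ev 0\<close> plays no role.\<close>

definition dirichlet_spectrum :: "(real \<times> real) set \<Rightarrow> (nat \<Rightarrow> real) \<Rightarrow> bool" where
  "dirichlet_spectrum \<Omega> ev \<longleftrightarrow>
     mono_on {1..} ev \<and>
     (\<forall>t. finite {k. 1 \<le> k \<and> ev k = t} \<and> has_multiplicity \<Omega> t (card {k. 1 \<le> k \<and> ev k = t}))"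


section \<open>Nodal domains\<close>

definition nodal_domains ::
    "(real \<times> real) set \<Rightarrow> (real \<times> real \<Rightarrow> real) \<Rightarrow> (real \<times> real) set set" where
  "nodal_domains \<Omega> u = components (\<Omega> - u -` {0})"


section \<open>Neumann domains\<close>

text \<open>In this section \<open>v\<close> stands for the analytic extension of an eigenfunction.\<close>

definition local_minima ::
    "(real \<times> real) set \<Rightarrow> (real \<times> real \<Rightarrow> real) \<Rightarrow> (real \<times> real) set" where
  "local_minima \<Omega> v = {z \<in> closure \<Omega>. \<forall>\<^sub>F w in nhds z. v z \<le> v w}"

definition local_maxima ::
    "(real \<times> real) set \<Rightarrow> (real \<times> real \<Rightarrow> real) \<Rightarrow> (real \<times> real) set" where
  "local_maxima \<Omega> v = {z \<in> closure \<Omega>. \<forall>\<^sub>F w in nhds z. v w \<le> v z}"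

definition saddle_points ::
    "(real \<times> real) set \<Rightarrow> (real \<times> real \<Rightarrow> real) \<Rightarrow> (real \<times> real) set" where
  "saddle_points \<Omega> v =
     {z \<in> closure \<Omega>. gradient v z = 0} - (local_minima \<Omega> v \<union> local_maxima \<Omega> v)"

text \<open>A solution on the time interval \<open>I\<close> that stays in the closure of \<open>\<Omega>\<close>; at end points of
  \<open>I\<close> that belong to \<open>I\<close> the derivative is one-sided, and \<open>I = {0}\<close> is admitted.\<close>

definition trajectory ::
    "(real \<times> real) set \<Rightarrow> (real \<times> real \<Rightarrow> real) \<Rightarrow> real \<times> real \<Rightarrow>
     real set \<Rightarrow> (real \<Rightarrow> real \<times> real) \<Rightarrow> bool" where
  "trajectory \<Omega> v z I \<gamma> \<longleftrightarrow>
     is_interval I \<and> 0 \<in> I \<and> \<gamma> 0 = z \<and>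
     (\<forall>t\<in>I. \<gamma> t \<in> closure \<Omega> \<and> (\<gamma> has_vector_derivative - gradient v (\<gamma> t)) (at t within I))"

text \<open>The maximal time interval, and the solution on it (which is unique, since the gradient of
  an analytic function is locally Lipschitz).\<close>

definition flow_interval ::
    "(real \<times> real) set \<Rightarrow> (real \<times> real \<Rightarrow> real) \<Rightarrow> real \<times> real \<Rightarrow> real set" where
  "flow_interval \<Omega> v z = \<Union>{I. \<exists>\<gamma>. trajectory \<Omega> v z I \<gamma>}"

definition flow ::
    "(real \<times> real) set \<Rightarrow> (real \<times> real \<Rightarrow> real) \<Rightarrow> real \<times> real \<Rightarrow> real \<Rightarrow> real \<times> real" where
  "flow \<Omega> v z t = (THE w. \<exists>I \<gamma>. trajectory \<Omega> v z I \<gamma> \<and> t \<in> I \<and> \<gamma> t = w)"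

definition stable_set ::
    "(real \<times> real) set \<Rightarrow> (real \<times> real \<Rightarrow> real) \<Rightarrow> real \<times> real \<Rightarrow> (real \<times> real) set" where
  "stable_set \<Omega> v r =
     {z \<in> closure \<Omega>. {0..} \<subseteq> flow_interval \<Omega> v z \<and> (flow \<Omega> v z \<longlongrightarrow> r) at_top}"

definition unstable_set ::
    "(real \<times> real) set \<Rightarrow> (real \<times> real \<Rightarrow> real) \<Rightarrow> real \<times> real \<Rightarrow> (real \<times> real) set" where
  "unstable_set \<Omega> v r =
     {z \<in> closure \<Omega>. {..0} \<subseteq> flow_interval \<Omega> v z \<and> (flow \<Omega> v z \<longlongrightarrow> r) at_bot}"

text \<open>The points whose trajectory meets the Dirichlet part of the boundary, here all of it.\<close>

definition G_set ::
    "(real \<times> real) set \<Rightarrow> (real \<times> real \<Rightarrow> real) \<Rightarrow> (real \<times> real) set" where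
  "G_set \<Omega> v = {z \<in> \<Omega>. \<exists>t\<in>flow_interval \<Omega> v z. flow \<Omega> v z t \<in> frontier \<Omega>}"

definition W_set ::
    "(real \<times> real) set \<Rightarrow> (real \<times> real \<Rightarrow> real) \<Rightarrow> (real \<times> real) set" where
  "W_set \<Omega> v =
     \<Omega> \<inter> (\<Union>q\<in>local_minima \<Omega> v. \<Union>p\<in>local_maxima \<Omega> v. stable_set \<Omega> v q \<inter> unstable_set \<Omega> v p)"

definition L_at ::
    "(real \<times> real) set \<Rightarrow> (real \<times> real \<Rightarrow> real) \<Rightarrow> real \<times> real \<Rightarrow> (real \<times> real) set" where
  "L_at \<Omega> v r = stable_set \<Omega> v r \<union> unstable_set \<Omega> v r"

definition L_set ::
    "(real \<times> real) set \<Rightarrow> (real \<times> real \<Rightarrow> real) \<Rightarrow> (real \<times> real) set" where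
  "L_set \<Omega> v = (\<Union>r\<in>saddle_points \<Omega> v. closure (L_at \<Omega> v r))"

definition analytic_extension ::
    "(real \<times> real) set \<Rightarrow> (real \<times> real \<Rightarrow> real) \<Rightarrow> (real \<times> real \<Rightarrow> real) \<Rightarrow> bool" where
  "analytic_extension \<Omega> u v \<longleftrightarrow>
     (\<exists>U. open U \<and> closure \<Omega> \<subseteq> U \<and> v real_analytic_on U) \<and> (\<forall>z\<in>closure \<Omega>. v z = u z)"

text \<open>For open \<open>\<Omega>\<close> the germs of an analytic extension at points of the closure of \<open>\<Omega>\<close> are
  determined by \<open>u\<close>, so the choice of the extension does not matter.\<close>

definition neumann_domains ::
    "(real \<times> real) set \<Rightarrow> (real \<times> real \<Rightarrow> real) \<Rightarrow> (real \<times> real) set set" where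
  "neumann_domains \<Omega> u =
     (let v = (SOME v. analytic_extension \<Omega> u v)
      in components ((G_set \<Omega> v \<union> W_set \<Omega> v \<union> interior (L_set \<Omega> v))
           - (\<Union>r\<in>saddle_points \<Omega> v. frontier (L_at \<Omega> v r))))"


section \<open>The two asymptotic constants\<close>

text \<open>Unlike \<^const>\<open>card\<close>, this is infinite on infinite sets.\<close>

definition ecard :: "'a set \<Rightarrow> ereal" where
  "ecard A = (if finite A then ereal (real (card A)) else \<infinity>)"

definition neumann_const ::
    "(real \<times> real) set \<Rightarrow> (nat \<Rightarrow> real \<times> real \<Rightarrow> real) \<Rightarrow> ereal" where
  "neumann_const \<Omega> u = limsup (\<lambda>k. ecard (neumann_domains \<Omega> (u k)) / ereal (real k))"

definition pleijel_const ::
    "(real \<times> real) set \<Rightarrow> (nat \<Rightarrow> real \<times> real \<Rightarrow> real) \<Rightarrow> ereal" where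
  "pleijel_const \<Omega> u = limsup (\<lambda>k. ecard (nodal_domains \<Omega> (u k)) / ereal (real k))"

definition rectangle :: "real \<Rightarrow> real \<Rightarrow> (real \<times> real) set" where
  "rectangle a b = {0<..<a} \<times> {0<..<b}"

end

theory Submission
  imports Defs "HOL-Complex_Analysis.Cauchy_Integral_Formula"
begin

text \<open>Separation of variables and the irrationality of \<open>a\<^sup>2 / b\<^sup>2\<close> show that every eigenvalue is simple, with
  eigenfunction \<open>u = c sin (\<alpha> x) sin (\<beta> y)\<close>, \<open>\<alpha> = m \<pi> / a\<close>, \<open>\<beta> = n \<pi> / b\<close>; it has \<open>m n\<close> nodal domains. Along a
  gradient trajectory \<open>\<bar>cos (\<alpha> x)\<bar> powr \<beta>\<^sup>2\<close> and \<open>\<bar>cos (\<beta> y)\<bar> powr \<alpha>\<^sup>2\<close> keep their ratio, which is 1 at the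
  saddle points. So the separatrices form the level set where the two functions agree, and every
  other trajectory joins a maximum to a minimum or leaves through the boundary. The complement of that level set
  consists of lenses, one around each grid segment between neighbouring extrema, or between an extremum and the
  boundary: \<open>(m + 1) n\<close> horizontal and \<open>m (n + 1)\<close> vertical ones. Finally, the index \<open>k\<close> of the eigenvalue is the number
  of lattice points in a quarter ellipse, asymptotically \<open>\<pi> a b R\<^sup>2 / 4\<close> with
  \<open>R\<^sup>2 = (m / a)\<^sup>2 + (n / b)\<^sup>2 \<ge> 2 m n / (a b)\<close>, and equality is approached along \<open>m / a \<approx> n / b\<close>.\<close>

section \<open>Planar saddle systems\<close>

text \<open>Three objects of the statement are not given by formulas: the eigenvalue list with its
  multiplicities, the analytic extension, and the flow. A multiplicity is the dimension of a space
  of classical solutions, about which only continuity is known at the boundary; all of them are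
  classified, by showing that every non-resonant double sine coefficient vanishes. The extension is
  determined by comparing power series on an inward quadrant at each point of the closure. The flow
  is a definite description, so the relevant orbits are built for all times, by quadrature of a
  model system in one cell, and then identified by uniqueness.

  The level set of the two conserved functions has empty interior. Hence the interior of
  \<open>L_set\<close> is empty and each point of some \<open>L_at\<close> is a frontier point of
  it, which is why exactly the separatrices disappear. The extrema also lie on the level set; they
  are excluded separately, as stationary points.

  The number of lenses exceeds 2 m n by m + n. This excess is of order R while the index k is of
  order R^2, whence the factor 2 between the constants.\<close>

lemma autonomous_solution:
  fixes g :: "real \<Rightarrow> real"
  assumes x0: "l < x0" "x0 < r"
    and cont: "continuous_on {l<..<r} g"
    and pos: "\<And>x. l < x \<Longrightarrow> x < r \<Longrightarrow> 0 < g x"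
    and lbd: "\<And>x. l < x \<Longrightarrow> x < r \<Longrightarrow> g x \<le> C * (x - l)"
    and rbd: "\<And>x. l < x \<Longrightarrow> x < r \<Longrightarrow> g x \<le> C * (r - x)"
  obtains X where "X 0 = x0" "\<And>t. l < X t" "\<And>t. X t < r"
    "\<And>t. (X has_real_derivative g (X t)) (at t)"
    "(X \<longlongrightarrow> r) at_top" "(X \<longlongrightarrow> l) at_bot"
proof -
  have lr: "l < r" using x0 by simp
  have Cpos: "C > 0"
    using pos[OF x0] lbd[OF x0] x0 by (smt (verit) mult_nonpos_nonneg)
  \<comment> \<open>An antiderivative of 1 / g is the travel time; the solution will be its inverse
    function.\<close>
  have "\<exists>F. \<forall>x::real. ereal l < x \<longrightarrow> x < ereal r \<longrightarrow> (F has_vector_derivative inverse (g x)) (at x)"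
  proof (rule einterval_antiderivative)
    show "ereal l < ereal r" using lr by simp
    fix x :: real assume "ereal l < ereal x" "ereal x < ereal r"
    then have x: "l < x" "x < r" by auto
    have "isCont g x" using cont x by (simp add: continuous_on_eq_continuous_at)
    then show "isCont (\<lambda>x. inverse (g x)) x"
      using pos[OF x] by (intro continuous_intros) auto
  qed
  then obtain F where F: "\<And>x. l < x \<Longrightarrow> x < r \<Longrightarrow> (F has_real_derivative inverse (g x)) (at x)"
    by (auto simp: has_real_derivative_iff_has_vector_derivative)
  define T where "T x = F x - F x0" for x
  have T: "(T has_real_derivative inverse (g x)) (at x)" if "l < x" "x < r" for x
    unfolding T_def by (rule derivative_eq_intros F that refl)+ simp
  have Tmono: "T x < T y" if "l < x" "x < y" "y < r" for x y
  proof (rule DERIV_pos_imp_increasing[OF that(2)])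
    fix z assume "x \<le> z" "z \<le> y"
    then have "l < z" "z < r" using that by auto
    then show "\<exists>d. (T has_real_derivative d) (at z) \<and> 0 < d"
      using T pos by (intro exI[of _ "inverse (g z)"]) auto
  qed
  have T0: "T x0 = 0" by (simp add: T_def)
  \<comment> \<open>Comparison with x' = C (r - x): since g vanishes at least linearly at r, the
    travel time to r is at least logarithmic, hence infinite. The bound \<open>lo\<close> does the
    same at l for negative times.\<close>
  have up: "T x \<ge> (ln (r - x0) - ln (r - x)) / C" if "x0 \<le> x" "x < r" for x
  proof -
    have "(\<lambda>x. T x + ln (r - x) / C) x0 \<le> (\<lambda>x. T x + ln (r - x) / C) x"
    proof (rule DERIV_nonneg_imp_nondecreasing[OF that(1)])
      fix z assume "x0 \<le> z" "z \<le> x"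
      then have z: "l < z" "z < r" using that x0 by auto
      have "((\<lambda>x. T x + ln (r - x) / C) has_real_derivative inverse (g z) - 1 / (r - z) / C) (at z)"
        using z Cpos by (auto intro!: derivative_eq_intros T)
      moreover have "1 / (C * (r - z)) \<le> 1 / g z"
        using rbd[OF z] pos[OF z] by (intro frac_le) auto
      then have "inverse (g z) - 1 / (r - z) / C \<ge> 0"
        by (simp add: inverse_eq_divide mult.commute)
      ultimately show "\<exists>y. ((\<lambda>x. T x + ln (r - x) / C) has_real_derivative y) (at z) \<and> 0 \<le> y" by blast
    qed
    then show ?thesis by (simp add: T0 diff_divide_distrib)
  qed
  have lo: "T x \<le> (ln (x - l) - ln (x0 - l)) / C" if "l < x" "x \<le> x0" for x
  proof -
    have "(\<lambda>x. T x - ln (x - l) / C) x \<le> (\<lambda>x. T x - ln (x - l) / C) x0"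
    proof (rule DERIV_nonneg_imp_nondecreasing[OF that(2)])
      fix z assume "x \<le> z" "z \<le> x0"
      then have z: "l < z" "z < r" using that x0 by auto
      have "((\<lambda>x. T x - ln (x - l) / C) has_real_derivative inverse (g z) - 1 / (z - l) / C) (at z)"
        using z Cpos by (auto intro!: derivative_eq_intros T)
      moreover have "1 / (C * (z - l)) \<le> 1 / g z"
        using lbd[OF z] pos[OF z] by (intro frac_le) auto
      then have "inverse (g z) - 1 / (z - l) / C \<ge> 0"
        by (simp add: inverse_eq_divide mult.commute)
      ultimately show "\<exists>y. ((\<lambda>x. T x - ln (x - l) / C) has_real_derivative y) (at z) \<and> 0 \<le> y" by blast
    qed
    then show ?thesis by (simp add: T0 diff_divide_distrib)
  qed
  have "\<exists>x. l < x \<and> x < r \<and> T x = t" for t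
  proof -
    \<comment> \<open>The positions after time \<open>\<bar>t\<bar>\<close> of the comparison
      solutions, forward towards r and backward towards l; the true travel times to them bracket
      t.\<close>
    define x2 where "x2 = r - (r - x0) * exp (- (C * \<bar>t\<bar>))"
    define x1 where "x1 = l + (x0 - l) * exp (- (C * \<bar>t\<bar>))"
    define E where "E = exp (- (C * \<bar>t\<bar>))"
    have E: "0 < E" "E \<le> 1" using Cpos by (simp_all add: E_def)
    have "(r - x0) * E \<le> (r - x0) * 1" "(x0 - l) * E \<le> (x0 - l) * 1"
      using x0 E by (intro mult_left_mono; simp)+
    moreover have "(r - x0) * E > 0" "(x0 - l) * E > 0" using x0 E by simp_all
    ultimately have x2: "x0 \<le> x2" "x2 < r" and x1: "x1 \<le> x0" "l < x1"
      unfolding x2_def x1_def E_def[symmetric] by (simp_all only: mult_1_right)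
    have "ln (r - x2) = ln (r - x0) - C * \<bar>t\<bar>"
      using x0 by (simp add: x2_def ln_mult)
    then have "T x2 \<ge> \<bar>t\<bar>" using up[OF x2] Cpos by simp
    moreover have "ln (x1 - l) = ln (x0 - l) - C * \<bar>t\<bar>"
      using x0 by (simp add: x1_def ln_mult)
    then have "T x1 \<le> - \<bar>t\<bar>" using lo[OF x1(2,1)] Cpos by simp
    moreover have "\<forall>x. x1 \<le> x \<and> x \<le> x2 \<longrightarrow> isCont T x"
      using x1 x2 T DERIV_isCont by (metis order.strict_trans1 order.strict_trans2)
    ultimately have "\<exists>x. x1 \<le> x \<and> x \<le> x2 \<and> T x = t"
      using x1 x2 by (intro IVT) auto
    then show ?thesis using x1 x2 by (metis order.strict_trans1 order.strict_trans2)
  qed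
  then obtain X where X: "\<And>t. l < X t" "\<And>t. X t < r" "\<And>t. T (X t) = t" by metis
  have XT: "X (T x) = x" if "l < x" "x < r" for x
    using X[of "T x"] Tmono that by (metis less_irrefl linorder_neqE)
  have Xmono: "x \<le> X t" if "T x \<le> t" "l < x" "x < r" for x t
    using X[of t] Tmono that by (metis leD leI)
  have Xmono': "X t \<le> x" if "t \<le> T x" "l < x" "x < r" for x t
    using X[of t] Tmono that by (metis leD leI)
  show thesis
  proof (rule that[of X])
    show "X 0 = x0" using XT[OF x0] T0 by simp
    show "l < X t" "X t < r" for t using X by auto
    show "(X has_real_derivative g (X t)) (at t)" for t
    proof -
      have "(X has_real_derivative inverse (inverse (g (X t)))) (at t)"
        unfolding has_field_derivative_def
      proof (rule has_derivative_inverse_strong_x)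
        show "(T has_derivative (*) (inverse (g (X t)))) (at (X t))"
          using T X by (auto simp: has_field_derivative_def)
        show "(*) (inverse (g (X t))) \<circ> (*) (inverse (inverse (g (X t)))) = id"
          using pos[OF X(1,2), of t] by (auto simp: fun_eq_iff)
        show "continuous_on {l<..<r} T"
          using T by (auto intro!: continuous_at_imp_continuous_on DERIV_isCont)
      qed (use X XT in auto)
      then show ?thesis by simp
    qed
    show "(X \<longlongrightarrow> r) at_top"
    proof (rule order_tendstoI)
      fix y assume "y < r"
      define x where "x = max ((y + r) / 2) x0"
      have x: "l < x" "x < r" "y < x" using \<open>y < r\<close> x0 by (auto simp: x_def max_def field_simps)
      show "\<forall>\<^sub>F t in at_top. y < X t"
        using eventually_ge_at_top[of "T x"]
        by eventually_elim (use Xmono x in force)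
    qed (use X in \<open>auto intro: less_trans always_eventually\<close>)
    show "(X \<longlongrightarrow> l) at_bot"
    proof (rule order_tendstoI)
      fix y assume "l < y"
      define x where "x = min ((y + l) / 2) x0"
      have x: "l < x" "x < r" "x < y" using \<open>l < y\<close> x0 by (auto simp: x_def min_def field_simps)
      show "\<forall>\<^sub>F t in at_bot. X t < y"
        using eventually_le_at_bot[of "T x"]
        by eventually_elim (use Xmono' x in force)
    qed (use X in \<open>auto intro: less_trans always_eventually\<close>)
  qed
qed

text \<open>In the phases \<alpha> x and \<beta> y, with \<kappa> = \<open>\<alpha>\<^sup>2\<close>
  and \<mu> = \<open>\<beta>\<^sup>2\<close>, this is the ascending gradient flow of sin (\<alpha>
  x) sin (\<beta> y). Saddles lie at multiples of pi, extrema at odd multiples of pi / 2 in both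
  phases.\<close>

definition saddle_system :: "real \<Rightarrow> real \<Rightarrow> (real \<Rightarrow> real) \<Rightarrow> (real \<Rightarrow> real) \<Rightarrow> bool" where
  "saddle_system \<kappa> \<mu> X Y \<longleftrightarrow>
     (\<forall>t. (X has_real_derivative \<kappa> * (cos (X t) * sin (Y t))) (at t)) \<and>
     (\<forall>t. (Y has_real_derivative \<mu> * (sin (X t) * cos (Y t))) (at t))"

text \<open>The ratio of \<open>\<bar>cos Y\<bar> powr \<kappa>\<close> and \<open>\<bar>cos X\<bar> powr \<mu>\<close> is conserved, so an orbit is a graph over
  the first coordinate, and the time parametrization is found by quadrature.\<close>

lemma saddle_system_graph:
  fixes \<kappa> \<mu> :: real
  assumes pos: "\<kappa> > 0" "\<mu> > 0"
    and \<xi>: "l < \<xi>" "\<xi> < r" and lr: "- pi / 2 \<le> l" "r \<le> pi / 2" and \<eta>: "0 < \<eta>" "\<eta> < pi"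
    and q: "\<And>x. q x = cos \<eta> * (cos x / cos \<xi>) powr (\<mu> / \<kappa>)"
    and q1: "\<And>x. l < x \<Longrightarrow> x < r \<Longrightarrow> \<bar>q x\<bar> < 1"
    and lbd: "\<And>x. l < x \<Longrightarrow> x < r \<Longrightarrow> cos x * sqrt (1 - (q x)\<^sup>2) \<le> C * (x - l)"
    and rbd: "\<And>x. l < x \<Longrightarrow> x < r \<Longrightarrow> cos x * sqrt (1 - (q x)\<^sup>2) \<le> C * (r - x)"
  obtains X where "X 0 = \<xi>" "arccos (q (X 0)) = \<eta>" "\<And>t. l < X t" "\<And>t. X t < r"
    "saddle_system \<kappa> \<mu> X (\<lambda>t. arccos (q (X t)))"
    "(X \<longlongrightarrow> r) at_top" "(X \<longlongrightarrow> l) at_bot"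
proof -
  \<comment> \<open>On the graph cos Y = q X with Y in (0, pi), sin Y is the nonnegative root, so
    the equation for X becomes autonomous.\<close>
  define g where "g x = \<kappa> * (cos x * sqrt (1 - (q x)\<^sup>2))" for x
  have cospos: "0 < cos x" if "l < x" "x < r" for x
    using that lr by (intro cos_gt_zero_pi) auto
  have sq: "(q x)\<^sup>2 < 1" if "l < x" "x < r" for x
    using q1[OF that] by (simp add: abs_square_less_1)
  have qd: "(q has_real_derivative - (\<mu> / \<kappa>) * q x * (sin x / cos x)) (at x)" if "l < x" "x < r" for x
  proof -
    have "q = (\<lambda>x. cos \<eta> * (cos x / cos \<xi>) powr (\<mu> / \<kappa>))" using q by auto
    moreover have "cos x / cos \<xi> > 0" using cospos that \<xi> by simp
    ultimately show ?thesis
      using cospos[OF that] cospos[OF \<xi>]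
      by (auto intro!: derivative_eq_intros simp: powr_diff field_simps)
  qed
  have qc: "isCont q x" if "l < x" "x < r" for x using qd[OF that] DERIV_isCont by blast
  have gc: "continuous_on {l<..<r} g"
    unfolding g_def by (intro continuous_at_imp_continuous_on ballI continuous_intros qc) auto
  have gpos: "g x > 0" if "l < x" "x < r" for x
    using cospos[OF that] sq[OF that] pos by (simp add: g_def)
  have gl: "g x \<le> (\<kappa> * C) * (x - l)" if "l < x" "x < r" for x
    using lbd[OF that] pos by (simp add: g_def)
  have gr: "g x \<le> (\<kappa> * C) * (r - x)" if "l < x" "x < r" for x
    using rbd[OF that] pos by (simp add: g_def)
  obtain X where X: "X 0 = \<xi>" "\<And>t. l < X t" "\<And>t. X t < r"
    "\<And>t. (X has_real_derivative g (X t)) (at t)"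
    "(X \<longlongrightarrow> r) at_top" "(X \<longlongrightarrow> l) at_bot"
    using autonomous_solution[OF \<xi> gc gpos gl gr] by blast
  show thesis
  proof (rule that[of X])
    show "arccos (q (X 0)) = \<eta>"
      using X(1) cospos[OF \<xi>] \<eta> by (simp add: q arccos_cos)
    have bd: "-1 \<le> q (X t)" "q (X t) \<le> 1" "-1 < q (X t)" "q (X t) < 1" for t
      using q1[OF X(2,3), of t] by auto
    have sn: "sin (arccos (q (X t))) = sqrt (1 - (q (X t))\<^sup>2)" for t
      using bd by (simp add: sin_arccos_abs abs_le_iff)
    show "saddle_system \<kappa> \<mu> X (\<lambda>t. arccos (q (X t)))"
      unfolding saddle_system_def
    proof (intro conjI allI)
      fix t
      show "(X has_real_derivative \<kappa> * (cos (X t) * sin (arccos (q (X t))))) (at t)"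
        using X(4)[of t] by (simp add: sn g_def)
      have "((\<lambda>t. arccos (q (X t))) has_real_derivative
          inverse (- sqrt (1 - (q (X t))\<^sup>2)) * ((- (\<mu> / \<kappa>) * q (X t) * (sin (X t) / cos (X t))) * g (X t))) (at t)"
        by (rule DERIV_chain2[OF DERIV_arccos DERIV_chain2[OF qd X(4)]]) (use bd X in auto)
      moreover have "inverse (- sqrt (1 - (q (X t))\<^sup>2)) * ((- (\<mu> / \<kappa>) * q (X t) * (sin (X t) / cos (X t))) * g (X t))
          = \<mu> * (sin (X t) * q (X t))"
        using sq[OF X(2,3), of t] cospos[OF X(2,3), of t] pos
        by (simp add: g_def field_simps)
      ultimately show "((\<lambda>t. arccos (q (X t))) has_real_derivative \<mu> * (sin (X t) * cos (arccos (q (X t))))) (at t)"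
        using bd by simp
    qed
  qed (use X in auto)
qed

text \<open>Bernoulli's inequality after raising the exponent to the next integer. It controls 1 -
  q^2 at a saddle, where q tends to 1 or -1.\<close>

lemma one_minus_powr_le:
  fixes p s :: real
  assumes "0 < p" "p \<le> 1" "0 < s"
  shows "1 - p powr s \<le> real (nat \<lceil>s\<rceil>) * (1 - p)"
proof -
  define n where "n = nat \<lceil>s\<rceil>"
  have "s \<le> real n" unfolding n_def by (rule real_nat_ceiling_ge)
  then have "p powr real n \<le> p powr s" using assms by (intro powr_mono') auto
  moreover have "1 + real n * (p - 1) \<le> (1 + (p - 1)) ^ n"
    using assms by (intro Bernoulli_inequality) auto
  moreover have "p powr real n = p ^ n" using assms by (simp add: powr_realpow)
  ultimately show ?thesis unfolding n_def[symmetric] by (simp add: algebra_simps)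
qed

lemma cos_le_linear:
  fixes x :: real
  assumes "- pi / 2 \<le> x" "x \<le> pi / 2"
  shows "cos x \<le> pi / 2 - x" "cos x \<le> x + pi / 2"
proof -
  have "cos x = sin (pi / 2 - x)" "cos x = sin (x + pi / 2)"
    by (simp_all add: sin_diff sin_add)
  moreover have "sin (pi / 2 - x) \<le> pi / 2 - x" "sin (x + pi / 2) \<le> x + pi / 2"
    using assms by (auto intro!: sin_x_le_x)
  ultimately show "cos x \<le> pi / 2 - x" "cos x \<le> x + pi / 2" by simp_all
qed

lemma powr_compare:
  fixes x y \<kappa> \<mu> :: real
  assumes "\<kappa> > 0" "x \<ge> 0" "y \<ge> 0"
  shows "x powr \<kappa> < y powr \<mu> \<longleftrightarrow> x < y powr (\<mu> / \<kappa>)"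
    and "x powr \<kappa> = y powr \<mu> \<longleftrightarrow> x = y powr (\<mu> / \<kappa>)"
proof -
  have *: "y powr \<mu> = (y powr (\<mu> / \<kappa>)) powr \<kappa>" using assms by (simp add: powr_powr)
  show "x powr \<kappa> < y powr \<mu> \<longleftrightarrow> x < y powr (\<mu> / \<kappa>)"
    unfolding * using assms
    by (metis linorder_not_less powr_ge_zero powr_less_mono2 powr_mono2 less_imp_le)
  show "x powr \<kappa> = y powr \<mu> \<longleftrightarrow> x = y powr (\<mu> / \<kappa>)"
    unfolding * using assms
    by (metis linorder_neqE powr_ge_zero powr_less_mono2 less_irrefl)
qed

text \<open>The strict inequality keeps \<open>\<bar>q\<bar>\<close> below 1 over the whole
  interval, so the graph never meets Y = 0 or Y = pi. At both ends cos X tends to 0, hence so does q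
  and Y tends to pi / 2: the limits are two neighbouring extrema of opposite sign.\<close>

lemma saddle_system_max_to_min:
  fixes \<kappa> \<mu> :: real
  assumes pos: "\<kappa> > 0" "\<mu> > 0"
    and \<xi>: "- pi / 2 < \<xi>" "\<xi> < pi / 2" and \<eta>: "0 < \<eta>" "\<eta> < pi"
    and less: "\<bar>cos \<eta>\<bar> powr \<kappa> < \<bar>cos \<xi>\<bar> powr \<mu>"
  obtains X Y where "X 0 = \<xi>" "Y 0 = \<eta>" "saddle_system \<kappa> \<mu> X Y"
    "(X \<longlongrightarrow> pi / 2) at_top" "(X \<longlongrightarrow> - pi / 2) at_bot"
    "(Y \<longlongrightarrow> pi / 2) at_top" "(Y \<longlongrightarrow> pi / 2) at_bot"
proof -
  define q where "q x = cos \<eta> * (cos x / cos \<xi>) powr (\<mu> / \<kappa>)" for x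
  have c\<xi>: "cos \<xi> > 0" using \<xi> by (intro cos_gt_zero_pi) auto
  have less': "\<bar>cos \<eta>\<bar> < cos \<xi> powr (\<mu> / \<kappa>)"
    using less c\<xi> pos by (subst (asm) powr_compare) auto
  have q1: "\<bar>q x\<bar> < 1" if "- pi / 2 < x" "x < pi / 2" for x
  proof -
    have cx: "cos x > 0" using that by (intro cos_gt_zero_pi) auto
    then have "cos x powr (\<mu> / \<kappa>) \<le> 1" using pos by (simp add: powr_le1)
    moreover have "cos x powr (\<mu> / \<kappa>) > 0" using cx by simp
    moreover have "\<bar>q x\<bar> = \<bar>cos \<eta>\<bar> / cos \<xi> powr (\<mu> / \<kappa>) * cos x powr (\<mu> / \<kappa>)"
      using cx c\<xi> by (simp add: q_def abs_mult powr_divide)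
    moreover have "\<bar>cos \<eta>\<bar> / cos \<xi> powr (\<mu> / \<kappa>) < 1" using less' c\<xi> by (simp add: field_simps)
    ultimately show ?thesis by (smt (verit) divide_nonneg_nonneg mult_less_cancel_right2)
  qed
  have bd: "cos x * sqrt (1 - (q x)\<^sup>2) \<le> 1 * (x - - pi / 2)" "cos x * sqrt (1 - (q x)\<^sup>2) \<le> 1 * (pi / 2 - x)"
    if "- pi / 2 < x" "x < pi / 2" for x
  proof -
    have "cos x > 0" using that by (intro cos_gt_zero_pi) auto
    moreover have "sqrt (1 - (q x)\<^sup>2) \<le> 1" by simp
    ultimately have "cos x * sqrt (1 - (q x)\<^sup>2) \<le> cos x" by (simp add: mult_left_le)
    then show "cos x * sqrt (1 - (q x)\<^sup>2) \<le> 1 * (x - - pi / 2)" "cos x * sqrt (1 - (q x)\<^sup>2) \<le> 1 * (pi / 2 - x)"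
      using cos_le_linear[of x] that by auto
  qed
  obtain X where X: "X 0 = \<xi>" "arccos (q (X 0)) = \<eta>" "\<And>t. - pi / 2 < X t" "\<And>t. X t < pi / 2"
    "saddle_system \<kappa> \<mu> X (\<lambda>t. arccos (q (X t)))"
    "(X \<longlongrightarrow> pi / 2) at_top" "(X \<longlongrightarrow> - pi / 2) at_bot"
    using saddle_system_graph[OF pos \<xi> order.refl order.refl \<eta> q_def q1 bd] by metis
  have "((\<lambda>t. arccos (q (X t))) \<longlongrightarrow> pi / 2) F" if "((\<lambda>t. cos (X t)) \<longlongrightarrow> 0) F" for F
  proof -
    have "((\<lambda>t. cos (X t) / cos \<xi>) \<longlongrightarrow> 0 / cos \<xi>) F"
      using that c\<xi> by (intro tendsto_intros) auto
    then have l: "((\<lambda>t. cos (X t) / cos \<xi>) \<longlongrightarrow> 0) F" by simp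
    have "\<forall>t. 0 \<le> cos (X t) / cos \<xi>"
      using X(3,4) c\<xi> cos_gt_zero_pi by (intro allI divide_nonneg_pos) (simp_all add: less_imp_le)
    then have "((\<lambda>t. (cos (X t) / cos \<xi>) powr (\<mu> / \<kappa>)) \<longlongrightarrow> 0) F"
      using pos l by (intro tendsto_zero_powrI[OF l tendsto_const]) auto
    then have "((\<lambda>t. q (X t)) \<longlongrightarrow> cos \<eta> * 0) F" unfolding q_def by (rule tendsto_mult_left)
    then have "((\<lambda>t. arccos (q (X t))) \<longlongrightarrow> arccos 0) F"
      by (intro isCont_tendsto_compose[OF isCont_arccos]) auto
    then show ?thesis by simp
  qed
  moreover have "((\<lambda>t. cos (X t)) \<longlongrightarrow> cos (pi / 2)) at_top" "((\<lambda>t. cos (X t)) \<longlongrightarrow> cos (- pi / 2)) at_bot"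
    by (intro tendsto_cos X)+
  ultimately show thesis using X by (intro that[of X "\<lambda>t. arccos (q (X t))"]) auto
qed

text \<open>Equality turns \<open>\<bar>q x\<bar>\<close> into a power of cos x, which reaches 1
  exactly at x = 0. The orbit is thus a graph over (0, pi / 2) only, and its backward limit is a
  saddle. One such end puts a point into the stable or unstable set of a saddle.\<close>

lemma saddle_system_separatrix:
  fixes \<kappa> \<mu> :: real
  assumes pos: "\<kappa> > 0" "\<mu> > 0"
    and \<xi>: "0 < \<xi>" "\<xi> < pi / 2" and \<eta>: "0 < \<eta>" "\<eta> < pi"
    and eq: "\<bar>cos \<eta>\<bar> powr \<kappa> = \<bar>cos \<xi>\<bar> powr \<mu>"
  obtains X Y e where "X 0 = \<xi>" "Y 0 = \<eta>" "saddle_system \<kappa> \<mu> X Y"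
    "\<And>t. 0 < X t" "\<And>t. X t < pi / 2" "\<And>t. 0 < Y t" "\<And>t. Y t < pi"
    "(X \<longlongrightarrow> 0) at_bot" "(Y \<longlongrightarrow> e) at_bot" "e = 0 \<or> e = pi"
proof -
  define q where "q x = cos \<eta> * (cos x / cos \<xi>) powr (\<mu> / \<kappa>)" for x
  have c\<xi>: "cos \<xi> > 0" using \<xi> by (intro cos_gt_zero_pi) auto
  have eq': "\<bar>cos \<eta>\<bar> = cos \<xi> powr (\<mu> / \<kappa>)"
    using eq c\<xi> pos by (subst (asm) powr_compare) auto
  have qa: "\<bar>q x\<bar> = cos x powr (\<mu> / \<kappa>)" if "0 \<le> x" "x < pi / 2" for x
  proof -
    have "cos x > 0" using that by (intro cos_gt_zero_pi) auto
    then show ?thesis using c\<xi> eq' by (simp add: q_def abs_mult powr_divide)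
  qed
  have cx: "0 < cos x" "cos x < 1" if "0 < x" "x < pi / 2" for x
  proof -
    show "0 < cos x" using that by (intro cos_gt_zero_pi) auto
    have "cos x < cos 0" using that by (intro cos_monotone_0_pi) auto
    then show "cos x < 1" by simp
  qed
  have q1: "\<bar>q x\<bar> < 1" if "0 < x" "x < pi / 2" for x
  proof -
    have "cos x powr (\<mu> / \<kappa>) < 1 powr (\<mu> / \<kappa>)"
      using cx[OF that] pos by (intro powr_less_mono2) auto
    then show ?thesis using qa that by simp
  qed
  \<comment> \<open>The exponent rounded up, as in Bernoulli's inequality. With N at least 1 it is
    also bounded by N^2, so that a square root can be taken below, and N serves at the right end
    too.\<close>
  define N where "N = max 1 (real (nat \<lceil>\<mu> / \<kappa>\<rceil>))"
  have N1: "N \<ge> 1" by (simp add: N_def)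
  have bdr: "cos x * sqrt (1 - (q x)\<^sup>2) \<le> N * (pi / 2 - x)"
    if "0 < x" "x < pi / 2" for x
  proof -
    have "sqrt (1 - (q x)\<^sup>2) \<le> 1" by simp
    then have "cos x * sqrt (1 - (q x)\<^sup>2) \<le> cos x" using cx[OF that] by (simp add: mult_left_le)
    also have "\<dots> \<le> 1 * (pi / 2 - x)" using cos_le_linear[of x] that by auto
    also have "\<dots> \<le> N * (pi / 2 - x)" using that N1 by (intro mult_right_mono) auto
    finally show ?thesis .
  qed
  \<comment> \<open>At the saddle end cos x tends to 1 and gives no decay; the linear bound has to
    come from the root, since 1 - q^2 is at most a multiple of sin^2.\<close>
  have bdl: "cos x * sqrt (1 - (q x)\<^sup>2) \<le> N * (x - 0)"
    if "0 < x" "x < pi / 2" for x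
  proof -
    have "(q x)\<^sup>2 = \<bar>q x\<bar>\<^sup>2" by simp
    also have "\<dots> = ((cos x)\<^sup>2) powr (\<mu> / \<kappa>)"
      using qa[of x] that cx[OF that] by (simp add: power2_eq_square powr_mult)
    finally have "1 - (q x)\<^sup>2 \<le> real (nat \<lceil>\<mu> / \<kappa>\<rceil>) * (1 - (cos x)\<^sup>2)"
      using one_minus_powr_le[of "(cos x)\<^sup>2" "\<mu> / \<kappa>"] cx[OF that] pos
      by (simp add: power_le_one)
    also have "\<dots> = real (nat \<lceil>\<mu> / \<kappa>\<rceil>) * (sin x)\<^sup>2" by (simp add: sin_squared_eq)
    also have "\<dots> \<le> N\<^sup>2 * x\<^sup>2"
    proof (intro mult_mono)
      have "N * 1 \<le> N * N" using N1 by (intro mult_left_mono) auto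
      then show "real (nat \<lceil>\<mu> / \<kappa>\<rceil>) \<le> N\<^sup>2" by (simp add: N_def power2_eq_square)
      show "(sin x)\<^sup>2 \<le> x\<^sup>2" using that by (intro power_mono sin_x_le_x sin_ge_zero) auto
    qed auto
    finally have "sqrt (1 - (q x)\<^sup>2) \<le> N * x"
      using that N1 by (intro real_le_lsqrt) (auto simp: power_mult_distrib)
    moreover have "sqrt (1 - (q x)\<^sup>2) \<ge> 0" using q1[OF that] by (simp add: abs_square_le_1)
    ultimately have "cos x * sqrt (1 - (q x)\<^sup>2) \<le> 1 * (N * x)"
      using cx[OF that] by (intro mult_mono) auto
    then show ?thesis by simp
  qed
  obtain X where X: "X 0 = \<xi>" "arccos (q (X 0)) = \<eta>" "\<And>t. 0 < X t" "\<And>t. X t < pi / 2"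
    "saddle_system \<kappa> \<mu> X (\<lambda>t. arccos (q (X t)))"
    "(X \<longlongrightarrow> pi / 2) at_top" "(X \<longlongrightarrow> 0) at_bot"
    using saddle_system_graph[OF pos \<xi> _ order.refl \<eta> q_def q1 bdl bdr] by auto
  \<comment> \<open>The sign is that of cos \<eta>; it decides whether the saddle is at height 0 or
    pi.\<close>
  have q0: "q 0 = 1 \<or> q 0 = -1" using qa[of 0] by (auto simp: abs_if split: if_splits)
  have "isCont q 0" unfolding q_def using c\<xi> by (auto intro!: continuous_intros)
  then have "((\<lambda>t. q (X t)) \<longlongrightarrow> q 0) at_bot"
    using X(7) by (rule isCont_tendsto_compose)
  moreover have bd: "-1 < q (X t)" "q (X t) < 1" for t using q1[OF X(3,4), of t] by auto
  ultimately have lim: "((\<lambda>t. arccos (q (X t))) \<longlongrightarrow> arccos (q 0)) at_bot"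
    using q0 by (intro continuous_on_tendsto_compose[OF continuous_on_arccos', where F=at_bot])
      (auto simp: less_imp_le)
  have arc: "0 < arccos (q (X t))" "arccos (q (X t)) < pi" for t
    using arccos_lt_bounded[OF bd] by auto
  show thesis
    by (rule that[OF X(1,2,5,3,4) arc X(7) lim]) (use q0 in auto)
qed

section \<open>Lattice points in a quarter ellipse\<close>

text \<open>F s is the area of the part of the quarter ellipse with abscissa at most s. At the right
  end arcsin is not differentiable, so only continuity is claimed there.\<close>

lemma ellipse_area_function:
  fixes a b R :: real
  assumes "a > 0" "b > 0" "R > 0"
  obtains F where "F 0 = 0" "F (a * R) = pi * a * b * R\<^sup>2 / 4" "continuous_on {0..a*R} F"
    "\<And>s. 0 < s \<Longrightarrow> s < a * R \<Longrightarrow> (F has_real_derivative b * sqrt (R\<^sup>2 - (s / a)\<^sup>2)) (at s)"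
proof -
  define F where "F s = b / 2 * (s * sqrt (R\<^sup>2 - (s / a)\<^sup>2) + a * R\<^sup>2 * arcsin (s / (a * R)))" for s
  show thesis
  proof (rule that[of F])
    show "F 0 = 0" by (simp add: F_def)
    show "F (a * R) = pi * a * b * R\<^sup>2 / 4" using assms by (simp add: F_def field_simps)
    show "continuous_on {0..a*R} F"
    proof -
      have "0 \<le> x \<Longrightarrow> x / (a * R) \<ge> -1" for x
        using assms divide_nonneg_pos[of x "a * R"] by (smt (verit) mult_pos_pos)
      moreover have "x \<le> a * R \<Longrightarrow> x / (a * R) \<le> 1" for x using assms by (simp add: field_simps)
      ultimately show ?thesis
        unfolding F_def using assms by (intro continuous_intros) auto
    qed
    fix s assume s: "0 < s" "s < a * R"
    define w where "w = sqrt (R\<^sup>2 - (s / a)\<^sup>2)"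
    have "(s / a)\<^sup>2 < R\<^sup>2" using s assms by (intro power_strict_mono) (auto simp: field_simps)
    then have w: "w > 0" "w\<^sup>2 = R\<^sup>2 - (s / a)\<^sup>2" by (auto simp: w_def)
    have "(w / R)\<^sup>2 = (R\<^sup>2 - (s / a)\<^sup>2) / R\<^sup>2" by (simp add: power_divide w)
    also have "\<dots> = 1 - (s / (a * R))\<^sup>2"
      using assms by (simp add: diff_divide_distrib power_divide power_mult_distrib)
    finally have "sqrt (1 - (s / (a * R))\<^sup>2) = sqrt ((w / R)\<^sup>2)" by simp
    then have ws: "sqrt (1 - (s / (a * R))\<^sup>2) = w / R" using w assms by simp
    have "((\<lambda>s. arcsin (s / (a * R))) has_real_derivative inverse (sqrt (1 - (s / (a * R))\<^sup>2)) * (1 / (a * R))) (at s)"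
    proof (rule DERIV_chain2[OF DERIV_arcsin])
      have "s / (a * R) > 0" using s assms by simp
      then show "-1 < s / (a * R)" by simp
      show "s / (a * R) < 1" using s assms by simp
      show "((\<lambda>s. s / (a * R)) has_real_derivative 1 / (a * R)) (at s)"
        using assms by (auto intro!: derivative_eq_intros)
    qed
    then have d1: "((\<lambda>s. arcsin (s / (a * R))) has_real_derivative 1 / (a * w)) (at s)"
      unfolding ws using assms by (simp add: field_simps)
    have d2: "((\<lambda>s. sqrt (R\<^sup>2 - (s / a)\<^sup>2)) has_real_derivative - (s / a\<^sup>2) / w) (at s)"
    proof -
      have "((\<lambda>s. sqrt (R\<^sup>2 - (s / a)\<^sup>2)) has_real_derivative inverse (sqrt (R\<^sup>2 - (s / a)\<^sup>2)) / 2 * (- 2 * s / a\<^sup>2)) (at s)"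
        by (rule DERIV_chain2[OF DERIV_real_sqrt])
          (use \<open>(s / a)\<^sup>2 < R\<^sup>2\<close> assms in \<open>auto intro!: derivative_eq_intros simp: power2_eq_square\<close>)
      then show ?thesis unfolding w_def[symmetric] by (simp add: inverse_eq_divide mult.commute)
    qed
    have "(F has_real_derivative b / 2 * ((1 * w + s * (- (s / a\<^sup>2) / w)) + a * R\<^sup>2 * (1 / (a * w)))) (at s)"
      unfolding F_def w_def
      by (rule derivative_eq_intros d1[unfolded w_def] d2[unfolded w_def] refl)+ (simp add: field_simps)
    moreover have "b / 2 * ((1 * w + s * (- (s / a\<^sup>2) / w)) + a * R\<^sup>2 * (1 / (a * w)))
        = b / 2 * (w\<^sup>2 + (R\<^sup>2 - (s / a)\<^sup>2)) / w"
      using w(1) assms by (simp add: field_simps power2_eq_square)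
    moreover have "b / 2 * (w\<^sup>2 + (R\<^sup>2 - (s / a)\<^sup>2)) / w = b * w"
      unfolding w(2)[symmetric] using w(1) by (simp add: power2_eq_square)
    ultimately show "(F has_real_derivative b * sqrt (R\<^sup>2 - (s / a)\<^sup>2)) (at s)"
      unfolding w_def[symmetric] by (simp only:)
  qed
qed

text \<open>The index pairs of modes whose eigenvalue is at most
  \<open>pi\<^sup>2 * R\<^sup>2\<close>; an index 0 would give the zero function.\<close>

definition lattice_points :: "real \<Rightarrow> real \<Rightarrow> real \<Rightarrow> (nat \<times> nat) set" where
  "lattice_points a b R = {(m, n). 1 \<le> m \<and> 1 \<le> n \<and> (m / a)\<^sup>2 + (n / b)\<^sup>2 \<le> R\<^sup>2}"

text \<open>Column m holds the integer part of the height h m. As h decreases, h m is at most the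
  area over the unit interval to its left and at least the area over the one to its right. The upper
  bound therefore has no error term. The lower bound loses h 0 = b R by the shift of columns, and at
  most 1 for rounding in each of at most a R columns.\<close>

lemma lattice_points_bounds:
  fixes a b R :: real
  assumes ab: "a > 0" "b > 0" and R: "R > 0"
  shows "finite (lattice_points a b R)"
    and "real (card (lattice_points a b R)) \<le> pi * a * b * R\<^sup>2 / 4"
    and "pi * a * b * R\<^sup>2 / 4 - (a + b) * R \<le> real (card (lattice_points a b R))"
proof -
  define h where "h s = b * sqrt (R\<^sup>2 - (s / a)\<^sup>2)" for s
  define M where "M = nat \<lfloor>a * R\<rfloor>"
  have M: "real M \<le> a * R" "a * R < real M + 1" using ab R by (auto simp: M_def)
  have hmono: "h t \<le> h s" if "0 \<le> s" "s \<le> t" for s t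
  proof -
    have "(s / a)\<^sup>2 \<le> (t / a)\<^sup>2" using that ab by (intro power_mono divide_right_mono) auto
    then show ?thesis using ab by (simp add: h_def)
  qed
  have hpos: "h s \<ge> 0" if "0 \<le> s" "s \<le> a * R" for s
  proof -
    have "(s / a)\<^sup>2 \<le> R\<^sup>2" using that ab by (intro power_mono) (auto simp: field_simps)
    then show ?thesis using ab by (simp add: h_def)
  qed
  have h0: "h 0 = b * R" using R by (simp add: h_def)
  have mem: "(m, n) \<in> lattice_points a b R \<longleftrightarrow> m \<in> {1..M} \<and> n \<in> {1..nat \<lfloor>h m\<rfloor>}" for m n
  proof (cases "m \<le> M")
    case True
    then have ma: "(m / a)\<^sup>2 \<le> R\<^sup>2" using M ab by (intro power_mono) (auto simp: field_simps)
    have nb: "sqrt ((n / b)\<^sup>2) = n / b" using ab by simp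
    have "(m / a)\<^sup>2 + (n / b)\<^sup>2 \<le> R\<^sup>2 \<longleftrightarrow> (n / b)\<^sup>2 \<le> R\<^sup>2 - (m / a)\<^sup>2" by auto
    also have "\<dots> \<longleftrightarrow> sqrt ((n / b)\<^sup>2) \<le> sqrt (R\<^sup>2 - (m / a)\<^sup>2)" by (simp only: real_sqrt_le_iff)
    also have "\<dots> \<longleftrightarrow> real n \<le> h m" unfolding nb h_def using ab by (simp only: pos_divide_le_eq mult.commute)
    also have "\<dots> \<longleftrightarrow> n \<le> nat \<lfloor>h m\<rfloor>" using hpos[of m] True M by (simp add: le_nat_iff le_floor_iff)
    finally show ?thesis using True by (auto simp: lattice_points_def)
  next
    case False
    then have "R < m / a" using M ab by (simp add: field_simps)
    then have "R\<^sup>2 < (m / a)\<^sup>2" using R by (intro power_strict_mono) auto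
    then have "\<not> (m / a)\<^sup>2 + (n / b)\<^sup>2 \<le> R\<^sup>2" using zero_le_power2[of "n / b"] by linarith
    then show ?thesis using False by (auto simp: lattice_points_def)
  qed
  have eq: "lattice_points a b R = (SIGMA m:{1..M}. {1..nat \<lfloor>h (real m)\<rfloor>})"
    using mem by auto
  show "finite (lattice_points a b R)" unfolding eq by auto
  have card: "real (card (lattice_points a b R)) = (\<Sum>m=1..M. real (nat \<lfloor>h (real m)\<rfloor>))"
    unfolding eq by (subst card_SigmaI) auto
  obtain F where F: "F 0 = 0" "F (a * R) = pi * a * b * R\<^sup>2 / 4" "continuous_on {0..a*R} F"
    "\<And>s. 0 < s \<Longrightarrow> s < a * R \<Longrightarrow> (F has_real_derivative h s) (at s)"
    using ellipse_area_function[OF ab R] unfolding h_def by metis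
  have mvt: "(t - s) * h t \<le> F t - F s \<and> F t - F s \<le> (t - s) * h s" if "0 \<le> s" "s \<le> t" "t \<le> a * R" for s t
  proof (cases "s = t")
    case False
    then have st: "s < t" using that by simp
    have "\<exists>l z. s < z \<and> z < t \<and> (F has_real_derivative l) (at z) \<and> F t - F s = (t - s) * l"
    proof (rule MVT[OF st])
      show "continuous_on {s..t} F" by (rule continuous_on_subset[OF F(3)]) (use that in auto)
      show "F differentiable (at x)" if "s < x" "x < t" for x
        using F(4)[of x] that \<open>0 \<le> s\<close> \<open>t \<le> a * R\<close> real_differentiable_def by fastforce
    qed
    then obtain l z where z: "s < z" "z < t" "(F has_real_derivative l) (at z)" "F t - F s = (t - s) * l" by blast
    then have "l = h z" using F(4)[of z] that by (intro DERIV_unique) auto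
    then have "h t \<le> l" "l \<le> h s" using hmono that z by auto
    then show ?thesis unfolding z(4) using st by (auto intro: mult_left_mono)
  qed simp
  have FM: "F (real k) = (\<Sum>m=1..k. F (real m) - F (real m - 1))" for k
    by (induction k) (auto simp: F(1))
  have "real (card (lattice_points a b R)) \<le> (\<Sum>m=1..M. h (real m))"
    unfolding card using hpos M by (intro sum_mono) (force simp: of_nat_floor)
  also have "\<dots> \<le> (\<Sum>m=1..M. F (real m) - F (real m - 1))"
  proof (rule sum_mono)
    fix m assume "m \<in> {1..M}"
    then show "h (real m) \<le> F (real m) - F (real m - 1)"
      using mvt[of "real m - 1" "real m"] M by auto
  qed
  also have "\<dots> = F (real M)" by (rule FM[symmetric])
  also have "\<dots> \<le> F (a * R)"
  proof -
    have "0 \<le> (a * R - real M) * h (a * R)"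
      using M hpos[of "a * R"] ab R by (intro mult_nonneg_nonneg) auto
    then show ?thesis using mvt[of "real M" "a * R"] M by auto
  qed
  finally show "real (card (lattice_points a b R)) \<le> pi * a * b * R\<^sup>2 / 4" using F(2) by simp
  have "F (a * R) \<le> F (real M) + (a * R - real M) * h (real M)" using mvt[of "real M" "a * R"] M by auto
  \<comment> \<open>The strip beyond the last full column has width less than 1. The term h M that
    it costs is cancelled by the index shift below.\<close>
  also have "\<dots> \<le> F (real M) + 1 * h (real M)"
    using M hpos[of "real M"] by (intro add_left_mono mult_right_mono) auto
  also have "F (real M) = (\<Sum>m=1..M. F (real m) - F (real m - 1))" by (rule FM)
  also have "\<dots> \<le> (\<Sum>m=1..M. h (real m - 1))"
  proof (rule sum_mono)
    fix m assume "m \<in> {1..M}"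
    then show "F (real m) - F (real m - 1) \<le> h (real m - 1)"
      using mvt[of "real m - 1" "real m"] M by auto
  qed
  also have "(\<Sum>m=1..k. h (real m - 1)) = h 0 - h (real k) + (\<Sum>m=1..k. h (real m))" for k
    by (induction k) auto
  also have "(\<Sum>m=1..M. h (real m)) \<le> (\<Sum>m=1..M. real (nat \<lfloor>h (real m)\<rfloor>) + 1)"
    by (intro sum_mono) linarith
  also have "\<dots> = real (card (lattice_points a b R)) + real M" by (simp add: card sum.distrib)
  finally have "F (a * R) \<le> h 0 + real (card (lattice_points a b R)) + real M" by simp
  then show "pi * a * b * R\<^sup>2 / 4 - (a + b) * R \<le> real (card (lattice_points a b R))"
    using M(1) F(2) h0 by (simp add: algebra_simps)
qed

section \<open>Sine coefficients on a square\<close>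

text \<open>Vanishing sine moments make f sin orthogonal to all polynomials in cos x. By
  Weierstrass, f (arccos y) is a uniform limit of polynomials on [-1, 1], so the integral of f^2 sin
  vanishes.\<close>

lemma sine_system_complete:
  fixes f :: "real \<Rightarrow> real"
  assumes cont: "continuous_on {0..pi} f"
    and zero: "\<And>m::nat. 1 \<le> m \<Longrightarrow> integral {0..pi} (\<lambda>x. f x * sin (real m * x)) = 0"
    and x: "0 < x" "x < pi"
  shows "f x = 0"
proof -
  \<comment> \<open>The product sin (m x) cos x is the mean of the sines with frequencies m + 1 and
    m - 1, which lowers the power of the cosine. For m = 1 the lower frequency is 0 and contributes
    nothing.\<close>
  have mono: "integral {0..pi} (\<lambda>x. f x * sin (real m * x) * cos x ^ k) = 0" if "1 \<le> m" for m k
    using that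
  proof (induction k arbitrary: m)
    case 0
    then show ?case using zero by simp
  next
    case (Suc k)
    have step: "f x * sin (real m * x) * cos x ^ Suc k =
        1 / 2 * (f x * sin (real (Suc m) * x) * cos x ^ k + f x * sin (real (m - 1) * x) * cos x ^ k)" for x
    proof -
      have "f x * sin (real m * x) * cos x ^ Suc k = f x * (sin (real m * x) * cos x) * cos x ^ k" by simp
      also have "sin (real m * x) * cos x = 1 / 2 * (sin (real (Suc m) * x) + sin (real (m - 1) * x))"
        using Suc.prems by (simp add: of_nat_diff distrib_right left_diff_distrib sin_add sin_diff)
      finally show ?thesis by (simp add: algebra_simps)
    qed
    have "integral {0..pi} (\<lambda>x. f x * sin (real m * x) * cos x ^ Suc k) =
       integral {0..pi} (\<lambda>x. 1 / 2 * (f x * sin (real (Suc m) * x) * cos x ^ k + f x * sin (real (m - 1) * x) * cos x ^ k))"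
      by (simp only: step)
    also have "\<dots> = 1 / 2 * (integral {0..pi} (\<lambda>x. f x * sin (real (Suc m) * x) * cos x ^ k) +
       integral {0..pi} (\<lambda>x. f x * sin (real (m - 1) * x) * cos x ^ k))"
      by (subst integral_mult_right, subst integral_add) (auto intro!: integrable_continuous_real continuous_intros cont)
    also have "integral {0..pi} (\<lambda>x. f x * sin (real (Suc m) * x) * cos x ^ k) = 0"
      by (rule Suc.IH) simp
    also have "integral {0..pi} (\<lambda>x. f x * sin (real (m - 1) * x) * cos x ^ k) = 0"
      using Suc.IH[of "m - 1"] Suc.prems by (cases "m = 1") simp_all
    finally show ?case by simp
  qed
  have poly: "integral {0..pi} (\<lambda>x. f x * sin x * p (cos x)) = 0" if rp: "real_polynomial_function p" for p
  proof -
    obtain a n where p: "p = (\<lambda>x. \<Sum>i\<le>n. a i * x ^ i)"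
      using rp unfolding real_polynomial_function_iff_sum by auto
    have "integral {0..pi} (\<lambda>x. f x * sin x * p (cos x)) =
       integral {0..pi} (\<lambda>x. \<Sum>i\<le>n. a i * (f x * sin (real 1 * x) * cos x ^ i))"
      by (simp add: p sum_distrib_left mult_ac)
    also have "\<dots> = (\<Sum>i\<le>n. integral {0..pi} (\<lambda>x. a i * (f x * sin (real 1 * x) * cos x ^ i)))"
      by (rule integral_sum) (auto intro!: integrable_continuous_real continuous_intros cont)
    also have "\<dots> = 0" using mono[of 1] by simp
    finally show ?thesis .
  qed
  obtain B where B: "B > 0" "\<And>x. x \<in> {0..pi} \<Longrightarrow> \<bar>f x\<bar> \<le> B"
  proof -
    have "bounded (f ` {0..pi})"
      using cont by (intro compact_imp_bounded compact_continuous_image) auto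
    then show thesis using that unfolding bounded_pos by force
  qed
  \<comment> \<open>One factor f will be replaced by a polynomial in cos x, the other keeps the
    orthogonality; positivity of sin on (0, pi) makes I a weighted square norm.\<close>
  define I where "I = integral {0..pi} (\<lambda>x. f x * sin x * f x)"
  have small: "\<bar>I\<bar> \<le> e" if e: "e > 0" for e
  proof -
    define d where "d = e / (B * pi)"
    have d: "d > 0" using e B by (simp add: d_def)
    have ca: "continuous_on {-1..1} (\<lambda>y. f (arccos y))"
      by (intro continuous_on_compose2[OF cont continuous_on_arccos']) (auto intro: arccos_lbound arccos_ubound)
    obtain p where p: "real_polynomial_function p" "\<And>y. y \<in> {-1..1} \<Longrightarrow> \<bar>f (arccos y) - p y\<bar> < d"
      using Stone_Weierstrass_real_polynomial_function[OF compact_Icc ca d] by blast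
    have cp: "continuous_on S p" for S
      using p(1) by (simp add: continuous_on_polymonial_function real_polynomial_function_eq)
    have cpc: "continuous_on S (\<lambda>x. p (cos x))" for S
      by (rule continuous_on_compose2[OF cp[of UNIV]]) (auto intro!: continuous_intros)
    have "I = integral {0..pi} (\<lambda>x. f x * sin x * (f x - p (cos x)) + f x * sin x * p (cos x))"
      by (simp add: I_def algebra_simps)
    also have "\<dots> = integral {0..pi} (\<lambda>x. f x * sin x * (f x - p (cos x)))"
      by (subst integral_add) (auto intro!: integrable_continuous_real continuous_intros cont cpc simp: poly[OF p(1)])
    finally have "\<bar>I\<bar> = norm (integral {0..pi} (\<lambda>x. f x * sin x * (f x - p (cos x))))" by simp
    also have "\<dots> \<le> (B * 1 * d) * (pi - 0)"
    proof (rule integral_bound)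
      show "continuous_on {0..pi} (\<lambda>x. f x * sin x * (f x - p (cos x)))"
        by (intro continuous_intros cont cpc)
      show "norm (f t * sin t * (f t - p (cos t))) \<le> B * 1 * d" if t: "t \<in> {0..pi}" for t
      proof -
        have "\<bar>f t - p (cos t)\<bar> \<le> d" using p(2)[of "cos t"] t by (auto simp: arccos_cos)
        then show ?thesis
          unfolding real_norm_def abs_mult using B t d by (intro mult_mono) auto
      qed
    qed auto
    also have "\<dots> = e" using B by (simp add: d_def)
    finally show ?thesis .
  qed
  have "I = 0" using small[of "\<bar>I\<bar> / 2"] by (cases "I = 0") auto
  moreover have "(I = 0) = (\<forall>x\<in>{0..pi}. f x * sin x * f x = 0)"
    unfolding I_def
  proof (rule integral_eq_0_iff)
    show "continuous_on {0..pi} (\<lambda>x. f x * sin x * f x)" by (intro continuous_intros cont)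
    fix x assume "x \<in> {0..pi}"
    then have "sin x * (f x)\<^sup>2 \<ge> 0" by (intro mult_nonneg_nonneg sin_ge_zero) auto
    then show "f x * sin x * f x \<ge> 0" by (simp add: power2_eq_square mult_ac)
  qed simp
  ultimately have "f x * sin x * f x = 0" using x by auto
  then show ?thesis using sin_gt_zero[OF x] by simp
qed

definition square_coeff :: "nat \<Rightarrow> nat \<Rightarrow> (real \<times> real \<Rightarrow> real) \<Rightarrow> real" where
  "square_coeff m n V = integral (cbox (0, 0) (pi, pi)) (\<lambda>z. V z * (sin (real m * fst z) * sin (real n * snd z)))"

text \<open>For fixed n the n-th sine coefficient in the second variable is a continuous function of
  the first one with vanishing sine coefficients; so the one-dimensional statement applies once in
  each variable.\<close>

lemma double_sine_system_complete:
  assumes cont: "continuous_on (cbox (0, 0) (pi, pi)) V"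
    and zero: "\<And>m n. 1 \<le> m \<Longrightarrow> 1 \<le> n \<Longrightarrow> square_coeff m n V = 0"
    and "0 < x" "x < pi" "0 < y" "y < pi"
  shows "V (x, y) = 0"
proof -
  have eq: "cbox (0, 0) (pi, pi) = {0..pi} \<times> {0..pi}" by (auto simp: cbox_Pair_eq)
  have V1: "continuous_on {0..pi} (\<lambda>s. V (s, r))" if "r \<in> {0..pi}" for r
    by (rule continuous_on_compose2[OF cont]) (use that in \<open>auto intro!: continuous_intros\<close>)
  have V2: "continuous_on {0..pi} (\<lambda>r. V (s, r))" if "s \<in> {0..pi}" for s
    by (rule continuous_on_compose2[OF cont]) (use that in \<open>auto intro!: continuous_intros\<close>)
  have inner: "integral {0..pi} (\<lambda>r. V (s, r) * sin (real n * r)) = 0" if s: "0 < s" "s < pi" and n: "1 \<le> n" for s n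
  proof (rule sine_system_complete[OF _ _ s])
    show "continuous_on {0..pi} (\<lambda>s. integral {0..pi} (\<lambda>r. V (s, r) * sin (real n * r)))"
    proof -
      have "continuous_on ({0..pi} \<times> cbox 0 pi) (\<lambda>(s, r). V (s, r) * sin (real n * r))"
        unfolding split_beta using cont eq by (auto intro!: continuous_intros simp: cbox_interval)
      from integral_continuous_on_param[OF this] show ?thesis by (simp add: cbox_interval)
    qed
    fix m :: nat assume m: "1 \<le> m"
    have "continuous_on (cbox (0, 0) (pi, pi)) (\<lambda>z. V z * (sin (real m * fst z) * sin (real n * snd z)))"
      by (intro continuous_intros cont)
    from integral_prod_continuous[OF this]
    have "square_coeff m n V = integral {0..pi} (\<lambda>s. integral {0..pi} (\<lambda>r. V (s, r) * (sin (real m * s) * sin (real n * r))))"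
      by (simp add: square_coeff_def cbox_interval)
    also have "(\<lambda>s. integral {0..pi} (\<lambda>r. V (s, r) * (sin (real m * s) * sin (real n * r)))) =
       (\<lambda>s. integral {0..pi} (\<lambda>r. V (s, r) * sin (real n * r)) * sin (real m * s))"
      by (rule ext, subst integral_mult_left[symmetric]) (simp add: mult_ac)
    finally show "integral {0..pi} (\<lambda>s. integral {0..pi} (\<lambda>r. V (s, r) * sin (real n * r)) * sin (real m * s)) = 0"
      using zero[OF m n] by simp
  qed
  show ?thesis
    by (rule sine_system_complete[where f="\<lambda>r. V (x, r)"])
      (use V2[of x] inner[of x] assms in auto)
qed

text \<open>The integrand is the derivative of
  \<open>f' x * sin (m * x) - m * f x * cos (m * x)\<close>. The sine removes f' at both ends, so
  the coefficient is controlled by the boundary values of f alone.\<close>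

lemma sine_coeff_second_derivative:
  fixes f :: "real \<Rightarrow> real"
  assumes d1: "\<And>x. x \<in> {0..pi} \<Longrightarrow> (f has_real_derivative f' x) (at x within {0..pi})"
    and d2: "\<And>x. x \<in> {0..pi} \<Longrightarrow> (f' has_real_derivative f'' x) (at x within {0..pi})"
    and bd: "\<bar>f 0\<bar> \<le> M" "\<bar>f pi\<bar> \<le> M"
  shows "\<bar>integral {0..pi} (\<lambda>x. (f'' x + (real m)\<^sup>2 * f x) * sin (real m * x))\<bar> \<le> 2 * real m * M"
proof -
  define g where "g x = f' x * sin (real m * x) - real m * f x * cos (real m * x)" for x
  have "((\<lambda>x. (f'' x + (real m)\<^sup>2 * f x) * sin (real m * x)) has_integral (g pi - g 0)) {0..pi}"
  proof (rule fundamental_theorem_of_calculus)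
    fix x assume x: "x \<in> {0..pi}"
    have "(g has_real_derivative ((f'' x * sin (real m * x) + f' x * (cos (real m * x) * real m)) -
        (real m * f' x * cos (real m * x) + real m * f x * (- sin (real m * x) * real m)))) (at x within {0..pi})"
      unfolding g_def by (auto intro!: derivative_eq_intros d1[OF x] d2[OF x])
    then show "(g has_vector_derivative (f'' x + (real m)\<^sup>2 * f x) * sin (real m * x)) (at x within {0..pi})"
      by (simp add: has_real_derivative_iff_has_vector_derivative[symmetric] algebra_simps power2_eq_square)
  qed simp
  then have "integral {0..pi} (\<lambda>x. (f'' x + (real m)\<^sup>2 * f x) * sin (real m * x)) = g pi - g 0"
    by (rule integral_unique)
  also have "g pi - g 0 = real m * (f 0 - f pi * cos (real m * pi))"
    by (simp add: g_def algebra_simps)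
  finally have "\<bar>integral {0..pi} (\<lambda>x. (f'' x + (real m)\<^sup>2 * f x) * sin (real m * x))\<bar> =
      \<bar>real m * (f 0 - f pi * cos (real m * pi))\<bar>" by simp
  also have "\<bar>real m * (f 0 - f pi * cos (real m * pi))\<bar> = real m * \<bar>f 0 - f pi * cos (real m * pi)\<bar>" by (simp add: abs_mult)
  also have "\<dots> \<le> real m * (2 * M)"
  proof (rule mult_left_mono)
    have "\<bar>cos (real m * pi)\<bar> = 1" by (simp add: cos_npi power_abs)
    then have "\<bar>f pi * cos (real m * pi)\<bar> \<le> M" using bd by (simp add: abs_mult)
    then show "\<bar>f 0 - f pi * cos (real m * pi)\<bar> \<le> 2 * M" using bd by linarith
  qed simp
  finally show ?thesis by simp
qed

text \<open>The one-dimensional bound holds on each line parallel to the first axis; the order of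
  integration is exchanged to make that integral the inner one.\<close>

lemma square_coeff_second_derivative:
  fixes V Vs Vss :: "real \<times> real \<Rightarrow> real"
  assumes cV: "continuous_on (cbox (0, 0) (pi, pi)) V" and cVss: "continuous_on (cbox (0, 0) (pi, pi)) Vss"
    and d1: "\<And>s r. s \<in> {0..pi} \<Longrightarrow> r \<in> {0..pi} \<Longrightarrow> ((\<lambda>s. V (s, r)) has_real_derivative Vs (s, r)) (at s within {0..pi})"
    and d2: "\<And>s r. s \<in> {0..pi} \<Longrightarrow> r \<in> {0..pi} \<Longrightarrow> ((\<lambda>s. Vs (s, r)) has_real_derivative Vss (s, r)) (at s within {0..pi})"
    and bd: "\<And>r. r \<in> {0..pi} \<Longrightarrow> \<bar>V (0, r)\<bar> \<le> M \<and> \<bar>V (pi, r)\<bar> \<le> M"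
  shows "\<bar>square_coeff m n (\<lambda>z. Vss z + (real m)\<^sup>2 * V z)\<bar> \<le> 2 * real m * M * pi"
proof -
  define h where "h s r = (Vss (s, r) + (real m)\<^sup>2 * V (s, r)) * (sin (real m * s) * sin (real n * r))" for s r
  have ch: "continuous_on (cbox (0, 0) (pi, pi)) (\<lambda>(s, r). h s r)"
    unfolding h_def split_beta by (auto intro!: continuous_intros cV cVss)
  have "square_coeff m n (\<lambda>z. Vss z + (real m)\<^sup>2 * V z) = integral (cbox (0, 0) (pi, pi)) (\<lambda>(s, r). h s r)"
    by (simp add: square_coeff_def h_def case_prod_unfold)
  also have "\<dots> = integral (cbox 0 pi) (\<lambda>s. integral (cbox 0 pi) (\<lambda>r. h s r))"
    using integral_prod_continuous[OF ch] by simp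
  also have "\<dots> = integral (cbox 0 pi) (\<lambda>r. integral (cbox 0 pi) (\<lambda>s. h s r))"
    by (rule integral_swap_continuous[OF ch])
  also have "\<dots> = integral {0..pi} (\<lambda>r. integral {0..pi} (\<lambda>s. h s r))" by (simp add: cbox_interval)
  also have "norm \<dots> \<le> (2 * real m * M) * (pi - 0)"
  proof (rule integral_bound)
    have "continuous_on ({0..pi} \<times> cbox 0 pi) (\<lambda>(r, s). h s r)"
      unfolding split_beta h_def
      by (intro continuous_intros continuous_on_compose2[OF cV] continuous_on_compose2[OF cVss])
        (auto simp: cbox_interval)
    from integral_continuous_on_param[OF this]
    show "continuous_on {0..pi} (\<lambda>r. integral {0..pi} (\<lambda>s. h s r))" by (simp add: cbox_interval)
    show "norm (integral {0..pi} (\<lambda>s. h s r)) \<le> 2 * real m * M" if r: "r \<in> {0..pi}" for r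
    proof -
      define J where "J = integral {0..pi} (\<lambda>s. (Vss (s, r) + (real m)\<^sup>2 * V (s, r)) * sin (real m * s))"
      have J: "\<bar>J\<bar> \<le> 2 * real m * M"
        unfolding J_def
        by (rule sine_coeff_second_derivative[of _ "\<lambda>s. Vs (s, r)"]) (use d1 d2 r bd in auto)
      have "integral {0..pi} (\<lambda>s. h s r) = J * sin (real n * r)"
        unfolding h_def J_def by (subst integral_mult_left[symmetric]) (simp add: mult_ac)
      then have "norm (integral {0..pi} (\<lambda>s. h s r)) = \<bar>J\<bar> * \<bar>sin (real n * r)\<bar>" by (simp add: abs_mult)
      also have "\<dots> \<le> \<bar>J\<bar> * 1" by (intro mult_left_mono) auto
      finally show ?thesis using J by simp
    qed
  qed simp
  finally show ?thesis by simp
qed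

lemma square_coeff_swap:
  assumes "continuous_on (cbox (0, 0) (pi, pi)) V"
  shows "square_coeff n m (\<lambda>(x, y). V (y, x)) = square_coeff m n V"
proof -
  have c1: "continuous_on (cbox (0, 0) (pi, pi)) (\<lambda>(x, y). V (x, y) * (sin (real m * x) * sin (real n * y)))"
    unfolding split_beta using assms by (auto intro!: continuous_intros)
  have c2: "continuous_on (cbox (0, 0) (pi, pi)) (\<lambda>(x, y). V (y, x) * (sin (real n * x) * sin (real m * y)))"
    unfolding split_beta by (intro continuous_intros continuous_on_compose2[OF assms]) auto
  have "square_coeff m n V = integral (cbox 0 pi) (\<lambda>x. integral (cbox 0 pi) (\<lambda>y. V (x, y) * (sin (real m * x) * sin (real n * y))))"
    using integral_prod_continuous[OF c1] by (simp add: square_coeff_def case_prod_unfold)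
  also have "\<dots> = integral (cbox 0 pi) (\<lambda>y. integral (cbox 0 pi) (\<lambda>x. V (x, y) * (sin (real m * x) * sin (real n * y))))"
    by (rule integral_swap_continuous[OF c1])
  also have "\<dots> = square_coeff n m (\<lambda>(x, y). V (y, x))"
    using integral_prod_continuous[OF c2] by (simp add: square_coeff_def case_prod_unfold mult_ac)
  finally show ?thesis by simp
qed

lemma square_coeff_cmult: "square_coeff m n (\<lambda>z. c * V z) = c * square_coeff m n V"
  by (simp add: square_coeff_def mult.assoc)

lemma square_coeff_add:
  assumes "continuous_on (cbox (0, 0) (pi, pi)) V" "continuous_on (cbox (0, 0) (pi, pi)) W"
  shows "square_coeff m n (\<lambda>z. V z + W z) = square_coeff m n V + square_coeff m n W"
  unfolding square_coeff_def distrib_right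
  by (rule integral_add) (auto intro!: integrable_continuous continuous_intros assms)

lemma square_coeff_bound:
  assumes "continuous_on (cbox (0, 0) (pi, pi)) V" "\<And>z. z \<in> cbox (0, 0) (pi, pi) \<Longrightarrow> \<bar>V z\<bar> \<le> e" "e \<ge> 0"
  shows "\<bar>square_coeff m n V\<bar> \<le> e * pi\<^sup>2"
proof -
  have "norm (square_coeff m n V) \<le> e * measure lborel (cbox (0, 0) (pi, pi::real))"
    unfolding square_coeff_def
  proof (rule has_integral_bound[OF assms(3) integrable_integral])
    show "(\<lambda>z. V z * (sin (real m * fst z) * sin (real n * snd z))) integrable_on cbox (0, 0) (pi, pi)"
      by (intro integrable_continuous continuous_intros assms)
    fix z :: "real \<times> real" assume "z \<in> cbox (0, 0) (pi, pi)"
    then have "\<bar>V z\<bar> \<le> e" using assms by blast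
    moreover have "\<bar>sin (real m * fst z) * sin (real n * snd z)\<bar> \<le> 1 * 1"
      unfolding abs_mult by (intro mult_mono) auto
    ultimately have "\<bar>V z\<bar> * \<bar>sin (real m * fst z) * sin (real n * snd z)\<bar> \<le> e * (1 * 1)"
      by (intro mult_mono) auto
    then show "norm (V z * (sin (real m * fst z) * sin (real n * snd z))) \<le> e" by (simp add: abs_mult)
  qed
  then show ?thesis by (simp add: content_Pair power2_eq_square)
qed

text \<open>Green's identity against a product of sines: the distance of \<tau> from the eigenvalue,
  times the coefficient, equals boundary terms of the size of M. The factors A and B are what
  remains of the Laplacian after the rectangle has been stretched to the square.\<close>

lemma square_coeff_elliptic:
  fixes V Vs Vss Vr Vrr :: "real \<times> real \<Rightarrow> real"
  assumes cV: "continuous_on (cbox (0, 0) (pi, pi)) V" and cVss: "continuous_on (cbox (0, 0) (pi, pi)) Vss"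
    and cVrr: "continuous_on (cbox (0, 0) (pi, pi)) Vrr"
    and "\<And>s r. s \<in> {0..pi} \<Longrightarrow> r \<in> {0..pi} \<Longrightarrow> ((\<lambda>s. V (s, r)) has_real_derivative Vs (s, r)) (at s within {0..pi})"
    and "\<And>s r. s \<in> {0..pi} \<Longrightarrow> r \<in> {0..pi} \<Longrightarrow> ((\<lambda>s. Vs (s, r)) has_real_derivative Vss (s, r)) (at s within {0..pi})"
    and "\<And>s r. s \<in> {0..pi} \<Longrightarrow> r \<in> {0..pi} \<Longrightarrow> ((\<lambda>r. V (s, r)) has_real_derivative Vr (s, r)) (at r within {0..pi})"
    and "\<And>s r. s \<in> {0..pi} \<Longrightarrow> r \<in> {0..pi} \<Longrightarrow> ((\<lambda>r. Vr (s, r)) has_real_derivative Vrr (s, r)) (at r within {0..pi})"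
    and "\<And>r. r \<in> {0..pi} \<Longrightarrow> \<bar>V (0, r)\<bar> \<le> M \<and> \<bar>V (pi, r)\<bar> \<le> M"
    and "\<And>s. s \<in> {0..pi} \<Longrightarrow> \<bar>V (s, 0)\<bar> \<le> M \<and> \<bar>V (s, pi)\<bar> \<le> M"
    and AB: "A > 0" "B > 0"
    and pde: "\<And>z. z \<in> cbox (0, 0) (pi, pi) \<Longrightarrow> A * Vss z + B * Vrr z = - \<tau> * V z"
  shows "\<bar>(A * (real m)\<^sup>2 + B * (real n)\<^sup>2 - \<tau>) * square_coeff m n V\<bar> \<le> (A * real m + B * real n) * (2 * pi * M)"
proof -
  define W1 where "W1 z = Vss z + (real m)\<^sup>2 * V z" for z
  define W2 where "W2 z = Vrr z + (real n)\<^sup>2 * V z" for z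
  have c: "continuous_on (cbox (0, 0) (pi, pi)) W1" "continuous_on (cbox (0, 0) (pi, pi)) W2"
    unfolding W1_def W2_def by (intro continuous_intros cV cVss cVrr)+
  have b1: "\<bar>square_coeff m n W1\<bar> \<le> 2 * real m * M * pi"
    unfolding W1_def by (rule square_coeff_second_derivative[of V Vss Vs]) (use assms in auto)
  \<comment> \<open>The second variable is handled by transposing both the function and the index
    pair.\<close>
  have "\<bar>square_coeff n m (\<lambda>z. (case z of (x, y) \<Rightarrow> Vrr (y, x)) + (real n)\<^sup>2 * (case z of (x, y) \<Rightarrow> V (y, x)))\<bar> \<le> 2 * real n * M * pi"
    by (rule square_coeff_second_derivative[of _ _ "\<lambda>(x, y). Vr (y, x)"])
      (use assms in \<open>auto simp: split_beta intro!: continuous_on_compose2[OF cV] continuous_on_compose2[OF cVrr] continuous_intros\<close>)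
  also have "(\<lambda>z. (case z of (x, y) \<Rightarrow> Vrr (y, x)) + (real n)\<^sup>2 * (case z of (x, y) \<Rightarrow> V (y, x))) = (\<lambda>(x, y). W2 (y, x))"
    by (auto simp: W2_def)
  also have "square_coeff n m (\<lambda>(x, y). W2 (y, x)) = square_coeff m n W2"
    by (rule square_coeff_swap[OF c(2)])
  finally have b2: "\<bar>square_coeff m n W2\<bar> \<le> 2 * real n * M * pi" .
  have "square_coeff m n (\<lambda>z. (A * (real m)\<^sup>2 + B * (real n)\<^sup>2 - \<tau>) * V z) = square_coeff m n (\<lambda>z. A * W1 z + B * W2 z)"
    unfolding square_coeff_def
  proof (rule integral_cong)
    fix z :: "real \<times> real" assume "z \<in> cbox (0, 0) (pi, pi)"
    from pde[OF this] have "(A * (real m)\<^sup>2 + B * (real n)\<^sup>2 - \<tau>) * V z = A * W1 z + B * W2 z"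
      by (simp add: W1_def W2_def algebra_simps)
    then show "(A * (real m)\<^sup>2 + B * (real n)\<^sup>2 - \<tau>) * V z * (sin (real m * fst z) * sin (real n * snd z)) =
         (A * W1 z + B * W2 z) * (sin (real m * fst z) * sin (real n * snd z))"
      by simp
  qed
  also have "\<dots> = A * square_coeff m n W1 + B * square_coeff m n W2"
    by (subst square_coeff_add) (auto intro!: continuous_intros c simp: square_coeff_cmult)
  finally have "\<bar>(A * (real m)\<^sup>2 + B * (real n)\<^sup>2 - \<tau>) * square_coeff m n V\<bar> = \<bar>A * square_coeff m n W1 + B * square_coeff m n W2\<bar>"
    by (simp add: square_coeff_cmult)
  also have "\<dots> \<le> A * \<bar>square_coeff m n W1\<bar> + B * \<bar>square_coeff m n W2\<bar>"
    using AB by (metis abs_mult abs_of_pos abs_triangle_ineq)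
  also have "\<dots> \<le> A * (2 * real m * M * pi) + B * (2 * real n * M * pi)"
    using AB b1 b2 by (intro add_mono mult_left_mono) auto
  finally show ?thesis by (simp add: algebra_simps)
qed

section \<open>Eigenfunctions of the rectangle\<close>

lemma closure_rectangle: "0 < a \<Longrightarrow> 0 < b \<Longrightarrow> closure (rectangle a b) = {0..a} \<times> {0..b}"
  by (simp add: rectangle_def closure_Times)

lemma open_rectangle: "open (rectangle a b)"
  by (simp add: rectangle_def open_Times)

section \<open>Locality of partial derivatives: modes agree with smooth waves only on the open
  rectangle\<close>

lemma eventually_nhds_slice:
  assumes "open S" "(x, y) \<in> S"
  shows "\<forall>\<^sub>F s in nhds x. (s, y) \<in> S" "\<forall>\<^sub>F s in nhds y. (x, s) \<in> S"
proof -
  have "open ((\<lambda>s. (s, y)) -` S)" "open ((\<lambda>s. (x, s)) -` S)"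
    using assms(1) by (auto intro!: open_vimage continuous_intros)
  then show "\<forall>\<^sub>F s in nhds x. (s, y) \<in> S" "\<forall>\<^sub>F s in nhds y. (x, s) \<in> S"
    using assms(2) by (auto simp: eventually_nhds)
qed

lemma pd_cong:
  assumes "open S" "z \<in> S" "\<And>w. w \<in> S \<Longrightarrow> u w = v w"
  shows "pdx u z = pdx v z" "pdy u z = pdy v z"
proof -
  obtain x y where z: "z = (x, y)" by force
  show "pdx u z = pdx v z" unfolding pdx_def z prod.case
    using eventually_nhds_slice(1)[of S x y] assms z
    by (intro deriv_cong_ev) (auto elim: eventually_mono)
  show "pdy u z = pdy v z" unfolding pdy_def z prod.case
    using eventually_nhds_slice(2)[of S x y] assms z
    by (intro deriv_cong_ev) (auto elim: eventually_mono)
qed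

lemma C1_on_cong:
  assumes "open S" "\<And>w. w \<in> S \<Longrightarrow> u w = v w"
  shows "C1_on S u \<longleftrightarrow> C1_on S v"
proof -
  have *: "C1_on S u" if S: "open S" and eq: "\<And>w. w \<in> S \<Longrightarrow> u w = v w" and v: "C1_on S v"
    for u v :: "real \<times> real \<Rightarrow> real"
    unfolding C1_on_def
  proof (intro conjI ballI; clarify?)
    fix x y assume xy: "(x, y) \<in> S"
    have v1: "\<exists>D. ((\<lambda>s. v (s, y)) has_real_derivative D) (at x)" "\<exists>D. ((\<lambda>s. v (x, s)) has_real_derivative D) (at y)"
      using v xy unfolding C1_on_def real_differentiable_def by auto
    have "\<forall>\<^sub>F s in nhds x. v (s, y) = u (s, y)" "\<forall>\<^sub>F s in nhds y. v (x, s) = u (x, s)"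
      using eventually_nhds_slice[OF S xy] eq by (auto elim: eventually_mono)
    then show "(\<lambda>s. u (s, y)) differentiable (at x) \<and> (\<lambda>s. u (x, s)) differentiable (at y)"
      unfolding real_differentiable_def
      using v1 DERIV_cong_ev[OF refl _ refl, of "\<lambda>s. v (s, y)" "\<lambda>s. u (s, y)" x]
        DERIV_cong_ev[OF refl _ refl, of "\<lambda>s. v (x, s)" "\<lambda>s. u (x, s)" y] by blast
  next
    have "continuous_on S (pdx v)" "continuous_on S (pdy v)" using v by (auto simp: C1_on_def)
    then show "continuous_on S (pdx u)" "continuous_on S (pdy u)"
      using pd_cong[of S _ u v, OF S _ eq] by (simp_all cong: continuous_on_cong)
  qed
  show ?thesis using *[of u v] *[of v u] assms by auto
qed

lemma C2_on_cong:
  assumes "open S" "\<And>w. w \<in> S \<Longrightarrow> u w = v w"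
  shows "C2_on S u \<longleftrightarrow> C2_on S v"
proof -
  have x: "pdx u w = pdx v w" and y: "pdy u w = pdy v w" if "w \<in> S" for w
    by (rule pd_cong[OF assms(1) that]; simp add: assms(2))+
  have "C1_on S u \<longleftrightarrow> C1_on S v" by (rule C1_on_cong[OF assms])
  moreover have "C1_on S (pdx u) \<longleftrightarrow> C1_on S (pdx v)" by (rule C1_on_cong[OF assms(1) x])
  moreover have "C1_on S (pdy u) \<longleftrightarrow> C1_on S (pdy v)" by (rule C1_on_cong[OF assms(1) y])
  ultimately show ?thesis by (simp only: C2_on_def)
qed

lemma laplacian_cong:
  assumes "open S" "z \<in> S" "\<And>w. w \<in> S \<Longrightarrow> u w = v w"
  shows "laplacian u z = laplacian v z"
proof -
  have x: "pdx u w = pdx v w" and y: "pdy u w = pdy v w" if "w \<in> S" for w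
    by (rule pd_cong[OF assms(1) that]; simp add: assms(3))+
  have "pdx (pdx u) z = pdx (pdx v) z" by (rule pd_cong(1)[OF assms(1,2) x])
  moreover have "pdy (pdy u) z = pdy (pdy v) z" by (rule pd_cong(2)[OF assms(1,2) y])
  ultimately show ?thesis by (simp only: laplacian_def)
qed

section \<open>Product waves on the whole plane\<close>

definition wave :: "real \<Rightarrow> real \<Rightarrow> real \<Rightarrow> real \<times> real \<Rightarrow> real" where
  "wave c \<alpha> \<beta> z = c * (sin (\<alpha> * fst z) * sin (\<beta> * snd z))"

lemma pd_prod:
  fixes f g f' g' :: "real \<Rightarrow> real"
  assumes "\<And>x. (f has_real_derivative f' x) (at x)" "\<And>y. (g has_real_derivative g' y) (at y)"
  shows "pdx (\<lambda>z. c * (f (fst z) * g (snd z))) = (\<lambda>z. c * (f' (fst z) * g (snd z)))"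
    and "pdy (\<lambda>z. c * (f (fst z) * g (snd z))) = (\<lambda>z. c * (f (fst z) * g' (snd z)))"
    and "\<lbrakk>continuous_on UNIV f'; continuous_on UNIV g'\<rbrakk> \<Longrightarrow> C1_on UNIV (\<lambda>z. c * (f (fst z) * g (snd z)))"
proof -
  have 1: "((\<lambda>s. c * (f s * g y)) has_real_derivative c * (f' x * g y)) (at x)" for x y
    by (auto intro!: derivative_eq_intros assms)
  have 2: "((\<lambda>s. c * (f x * g s)) has_real_derivative c * (f x * g' y)) (at y)" for x y
    by (auto intro!: derivative_eq_intros assms)
  show a: "pdx (\<lambda>z. c * (f (fst z) * g (snd z))) = (\<lambda>z. c * (f' (fst z) * g (snd z)))"
    by (auto simp: pdx_def fun_eq_iff intro!: DERIV_imp_deriv 1)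
  show b: "pdy (\<lambda>z. c * (f (fst z) * g (snd z))) = (\<lambda>z. c * (f (fst z) * g' (snd z)))"
    by (auto simp: pdy_def fun_eq_iff intro!: DERIV_imp_deriv 2)
  have cf: "continuous_on UNIV f" "continuous_on UNIV g"
    using assms by (auto intro!: continuous_at_imp_continuous_on DERIV_isCont)
  have d: "(\<lambda>s. c * (f s * g y)) differentiable (at x)" "(\<lambda>s. c * (f x * g s)) differentiable (at y)" for x y
    using 1 2 unfolding real_differentiable_def by blast+
  show "C1_on UNIV (\<lambda>z. c * (f (fst z) * g (snd z)))" if "continuous_on UNIV f'" "continuous_on UNIV g'"
    unfolding C1_on_def a b
  proof (intro conjI ballI; clarify?)
    show "(\<lambda>s. c * (f (fst (s, y)) * g (snd (s, y)))) differentiable at x \<and>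
        (\<lambda>s. c * (f (fst (x, s)) * g (snd (x, s)))) differentiable at y" for x y
      using d by simp
  qed (intro continuous_intros continuous_on_compose2[OF cf(1)] continuous_on_compose2[OF cf(2)]
      continuous_on_compose2[OF that(1)] continuous_on_compose2[OF that(2)]; simp)+
qed

lemma DERIV_sin_scaled: "((\<lambda>x. sin (\<alpha> * x)) has_real_derivative \<alpha> * cos (\<alpha> * x)) (at x)"
  and DERIV_cos_scaled: "((\<lambda>x. \<alpha> * cos (\<alpha> * x)) has_real_derivative - \<alpha>\<^sup>2 * sin (\<alpha> * x)) (at x)"
  for \<alpha> x :: real
  by (auto intro!: derivative_eq_intros simp: power2_eq_square)

lemma wave_pd:
  "pdx (wave c \<alpha> \<beta>) = (\<lambda>z. c * (\<alpha> * cos (\<alpha> * fst z) * sin (\<beta> * snd z)))"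
  "pdy (wave c \<alpha> \<beta>) = (\<lambda>z. c * (sin (\<alpha> * fst z) * (\<beta> * cos (\<beta> * snd z))))"
  unfolding wave_def[abs_def]
  by (rule pd_prod[OF DERIV_sin_scaled DERIV_sin_scaled])+

lemma wave_C2: "C2_on UNIV (wave c \<alpha> \<beta>)"
proof -
  have c: "continuous_on UNIV (\<lambda>x. \<alpha> * cos (\<alpha> * x))" "continuous_on UNIV (\<lambda>x. - \<alpha>\<^sup>2 * sin (\<alpha> * x))" for \<alpha> :: real
    by (intro continuous_intros)+
  have "C1_on UNIV (wave c \<alpha> \<beta>)"
    unfolding wave_def[abs_def] by (rule pd_prod(3)[OF DERIV_sin_scaled DERIV_sin_scaled c(1) c(1)])
  moreover have "C1_on UNIV (pdx (wave c \<alpha> \<beta>))"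
    unfolding wave_pd by (rule pd_prod(3)[OF DERIV_cos_scaled DERIV_sin_scaled c(2) c(1)])
  moreover have "C1_on UNIV (pdy (wave c \<alpha> \<beta>))"
    unfolding wave_pd by (rule pd_prod(3)[OF DERIV_sin_scaled DERIV_cos_scaled c(1) c(2)])
  ultimately show ?thesis by (simp only: C2_on_def)
qed

lemma wave_laplacian: "- laplacian (wave c \<alpha> \<beta>) z = (\<alpha>\<^sup>2 + \<beta>\<^sup>2) * wave c \<alpha> \<beta> z"
proof -
  have "pdx (pdx (wave c \<alpha> \<beta>)) = (\<lambda>z. c * (- \<alpha>\<^sup>2 * sin (\<alpha> * fst z) * sin (\<beta> * snd z)))"
    unfolding wave_pd by (rule pd_prod(1)[OF DERIV_cos_scaled DERIV_sin_scaled])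
  moreover have "pdy (pdy (wave c \<alpha> \<beta>)) = (\<lambda>z. c * (sin (\<alpha> * fst z) * (- \<beta>\<^sup>2 * sin (\<beta> * snd z))))"
    unfolding wave_pd by (rule pd_prod(2)[OF DERIV_sin_scaled DERIV_cos_scaled])
  ultimately show ?thesis by (simp add: laplacian_def wave_def algebra_simps)
qed

lemma C1_on_subset: "C1_on S u \<Longrightarrow> T \<subseteq> S \<Longrightarrow> C1_on T u"
  unfolding C1_on_def using continuous_on_subset by blast

lemma C2_on_subset: "C2_on S u \<Longrightarrow> T \<subseteq> S \<Longrightarrow> C2_on T u"
  unfolding C2_on_def using C1_on_subset by blast

section \<open>Modes of the rectangle and the sine coefficients of an arbitrary
  eigenfunction\<close>

definition mode :: "real \<Rightarrow> real \<Rightarrow> nat \<Rightarrow> nat \<Rightarrow> real \<Rightarrow> real \<times> real \<Rightarrow> real" where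
  "mode a b m n c z = (if z \<in> rectangle a b then wave c (real m * pi / a) (real n * pi / b) z else 0)"

definition mode_ev :: "real \<Rightarrow> real \<Rightarrow> nat \<Rightarrow> nat \<Rightarrow> real" where
  "mode_ev a b m n = (real m * pi / a)\<^sup>2 + (real n * pi / b)\<^sup>2"

text \<open>The wave vanishes on the boundary by itself, so cutting it off there does not show on
  the closure.\<close>

lemma mode_closure:
  assumes "0 < a" "0 < b" "z \<in> closure (rectangle a b)"
  shows "mode a b m n c z = wave c (real m * pi / a) (real n * pi / b) z"
proof -
  have "fst z = 0 \<or> fst z = a \<or> snd z = 0 \<or> snd z = b" if "z \<notin> rectangle a b"
    using that assms unfolding closure_rectangle[OF assms(1,2)] by (cases z) (auto simp: rectangle_def)
  then show ?thesis using assms by (auto simp: mode_def wave_def sin_npi)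
qed

lemma mode_in_eigenspace:
  assumes "0 < a" "0 < b"
  shows "mode a b m n c \<in> dirichlet_eigenspace (rectangle a b) (mode_ev a b m n)"
  unfolding dirichlet_eigenspace_def
proof (intro CollectI conjI ballI allI impI)
  let ?w = "wave c (real m * pi / a) (real n * pi / b)"
  have eq: "mode a b m n c z = ?w z" if "z \<in> rectangle a b" for z using that by (simp add: mode_def)
  have "C2_on (rectangle a b) ?w" by (rule C2_on_subset[OF wave_C2]) simp
  then show "C2_on (rectangle a b) (mode a b m n c)"
    using C2_on_cong[of "rectangle a b" "mode a b m n c" ?w, OF open_rectangle eq] by simp
  have "continuous_on (closure (rectangle a b)) ?w" unfolding wave_def by (intro continuous_intros)
  then show "continuous_on (closure (rectangle a b)) (mode a b m n c)"
    using mode_closure[OF assms] by (simp cong: continuous_on_cong)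
  fix z assume z: "z \<in> rectangle a b"
  show "- laplacian (mode a b m n c) z = mode_ev a b m n * mode a b m n c z"
    using laplacian_cong[of "rectangle a b" z "mode a b m n c" ?w, OF open_rectangle z eq] wave_laplacian[of c "real m * pi / a" "real n * pi / b" z]
    by (simp add: eq[OF z] mode_ev_def)
qed (simp add: mode_def)

text \<open>The derivatives of a classical solution need not extend continuously to the boundary, so Green's
  formula is applied to the solution rescaled from the concentric rectangle of relative size \<open>\<theta> < 1\<close>.\<close>

definition rescaled :: "real \<Rightarrow> real \<Rightarrow> real \<Rightarrow> (real \<times> real \<Rightarrow> real) \<Rightarrow> real \<times> real \<Rightarrow> real" where
  "rescaled a b \<theta> u z = u (a / 2 + \<theta> * a / pi * (fst z - pi / 2), b / 2 + \<theta> * b / pi * (snd z - pi / 2))"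

lemma rescaled_bounds:
  fixes a s \<theta> :: real
  assumes "0 < a" "s \<in> {0..pi}"
  shows "0 < \<theta> \<Longrightarrow> \<theta> < 1 \<Longrightarrow> 0 < a / 2 + \<theta> * a / pi * (s - pi / 2) \<and> a / 2 + \<theta> * a / pi * (s - pi / 2) < a"
    and "0 < \<theta> \<Longrightarrow> \<theta> \<le> 1 \<Longrightarrow> 0 \<le> a / 2 + \<theta> * a / pi * (s - pi / 2) \<and> a / 2 + \<theta> * a / pi * (s - pi / 2) \<le> a"
    and "\<bar>(a / 2 + \<theta> * a / pi * (s - pi / 2)) - (a / 2 + 1 * a / pi * (s - pi / 2))\<bar> \<le> \<bar>1 - \<theta>\<bar> * a"
proof -
  define k where "k = (s - pi / 2) / pi"
  have k: "\<bar>k\<bar> \<le> 1 / 2" using assms by (auto simp: k_def field_simps abs_le_iff)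
  have eq: "a / 2 + \<theta> * a / pi * (s - pi / 2) = a * (1 / 2 + \<theta> * k)" for \<theta> by (simp add: k_def field_simps)
  show "0 < a / 2 + \<theta> * a / pi * (s - pi / 2) \<and> a / 2 + \<theta> * a / pi * (s - pi / 2) < a" if "0 < \<theta>" "\<theta> < 1"
  proof -
    have "\<theta> * \<bar>k\<bar> \<le> \<theta> * (1 / 2)" using k that by (intro mult_left_mono) auto
    moreover have "\<bar>\<theta> * k\<bar> = \<theta> * \<bar>k\<bar>" using that by (simp add: abs_mult)
    ultimately have "\<bar>\<theta> * k\<bar> < 1 / 2" using that(2) by linarith
    then have "0 < 1 / 2 + \<theta> * k" "1 / 2 + \<theta> * k < 1" by linarith+
    then have "a * 0 < a * (1 / 2 + \<theta> * k)" "a * (1 / 2 + \<theta> * k) < a * 1"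
      by (simp_all only: mult_less_cancel_left_pos[OF assms(1)])
    then show ?thesis unfolding eq by simp
  qed
  show "0 \<le> a / 2 + \<theta> * a / pi * (s - pi / 2) \<and> a / 2 + \<theta> * a / pi * (s - pi / 2) \<le> a" if "0 < \<theta>" "\<theta> \<le> 1"
  proof -
    have "\<bar>\<theta> * k\<bar> \<le> 1 * (1 / 2)" unfolding abs_mult using k that by (intro mult_mono) auto
    then have "0 \<le> 1 / 2 + \<theta> * k" "1 / 2 + \<theta> * k \<le> 1" by linarith+
    then have "a * 0 \<le> a * (1 / 2 + \<theta> * k)" "a * (1 / 2 + \<theta> * k) \<le> a * 1"
      by (simp_all only: mult_le_cancel_left_pos[OF assms(1)])
    then show ?thesis unfolding eq by simp
  qed
  have "(a / 2 + \<theta> * a / pi * (s - pi / 2)) - (a / 2 + 1 * a / pi * (s - pi / 2)) = (\<theta> - 1) * a * k"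
    unfolding eq by (simp add: algebra_simps)
  also have "\<bar>\<dots>\<bar> = \<bar>1 - \<theta>\<bar> * a * \<bar>k\<bar>" using assms by (simp add: abs_mult abs_minus_commute)
  also have "\<dots> \<le> \<bar>1 - \<theta>\<bar> * a * 1" using k assms by (intro mult_left_mono) auto
  finally show "\<bar>(a / 2 + \<theta> * a / pi * (s - pi / 2)) - (a / 2 + 1 * a / pi * (s - pi / 2))\<bar> \<le> \<bar>1 - \<theta>\<bar> * a" by simp
qed

lemma C1_on_has_derivs:
  assumes "C1_on S u" "(x, y) \<in> S"
  shows "((\<lambda>s. u (s, y)) has_real_derivative pdx u (x, y)) (at x)"
    and "((\<lambda>s. u (x, s)) has_real_derivative pdy u (x, y)) (at y)"
proof -
  have "(\<lambda>s. u (s, y)) differentiable (at x)" "(\<lambda>s. u (x, s)) differentiable (at y)"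
    using assms unfolding C1_on_def by blast+
  then show "((\<lambda>s. u (s, y)) has_real_derivative pdx u (x, y)) (at x)"
    "((\<lambda>s. u (x, s)) has_real_derivative pdy u (x, y)) (at y)"
    by (simp_all add: pdx_def pdy_def DERIV_deriv_iff_real_differentiable)
qed

text \<open>For \<theta> < 1 the closed square is mapped into the open rectangle, so the rescaled
  solution is smooth enough up to the boundary. The chain rule turns t into
  \<open>\<theta>\<^sup>2 * t\<close>; the price is that the boundary values are only small, not
  zero.\<close>

lemma rescaled_coeff_bound:
  assumes ab: "0 < a" "0 < b" and \<theta>: "0 < \<theta>" "\<theta> < 1"
    and u: "u \<in> dirichlet_eigenspace (rectangle a b) t"
    and M1: "\<And>r. r \<in> {0..pi} \<Longrightarrow> \<bar>rescaled a b \<theta> u (0, r)\<bar> \<le> M \<and> \<bar>rescaled a b \<theta> u (pi, r)\<bar> \<le> M"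
    and M2: "\<And>s. s \<in> {0..pi} \<Longrightarrow> \<bar>rescaled a b \<theta> u (s, 0)\<bar> \<le> M \<and> \<bar>rescaled a b \<theta> u (s, pi)\<bar> \<le> M"
  shows "\<bar>(mode_ev a b m n - \<theta>\<^sup>2 * t) * square_coeff m n (rescaled a b \<theta> u)\<bar>
    \<le> ((pi / a)\<^sup>2 * real m + (pi / b)\<^sup>2 * real n) * (2 * pi * M)"
proof -
  define X where "X s = a / 2 + \<theta> * a / pi * (s - pi / 2)" for s
  define Y where "Y s = b / 2 + \<theta> * b / pi * (s - pi / 2)" for s
  have resc: "rescaled a b \<theta> f = (\<lambda>z. f (X (fst z), Y (snd z)))" for f
    by (simp add: rescaled_def X_def Y_def fun_eq_iff)
  have C2: "C2_on (rectangle a b) u" and pde: "\<And>z. z \<in> rectangle a b \<Longrightarrow> - laplacian u z = t * u z"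
    and uc: "continuous_on (closure (rectangle a b)) u"
    using u by (auto simp: dirichlet_eigenspace_def)
  have C1: "C1_on (rectangle a b) u" "C1_on (rectangle a b) (pdx u)" "C1_on (rectangle a b) (pdy u)"
    using C2 by (auto simp: C2_on_def)
  have XY: "(X s, Y r) \<in> rectangle a b" if "s \<in> {0..pi}" "r \<in> {0..pi}" for s r
    using rescaled_bounds(1)[OF ab(1) that(1) \<theta>] rescaled_bounds(1)[OF ab(2) that(2) \<theta>]
    by (simp add: rectangle_def X_def Y_def)
  have dX: "(X has_real_derivative \<theta> * a / pi) (at s within S)" for s S
    unfolding X_def by (auto intro!: derivative_eq_intros)
  have dY: "(Y has_real_derivative \<theta> * b / pi) (at s within S)" for s S
    unfolding Y_def by (auto intro!: derivative_eq_intros)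
  have cont: "continuous_on (cbox (0, 0) (pi, pi)) (\<lambda>z. k * f (X (fst z), Y (snd z)))"
    if "continuous_on (rectangle a b) f" for f :: "real \<times> real \<Rightarrow> real" and k
  proof (intro continuous_intros continuous_on_compose2[OF that])
    show "(\<lambda>z. (X (fst z), Y (snd z))) ` cbox (0, 0) (pi, pi) \<subseteq> rectangle a b"
      using XY by auto
  qed (auto simp: X_def Y_def intro!: continuous_intros)
  have chainX: "((\<lambda>s. k * f (X s, Y r)) has_real_derivative \<theta> * a / pi * k * pdx f (X s, Y r)) (at s within {0..pi})"
    if "C1_on (rectangle a b) f" "s \<in> {0..pi}" "r \<in> {0..pi}" for f k s r
    using DERIV_cmult[OF DERIV_chain2[OF C1_on_has_derivs(1)[OF that(1) XY[OF that(2,3)]] dX], of k]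
    by (simp add: mult_ac)
  have chainY: "((\<lambda>r. k * f (X s, Y r)) has_real_derivative \<theta> * b / pi * k * pdy f (X s, Y r)) (at r within {0..pi})"
    if "C1_on (rectangle a b) f" "s \<in> {0..pi}" "r \<in> {0..pi}" for f k s r
    using DERIV_cmult[OF DERIV_chain2[OF C1_on_has_derivs(2)[OF that(1) XY[OF that(2,3)]] dY], of k]
    by (simp add: mult_ac)
  have "\<bar>((pi / a)\<^sup>2 * (real m)\<^sup>2 + (pi / b)\<^sup>2 * (real n)\<^sup>2 - \<theta>\<^sup>2 * t) * square_coeff m n (rescaled a b \<theta> u)\<bar>
      \<le> ((pi / a)\<^sup>2 * real m + (pi / b)\<^sup>2 * real n) * (2 * pi * M)"
  proof (rule square_coeff_elliptic)
    show "continuous_on (cbox (0, 0) (pi, pi)) (rescaled a b \<theta> u)"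
      unfolding resc using cont[OF continuous_on_subset[OF uc closure_subset], of 1] by simp
    show "continuous_on (cbox (0, 0) (pi, pi)) (\<lambda>z. (\<theta> * a / pi) * (\<theta> * a / pi) * pdx (pdx u) (X (fst z), Y (snd z)))"
      by (rule cont) (use C1 in \<open>simp add: C1_on_def\<close>)
    show "continuous_on (cbox (0, 0) (pi, pi)) (\<lambda>z. (\<theta> * b / pi) * (\<theta> * b / pi) * pdy (pdy u) (X (fst z), Y (snd z)))"
      by (rule cont) (use C1 in \<open>simp add: C1_on_def\<close>)
    fix s r :: real assume sr: "s \<in> {0..pi}" "r \<in> {0..pi}"
    show "((\<lambda>s. rescaled a b \<theta> u (s, r)) has_real_derivative
        (\<lambda>z. (\<theta> * a / pi) * pdx u (X (fst z), Y (snd z))) (s, r)) (at s within {0..pi})"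
      unfolding resc using chainX[OF C1(1) sr, of 1] by simp
    show "((\<lambda>s. (\<lambda>z. (\<theta> * a / pi) * pdx u (X (fst z), Y (snd z))) (s, r)) has_real_derivative
        (\<lambda>z. (\<theta> * a / pi) * (\<theta> * a / pi) * pdx (pdx u) (X (fst z), Y (snd z))) (s, r)) (at s within {0..pi})"
      using chainX[OF C1(2) sr, of "\<theta> * a / pi"] by simp
    show "((\<lambda>r. rescaled a b \<theta> u (s, r)) has_real_derivative
        (\<lambda>z. (\<theta> * b / pi) * pdy u (X (fst z), Y (snd z))) (s, r)) (at r within {0..pi})"
      unfolding resc using chainY[OF C1(1) sr, of 1] by simp
    show "((\<lambda>r. (\<lambda>z. (\<theta> * b / pi) * pdy u (X (fst z), Y (snd z))) (s, r)) has_real_derivative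
        (\<lambda>z. (\<theta> * b / pi) * (\<theta> * b / pi) * pdy (pdy u) (X (fst z), Y (snd z))) (s, r)) (at r within {0..pi})"
      using chainY[OF C1(3) sr, of "\<theta> * b / pi"] by simp
  next
    fix z :: "real \<times> real" assume "z \<in> cbox (0, 0) (pi, pi)"
    then have "(X (fst z), Y (snd z)) \<in> rectangle a b" using XY by (cases z) auto
    from pde[OF this]
    have "pdx (pdx u) (X (fst z), Y (snd z)) + pdy (pdy u) (X (fst z), Y (snd z)) = - t * u (X (fst z), Y (snd z))"
      by (simp add: laplacian_def)
    then have "\<theta>\<^sup>2 * (pdx (pdx u) (X (fst z), Y (snd z)) + pdy (pdy u) (X (fst z), Y (snd z))) = - (\<theta>\<^sup>2 * t) * u (X (fst z), Y (snd z))"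
      by simp
    moreover have "(pi / a)\<^sup>2 * (\<theta> * a / pi * (\<theta> * a / pi) * p) = \<theta>\<^sup>2 * p" "(pi / b)\<^sup>2 * (\<theta> * b / pi * (\<theta> * b / pi) * p) = \<theta>\<^sup>2 * p" for p
      using ab by (simp_all add: power2_eq_square field_simps)
    ultimately show "(pi / a)\<^sup>2 * (\<theta> * a / pi * (\<theta> * a / pi) * pdx (pdx u) (X (fst z), Y (snd z))) +
         (pi / b)\<^sup>2 * (\<theta> * b / pi * (\<theta> * b / pi) * pdy (pdy u) (X (fst z), Y (snd z))) = - (\<theta>\<^sup>2 * t) * rescaled a b \<theta> u z"
      unfolding resc by (simp add: distrib_left)
  qed (use ab M1 M2 in auto)
  then show ?thesis by (simp add: mode_ev_def power_divide power_mult_distrib mult.commute)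
qed


lemma rescaled_1: 
  assumes "s \<in> {0..pi}" "r \<in> {0..pi}"
  shows "rescaled a b 1 u (s, r) = u (a * s / pi, b * r / pi)"
  by (simp add: rescaled_def field_simps)

lemma rescaled_continuous:
  assumes ab: "0 < a" "0 < b" and \<theta>: "0 < \<theta>" "\<theta> \<le> 1" and u: "continuous_on (closure (rectangle a b)) u"
  shows "continuous_on (cbox (0, 0) (pi, pi)) (rescaled a b \<theta> u)"
  unfolding rescaled_def
proof (intro continuous_on_compose2[OF u] continuous_intros)
  show "(\<lambda>z. (a / 2 + \<theta> * a / pi * (fst z - pi / 2), b / 2 + \<theta> * b / pi * (snd z - pi / 2))) ` cbox (0, 0) (pi, pi) \<subseteq> closure (rectangle a b)"
    unfolding closure_rectangle[OF ab]
    using rescaled_bounds(2)[OF ab(1) _ \<theta>] rescaled_bounds(2)[OF ab(2) _ \<theta>] by fastforce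
qed

text \<open>As \<theta> tends to 1, uniform continuity makes the boundary values tend to 0 and the
  coefficients converge; in the limit the eigenvalue gap times the coefficient is 0.\<close>

lemma eigenspace_coeff_zero:
  assumes ab: "0 < a" "0 < b" and u: "u \<in> dirichlet_eigenspace (rectangle a b) t"
    and ne: "mode_ev a b m n \<noteq> t"
  shows "square_coeff m n (rescaled a b 1 u) = 0"
proof -
  define D where "D \<theta> = square_coeff m n (rescaled a b \<theta> u)" for \<theta>
  define K where "K = ((pi / a)\<^sup>2 * real m + (pi / b)\<^sup>2 * real n) * (2 * pi)"
  have K: "K \<ge> 0" unfolding K_def by (intro mult_nonneg_nonneg add_nonneg_nonneg) auto
  have uc: "continuous_on (closure (rectangle a b)) u" and u0: "\<And>z. z \<notin> rectangle a b \<Longrightarrow> u z = 0"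
    using u by (auto simp: dirichlet_eigenspace_def)
  have "compact (closure (rectangle a b))" unfolding closure_rectangle[OF ab] by (intro compact_Times) auto
  then have unif: "uniformly_continuous_on (closure (rectangle a b)) u"
    by (rule compact_uniformly_continuous[OF uc])
  \<comment> \<open>A single e serves both as the uniform distance to the unscaled function and as
    the bound M on the boundary values.\<close>
  have key: "\<forall>\<^sub>F \<theta> in at_left 1. \<bar>D \<theta> - D 1\<bar> \<le> e * pi\<^sup>2 \<and> \<bar>(mode_ev a b m n - \<theta>\<^sup>2 * t) * D \<theta>\<bar> \<le> K * e"
    if e: "e > 0" for e
  proof -
    obtain d where d: "d > 0" "\<And>x y. x \<in> closure (rectangle a b) \<Longrightarrow> y \<in> closure (rectangle a b) \<Longrightarrow>
        dist y x < d \<Longrightarrow> dist (u y) (u x) < e"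
      using unif e unfolding uniformly_continuous_on_def by metis
    have "((\<lambda>\<theta>::real. \<bar>1 - \<theta>\<bar> * (a + b)) \<longlongrightarrow> \<bar>1 - 1\<bar> * (a + b)) (at_left 1)"
      by (intro tendsto_intros)
    then have "\<forall>\<^sub>F \<theta> in at_left (1::real). \<bar>1 - \<theta>\<bar> * (a + b) < d"
      using d(1) by (simp add: order_tendstoD)
    moreover have "\<forall>\<^sub>F \<theta> in at_left (1::real). \<theta> \<in> {0<..<1}"
      by (rule eventually_at_left_real) simp
    ultimately show ?thesis
    proof eventually_elim
      case (elim \<theta>)
      then have \<theta>: "0 < \<theta>" "\<theta> < 1" "\<theta> \<le> 1" by auto
      have close: "\<bar>rescaled a b \<theta> u (s, r) - rescaled a b 1 u (s, r)\<bar> \<le> e"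
        if sr: "s \<in> {0..pi}" "r \<in> {0..pi}" for s r
      proof -
        define x where "x \<theta> = a / 2 + \<theta> * a / pi * (s - pi / 2)" for \<theta>
        define y where "y \<theta> = b / 2 + \<theta> * b / pi * (r - pi / 2)" for \<theta>
        have mem: "(x \<theta>, y \<theta>) \<in> closure (rectangle a b)" "(x 1, y 1) \<in> closure (rectangle a b)"
          unfolding closure_rectangle[OF ab] x_def y_def
          using rescaled_bounds(2)[OF ab(1) sr(1), of \<theta>] rescaled_bounds(2)[OF ab(2) sr(2), of \<theta>] \<theta>
            rescaled_bounds(2)[OF ab(1) sr(1), of 1] rescaled_bounds(2)[OF ab(2) sr(2), of 1] by auto
        have "dist (x \<theta>, y \<theta>) (x 1, y 1) \<le> \<bar>x \<theta> - x 1\<bar> + \<bar>y \<theta> - y 1\<bar>"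
          by (simp add: dist_Pair_Pair dist_real_def sqrt_sum_squares_le_sum_abs)
        also have "\<dots> \<le> \<bar>1 - \<theta>\<bar> * a + \<bar>1 - \<theta>\<bar> * b"
          unfolding x_def y_def
          using rescaled_bounds(3)[OF ab(1) sr(1), of \<theta>] rescaled_bounds(3)[OF ab(2) sr(2), of \<theta>] by linarith
        also have "\<dots> < d" using elim by (simp add: distrib_left)
        finally have "dist (u (x \<theta>, y \<theta>)) (u (x 1, y 1)) < e" by (rule d(2)[OF mem(2,1)])
        then show ?thesis by (simp add: rescaled_def x_def y_def dist_real_def)
      qed
      \<comment> \<open>For \<theta> = 1 the boundary of the square goes to the boundary of the
        rectangle, where u is 0; by \<open>close\<close> the boundary values for \<theta> are then
        at most e.\<close>
      have zero: "rescaled a b 1 u (s, r) = 0"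
        if "s \<in> {0..pi}" "r \<in> {0..pi}" "s = 0 \<or> s = pi \<or> r = 0 \<or> r = pi" for s r
        using that ab by (subst rescaled_1) (auto intro!: u0 simp: rectangle_def)
      have c1: "continuous_on (cbox (0, 0) (pi, pi)) (rescaled a b \<theta> u)"
        by (rule rescaled_continuous[OF ab \<theta>(1,3) uc])
      have c2: "continuous_on (cbox (0, 0) (pi, pi)) (\<lambda>z. (-1) * rescaled a b 1 u z)"
        using rescaled_continuous[OF ab _ _ uc, of 1] by (intro continuous_intros) auto
      have "\<bar>D \<theta> - D 1\<bar> = \<bar>square_coeff m n (\<lambda>z. rescaled a b \<theta> u z + (-1) * rescaled a b 1 u z)\<bar>"
        unfolding D_def square_coeff_add[OF c1 c2] square_coeff_cmult by simp
      also have "\<dots> \<le> e * pi\<^sup>2"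
        by (rule square_coeff_bound)
          (use close e in \<open>auto intro!: continuous_intros rescaled_continuous[OF ab _ _ uc] \<theta>\<close>)
      finally have 1: "\<bar>D \<theta> - D 1\<bar> \<le> e * pi\<^sup>2" .
      have "\<bar>(mode_ev a b m n - \<theta>\<^sup>2 * t) * D \<theta>\<bar> \<le> ((pi / a)\<^sup>2 * real m + (pi / b)\<^sup>2 * real n) * (2 * pi * e)"
        unfolding D_def
      proof (rule rescaled_coeff_bound[OF ab \<theta>(1,2) u])
        show "\<bar>rescaled a b \<theta> u (0, r)\<bar> \<le> e \<and> \<bar>rescaled a b \<theta> u (pi, r)\<bar> \<le> e" if "r \<in> {0..pi}" for r
          using close[of 0 r] close[of pi r] zero[of 0 r] zero[of pi r] that by auto
        show "\<bar>rescaled a b \<theta> u (s, 0)\<bar> \<le> e \<and> \<bar>rescaled a b \<theta> u (s, pi)\<bar> \<le> e" if "s \<in> {0..pi}" for s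
          using close[of s 0] close[of s pi] zero[of s 0] zero[of s pi] that by auto
      qed
      then have 2: "\<bar>(mode_ev a b m n - \<theta>\<^sup>2 * t) * D \<theta>\<bar> \<le> K * e" by (simp add: K_def mult.assoc)
      from 1 2 show ?case ..
    qed
  qed
  have lim1: "(D \<longlongrightarrow> D 1) (at_left 1)"
  proof (rule tendstoI)
    fix e :: real assume "e > 0"
    then have "\<forall>\<^sub>F \<theta> in at_left 1. \<bar>D \<theta> - D 1\<bar> \<le> e / (2 * pi\<^sup>2) * pi\<^sup>2"
      using key[of "e / (2 * pi\<^sup>2)"] by (auto elim: eventually_mono)
    then show "\<forall>\<^sub>F \<theta> in at_left 1. dist (D \<theta>) (D 1) < e"
      by eventually_elim (use \<open>e > 0\<close> in \<open>simp add: dist_real_def\<close>)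
  qed
  have lim2: "((\<lambda>\<theta>. (mode_ev a b m n - \<theta>\<^sup>2 * t) * D \<theta>) \<longlongrightarrow> 0) (at_left 1)"
  proof (rule tendstoI)
    fix e :: real assume "e > 0"
    then have "e / (K + 1) > 0" using K by simp
    then have "\<forall>\<^sub>F \<theta> in at_left 1. \<bar>(mode_ev a b m n - \<theta>\<^sup>2 * t) * D \<theta>\<bar> \<le> K * (e / (K + 1))"
      using key[of "e / (K + 1)"] by (auto elim: eventually_mono)
    then show "\<forall>\<^sub>F \<theta> in at_left 1. dist ((mode_ev a b m n - \<theta>\<^sup>2 * t) * D \<theta>) 0 < e"
    proof eventually_elim
      case (elim \<theta>)
      have "K * (e / (K + 1)) < e" using K \<open>e > 0\<close> by (simp add: field_simps)
      then show ?case using elim by (simp add: dist_real_def)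
    qed
  qed
  \<comment> \<open>The limit computed factor by factor; it has to agree with
    \<open>lim2\<close>.\<close>
  have "((\<lambda>\<theta>. (mode_ev a b m n - \<theta>\<^sup>2 * t) * D \<theta>) \<longlongrightarrow> (mode_ev a b m n - 1\<^sup>2 * t) * D 1) (at_left 1)"
    by (intro tendsto_intros lim1)
  then have "(mode_ev a b m n - 1\<^sup>2 * t) * D 1 = 0"
    using lim2 by (intro tendsto_unique[of "at_left (1::real)"]) auto
  then show ?thesis using ne by (simp add: D_def)
qed

text \<open>Completeness applied to u - c v on the square. The value c = 0 yields that u vanishes,
  other values that u is proportional to a mode.\<close>

lemma eigenspace_eq_zeroI:
  assumes ab: "0 < a" "0 < b" and u: "u \<in> dirichlet_eigenspace (rectangle a b) t"
    and v: "v \<in> dirichlet_eigenspace (rectangle a b) t'"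
    and zero: "\<And>m n. 1 \<le> m \<Longrightarrow> 1 \<le> n \<Longrightarrow> square_coeff m n (rescaled a b 1 u) = c * square_coeff m n (rescaled a b 1 v)"
  shows "u = (\<lambda>z. c * v z)"
proof
  fix z
  have uc: "continuous_on (closure (rectangle a b)) u" and u0: "\<And>z. z \<notin> rectangle a b \<Longrightarrow> u z = 0"
    using u by (auto simp: dirichlet_eigenspace_def)
  have vc: "continuous_on (closure (rectangle a b)) v" and v0: "\<And>z. z \<notin> rectangle a b \<Longrightarrow> v z = 0"
    using v by (auto simp: dirichlet_eigenspace_def)
  define W where "W z = rescaled a b 1 u z + (- c) * rescaled a b 1 v z" for z
  have cont: "continuous_on (cbox (0, 0) (pi, pi)) (rescaled a b 1 u)" "continuous_on (cbox (0, 0) (pi, pi)) (rescaled a b 1 v)"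
    using rescaled_continuous[OF ab _ _ uc] rescaled_continuous[OF ab _ _ vc] by auto
  show "u z = c * v z"
  proof (cases "z \<in> rectangle a b")
    case True
    then obtain x y where z: "z = (x, y)" "0 < x" "x < a" "0 < y" "y < b" by (auto simp: rectangle_def)
    have "W (pi * x / a, pi * y / b) = 0"
    proof (rule double_sine_system_complete)
      show "continuous_on (cbox (0, 0) (pi, pi)) W" unfolding W_def by (intro continuous_intros cont)
      show "square_coeff m n W = 0" if "1 \<le> m" "1 \<le> n" for m n
      proof -
        have "square_coeff m n W = square_coeff m n (rescaled a b 1 u) + (- c) * square_coeff m n (rescaled a b 1 v)"
          unfolding W_def by (subst square_coeff_add) (intro continuous_intros cont | simp only: square_coeff_cmult)+
        then show ?thesis using zero[OF that] by simp
      qed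
    qed (use z ab in \<open>auto simp: field_simps\<close>)
    moreover have "rescaled a b 1 f (pi * x / a, pi * y / b) = f z" for f
      using z ab by (subst rescaled_1) (auto simp: field_simps)
    ultimately show ?thesis by (simp add: W_def)
  qed (use u0 v0 in simp)
qed

section \<open>Simplicity of the eigenvalues and the index of an eigenvalue\<close>

lemma eigenspace_trivial:
  assumes ab: "0 < a" "0 < b" and u: "u \<in> dirichlet_eigenspace (rectangle a b) t"
    and ne: "\<And>m n. 1 \<le> m \<Longrightarrow> 1 \<le> n \<Longrightarrow> mode_ev a b m n \<noteq> t"
  shows "u = 0"
proof -
  have "u = (\<lambda>z. 0 * u z)"
    by (rule eigenspace_eq_zeroI[OF ab u u]) (simp add: eigenspace_coeff_zero[OF ab u ne])
  then show ?thesis by (simp add: fun_eq_iff)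
qed

lemma mode_nonzero:
  assumes "0 < a" "0 < b" "1 \<le> m" "1 \<le> n"
  shows "mode a b m n c (a / (2 * real m), b / (2 * real n)) = c" "(a / (2 * real m), b / (2 * real n)) \<in> rectangle a b"
proof -
  show mem: "(a / (2 * real m), b / (2 * real n)) \<in> rectangle a b"
    using assms by (auto simp: rectangle_def field_simps)
  have "real m * pi / a * (a / (2 * real m)) = pi / 2" "real n * pi / b * (b / (2 * real n)) = pi / 2"
    using assms by auto
  then show "mode a b m n c (a / (2 * real m), b / (2 * real n)) = c"
    using mem by (simp only: mode_def wave_def fst_conv snd_conv if_True sin_pi_half mult_1_right)
qed

text \<open>All coefficients except the one at (m, n) are non-resonant and vanish, so an element of
  the space is determined by a single number.\<close>

lemma eigenspace_simple:
  assumes ab: "0 < a" "0 < b" and mn: "1 \<le> m" "1 \<le> n"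
    and inj: "\<And>p q. 1 \<le> p \<Longrightarrow> 1 \<le> q \<Longrightarrow> mode_ev a b p q = mode_ev a b m n \<Longrightarrow> p = m \<and> q = n"
  shows "dirichlet_eigenspace (rectangle a b) (mode_ev a b m n) = range (mode a b m n)"
proof
  show "range (mode a b m n) \<subseteq> dirichlet_eigenspace (rectangle a b) (mode_ev a b m n)"
    using mode_in_eigenspace[OF ab] by auto
  have \<phi>: "mode a b m n 1 \<in> dirichlet_eigenspace (rectangle a b) (mode_ev a b m n)"
    by (rule mode_in_eigenspace[OF ab])
  define d where "d = square_coeff m n (rescaled a b 1 (mode a b m n 1))"
  have zero: "square_coeff p q (rescaled a b 1 u) = 0"
    if "u \<in> dirichlet_eigenspace (rectangle a b) (mode_ev a b m n)" "1 \<le> p" "1 \<le> q" "(p, q) \<noteq> (m, n)" for u p q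
    using eigenspace_coeff_zero[OF ab that(1)] inj that by blast
  \<comment> \<open>No integral is evaluated: were d zero, all coefficients of the mode would vanish
    and completeness would contradict its value at its first extremum.\<close>
  have "d \<noteq> 0"
  proof
    assume "d = 0"
    then have "square_coeff p q (rescaled a b 1 (mode a b m n 1)) = 0" if "1 \<le> p" "1 \<le> q" for p q
      using zero[OF \<phi> that] by (cases "(p, q) = (m, n)") (auto simp: d_def)
    then have "mode a b m n 1 = (\<lambda>z. 0 * mode a b m n 1 z)"
      by (intro eigenspace_eq_zeroI[OF ab \<phi> \<phi>]) simp
    then show False using mode_nonzero(1)[OF ab mn, of 1] by (simp add: fun_eq_iff)
  qed
  show "dirichlet_eigenspace (rectangle a b) (mode_ev a b m n) \<subseteq> range (mode a b m n)"
  proof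
    fix u assume u: "u \<in> dirichlet_eigenspace (rectangle a b) (mode_ev a b m n)"
    define c where "c = square_coeff m n (rescaled a b 1 u) / d"
    have "u = (\<lambda>z. c * mode a b m n 1 z)"
    proof (rule eigenspace_eq_zeroI[OF ab u \<phi>])
      fix p q :: nat assume pq: "1 \<le> p" "1 \<le> q"
      show "square_coeff p q (rescaled a b 1 u) = c * square_coeff p q (rescaled a b 1 (mode a b m n 1))"
        using zero[OF u pq] zero[OF \<phi> pq] \<open>d \<noteq> 0\<close> by (cases "(p, q) = (m, n)") (auto simp: d_def c_def)
    qed
    then have "u = mode a b m n c" by (auto simp: fun_eq_iff mode_def wave_def)
    then show "u \<in> range (mode a b m n)" by simp
  qed
qed

text \<open>Two different representations of one eigenvalue would exhibit
  \<open>a\<^sup>2 / b\<^sup>2\<close> as a quotient of integers.\<close>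

lemma mode_ev_inj:
  assumes ab: "0 < a" "0 < b" and irr: "a\<^sup>2 / b\<^sup>2 \<notin> \<rat>"
    and eq: "mode_ev a b p q = mode_ev a b m n"
  shows "p = m \<and> q = n"
proof -
  have "pi\<^sup>2 * ((real p / a)\<^sup>2 + (real q / b)\<^sup>2) = pi\<^sup>2 * ((real m / a)\<^sup>2 + (real n / b)\<^sup>2)"
    using eq by (simp add: mode_ev_def power_divide power_mult_distrib algebra_simps)
  then have "(real p / a)\<^sup>2 + (real q / b)\<^sup>2 = (real m / a)\<^sup>2 + (real n / b)\<^sup>2" by simp
  then have e: "(real p)\<^sup>2 - (real m)\<^sup>2 = (a\<^sup>2 / b\<^sup>2) * ((real n)\<^sup>2 - (real q)\<^sup>2)"
    using ab by (simp add: field_simps)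
  have "(real n)\<^sup>2 - (real q)\<^sup>2 = 0"
  proof (rule ccontr)
    assume nz: "(real n)\<^sup>2 - (real q)\<^sup>2 \<noteq> 0"
    then have "a\<^sup>2 / b\<^sup>2 = ((real p)\<^sup>2 - (real m)\<^sup>2) / ((real n)\<^sup>2 - (real q)\<^sup>2)" unfolding e by simp
    also have "\<dots> \<in> \<rat>" by (intro Rats_divide Rats_diff Rats_power Rats_of_nat)
    finally show False using irr by simp
  qed
  then have "(real n)\<^sup>2 = (real q)\<^sup>2" "(real p)\<^sup>2 = (real m)\<^sup>2" using e by auto
  then show ?thesis by simp
qed

text \<open>The hypothesis supplies some finite basis; comparison with the one-element basis of the
  mode, or with the zero space, fixes its size.\<close>

lemma rectangle_multiplicity:
  assumes ab: "0 < a" "0 < b" and irr: "a\<^sup>2 / b\<^sup>2 \<notin> \<rat>"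
    and mult: "has_multiplicity (rectangle a b) t k"
  shows "k = (if \<exists>m n. 1 \<le> m \<and> 1 \<le> n \<and> mode_ev a b m n = t then 1 else 0)"
proof -
  obtain B where B: "finite B" "card B = k" "fun_vs.independent B" "fun_vs.span B = dirichlet_eigenspace (rectangle a b) t"
    using mult by (auto simp: has_multiplicity_def)
  show ?thesis
  proof (cases "\<exists>m n. 1 \<le> m \<and> 1 \<le> n \<and> mode_ev a b m n = t")
    case True
    then obtain m n where mn: "1 \<le> m" "1 \<le> n" "mode_ev a b m n = t" by blast
    have "dirichlet_eigenspace (rectangle a b) t = range (mode a b m n)"
      using eigenspace_simple[OF ab mn(1,2)] mode_ev_inj[OF ab irr] mn(3) by blast
    also have "\<dots> = range (\<lambda>c z. c * mode a b m n 1 z)"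
      by (intro arg_cong[where f=range]) (auto simp: fun_eq_iff mode_def wave_def)
    also have "\<dots> = fun_vs.span {mode a b m n 1}" by (simp add: fun_vs.span_singleton)
    finally have "fun_vs.span {mode a b m n 1} = fun_vs.span B" using B by simp
    moreover have "fun_vs.independent {mode a b m n 1}"
      using mode_nonzero(1)[OF ab mn(1,2), of 1] unfolding fun_vs.dependent_single fun_eq_iff by (metis zero_fun_apply zero_neq_one)
    ultimately have "card {mode a b m n 1} = card B"
      using fun_vs.dim_eq_card[of "{mode a b m n 1}" B] B(3) fun_vs.dim_eq_card[of B B] by metis
    then show ?thesis using True B(2) by simp
  next
    case False
    then have "u = 0" if "u \<in> fun_vs.span B" for u
      using eigenspace_trivial[OF ab] that B(4) by blast
    then have "B \<subseteq> {0}" using fun_vs.span_superset by blast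
    moreover have "0 \<notin> B" using B(3) fun_vs.dependent_zero by blast
    ultimately have "B = {}" by blast
    then show ?thesis using False B(2) by auto
  qed
qed

text \<open>Since all multiplicities are 0 or 1, the list \<open>ev\<close> is strictly increasing
  from index 1 on and meets each mode eigenvalue once. An index therefore counts the mode
  eigenvalues not exceeding its own.\<close>

lemma spectrum_enumeration:
  assumes ab: "0 < a" "0 < b" and irr: "a\<^sup>2 / b\<^sup>2 \<notin> \<rat>"
    and spec: "dirichlet_spectrum (rectangle a b) ev"
  shows "\<And>k. 1 \<le> k \<Longrightarrow> \<exists>m n. 1 \<le> m \<and> 1 \<le> n \<and> ev k = mode_ev a b m n"
    and "\<And>m n. 1 \<le> m \<Longrightarrow> 1 \<le> n \<Longrightarrow> \<exists>k\<ge>1. ev k = mode_ev a b m n"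
    and "\<And>k m n. 1 \<le> k \<Longrightarrow> 1 \<le> m \<Longrightarrow> 1 \<le> n \<Longrightarrow> ev k = mode_ev a b m n \<Longrightarrow>
      card (lattice_points a b (sqrt ((m / a)\<^sup>2 + (n / b)\<^sup>2))) = k"
proof -
  have mono: "mono_on {1..} ev" and fin: "finite {k. 1 \<le> k \<and> ev k = t}"
    and card: "card {k. 1 \<le> k \<and> ev k = t} = (if \<exists>m n. 1 \<le> m \<and> 1 \<le> n \<and> mode_ev a b m n = t then 1 else 0)" for t
    using spec rectangle_multiplicity[OF ab irr] unfolding dirichlet_spectrum_def by blast+
  show ex1: "\<exists>m n. 1 \<le> m \<and> 1 \<le> n \<and> ev k = mode_ev a b m n" if "1 \<le> k" for k
  proof (rule ccontr)
    assume "\<not> ?thesis"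
    then have "card {j. 1 \<le> j \<and> ev j = ev k} = 0" using card[of "ev k"] by metis
    then show False using fin[of "ev k"] that by auto
  qed
  show ex2: "\<exists>k\<ge>1. ev k = mode_ev a b m n" if "1 \<le> m" "1 \<le> n" for m n
  proof -
    have "card {j. 1 \<le> j \<and> ev j = mode_ev a b m n} = 1" unfolding card using that by auto
    then have "{j. 1 \<le> j \<and> ev j = mode_ev a b m n} \<noteq> {}" by (metis card.empty zero_neq_one)
    then show ?thesis by blast
  qed
  have inj: "j = k" if "1 \<le> j" "1 \<le> k" "ev j = ev k" for j k
  proof (rule ccontr)
    assume "j \<noteq> k"
    have "card {j, k} \<le> card {i. 1 \<le> i \<and> ev i = ev k}" using that by (intro card_mono fin) auto
    then show False using \<open>j \<noteq> k\<close> unfolding card by (simp split: if_splits)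
  qed
  have le: "ev j \<le> ev k \<longleftrightarrow> j \<le> k" if "1 \<le> j" "1 \<le> k" for j k
    using mono that inj unfolding mono_on_def by (metis atLeast_iff eq_iff nat_le_linear)
  fix k m n :: nat assume k: "1 \<le> k" and mn: "1 \<le> m" "1 \<le> n" "ev k = mode_ev a b m n"
  let ?R = "sqrt ((m / a)\<^sup>2 + (n / b)\<^sup>2)"
  have ev_eq: "mode_ev a b p q = pi\<^sup>2 * ((p / a)\<^sup>2 + (q / b)\<^sup>2)" for p q
    by (simp add: mode_ev_def power_divide power_mult_distrib algebra_simps)
  have lat: "(p, q) \<in> lattice_points a b ?R \<longleftrightarrow> 1 \<le> p \<and> 1 \<le> q \<and> mode_ev a b p q \<le> ev k" for p q
    unfolding lattice_points_def mn(3) ev_eq by (simp add: mult_le_cancel_left_pos)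
  \<comment> \<open>Both sides are injective images, of the first k indices and of the lattice
    points, so the cardinalities agree.\<close>
  have "ev ` {1..k} = (\<lambda>(p, q). mode_ev a b p q) ` lattice_points a b ?R"
  proof safe
    fix j assume "j \<in> {1..k}"
    then have j: "1 \<le> j" "ev j \<le> ev k" using le k by auto
    then obtain p q where "1 \<le> p" "1 \<le> q" "ev j = mode_ev a b p q" using ex1 by blast
    then show "ev j \<in> (\<lambda>(p, q). mode_ev a b p q) ` lattice_points a b ?R"
      using j lat[of p q] by (intro image_eqI[of _ _ "(p, q)"]) auto
  next
    fix p q assume "(p, q) \<in> lattice_points a b ?R"
    then have pq: "1 \<le> p" "1 \<le> q" "mode_ev a b p q \<le> ev k" using lat by auto
    then obtain j where "1 \<le> j" "ev j = mode_ev a b p q" using ex2 by blast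
    then show "mode_ev a b p q \<in> ev ` {1..k}" using pq le[of j k] k by (intro image_eqI[of _ _ j]) auto
  qed
  moreover have "inj_on ev {1..k}" using inj by (intro inj_onI) auto
  moreover have "inj_on (\<lambda>(p, q). mode_ev a b p q) (lattice_points a b ?R)"
    using mode_ev_inj[OF ab irr] by (intro inj_onI) auto
  ultimately show "card (lattice_points a b ?R) = k"
    by (metis card_image card_atLeastAtMost diff_Suc_1)
qed

lemma eigenfunction_is_mode:
  assumes ab: "0 < a" "0 < b" and irr: "a\<^sup>2 / b\<^sup>2 \<notin> \<rat>" and mn: "1 \<le> m" "1 \<le> n"
    and u: "dirichlet_eigenfunction (rectangle a b) (mode_ev a b m n) u"
  obtains c where "c \<noteq> 0" "u = mode a b m n c"
proof -
  have "u \<in> range (mode a b m n)"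
    using u eigenspace_simple[OF ab mn] mode_ev_inj[OF ab irr] unfolding dirichlet_eigenfunction_def by blast
  then obtain c where c: "u = mode a b m n c" by auto
  moreover have "c \<noteq> 0" using u c by (auto simp: dirichlet_eigenfunction_def mode_def wave_def)
  ultimately show thesis using that by blast
qed

section \<open>Uniqueness of the analytic extension\<close>

text \<open>A power series with a nonzero coefficient of positive order and value 0 at the centre
  has an isolated zero there. Vanishing on one side already contradicts this, and at a boundary
  point of the rectangle no more is available.\<close>

lemma power_series_zero_one_sided:
  fixes a :: "nat \<Rightarrow> real"
  assumes ser: "\<And>h. \<bar>h\<bar> < \<rho> \<Longrightarrow> (\<lambda>i. a i * h ^ i) sums g h"
    and r: "0 < r" "r \<le> \<rho>" and \<sigma>: "\<sigma> = 1 \<or> \<sigma> = -1"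
    and zero: "\<And>h. 0 \<le> h \<Longrightarrow> h < r \<Longrightarrow> g (\<sigma> * h) = 0"
    and h: "\<bar>h\<bar> < \<rho>"
  shows "g h = 0"
proof -
  have g0: "g 0 = 0" using zero[of 0] r by simp
  have "a m = 0" for m
  proof (cases "m = 0")
    case True
    have "(\<lambda>i. a i * 0 ^ i) sums a 0" by (rule powser_sums_zero)
    moreover have "(\<lambda>i. a i * 0 ^ i) sums g 0" using ser[of 0] r by simp
    ultimately have "a 0 = g 0" by (rule sums_unique2)
    then show ?thesis using g0 True by simp
  next
    case False
    show ?thesis
    proof (rule ccontr)
      assume "a m \<noteq> 0"
      then obtain s where s: "0 < s" "\<And>z. z \<in> cball 0 s - {0} \<Longrightarrow> g z \<noteq> 0"
        using powser_0_nonzero[of \<rho> 0 a g m] ser g0 False r by auto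
      have "g (\<sigma> * min s (r / 2)) \<noteq> 0" using s r \<sigma> by (intro s(2)) auto
      moreover have "g (\<sigma> * min s (r / 2)) = 0" using s r by (intro zero) auto
      ultimately show False by simp
    qed
  qed
  then have "(\<lambda>i. 0) sums g h" using ser[OF h] by simp
  then show ?thesis by (rule sums_unique2[OF _ sums_zero])
qed

text \<open>With k frozen, the double series is regrouped into a power series in h whose
  coefficients are the row sums, and the one-variable statement applies.\<close>

lemma double_power_series_zero_step:
  fixes c :: "nat \<Rightarrow> nat \<Rightarrow> real"
  assumes ser: "\<And>h k. \<bar>h\<bar> < \<rho> \<Longrightarrow> \<bar>k\<bar> < \<rho> \<Longrightarrow> ((\<lambda>(i, j). c i j * h ^ i * k ^ j) has_sum f h k) UNIV"
    and r: "0 < r" "r \<le> \<rho>" and \<sigma>: "\<sigma> = 1 \<or> \<sigma> = -1"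
    and k: "\<bar>k\<bar> < \<rho>" and zero: "\<And>h. 0 \<le> h \<Longrightarrow> h < r \<Longrightarrow> f (\<sigma> * h) k = 0"
    and h: "\<bar>h\<bar> < \<rho>"
  shows "f h k = 0"
proof (rule power_series_zero_one_sided[where g="\<lambda>h. f h k", OF _ r \<sigma> zero h])
  have inner: "(\<lambda>j. c i j * k ^ j) summable_on UNIV" for i
  proof -
    \<comment> \<open>Any nonzero argument in range would do: dividing row i by its i-th power shows
      that the row itself is summable.\<close>
    define h1 where "h1 = r / 2"
    have h1: "\<bar>h1\<bar> < \<rho>" "h1 \<noteq> 0" using r by (auto simp: h1_def)
    have "(\<lambda>(i, j). c i j * h1 ^ i * k ^ j) summable_on (UNIV \<times> UNIV)"
      using ser[OF h1(1) k] by (auto simp: summable_on_def)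
    then have "(\<lambda>(i, j). c i j * h1 ^ i * k ^ j) summable_on (Pair i ` UNIV)"
      by (rule summable_on_subset_banach) auto
    then have "(\<lambda>j. c i j * h1 ^ i * k ^ j) summable_on UNIV"
      by (subst (asm) summable_on_reindex) (auto simp: inj_on_def o_def)
    from summable_on_cmult_left[OF this, of "inverse (h1 ^ i)"]
    show ?thesis using h1(2) by (simp add: field_simps)
  qed
  fix h :: real assume h: "\<bar>h\<bar> < \<rho>"
  have "((\<lambda>i. (\<Sum>\<^sub>\<infinity>j. c i j * k ^ j) * h ^ i) has_sum f h k) UNIV"
  proof (rule has_sum_SigmaD[where B="\<lambda>_. UNIV"])
    show "((\<lambda>(i, j). c i j * h ^ i * k ^ j) has_sum f h k) (UNIV \<times> UNIV)" using ser[OF h k] by simp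
    fix i :: nat
    have "((\<lambda>j. c i j * k ^ j * h ^ i) has_sum (\<Sum>\<^sub>\<infinity>j. c i j * k ^ j) * h ^ i) UNIV"
      by (intro has_sum_cmult_left has_sum_infsum inner)
    then show "((\<lambda>j. (\<lambda>(i, j). c i j * h ^ i * k ^ j) (i, j)) has_sum (\<Sum>\<^sub>\<infinity>j. c i j * k ^ j) * h ^ i) UNIV"
      by (simp add: mult_ac)
  qed
  then show "(\<lambda>i. (\<Sum>\<^sub>\<infinity>j. c i j * k ^ j) * h ^ i) sums f h k" by (rule has_sum_imp_sums)
qed

text \<open>Two sweeps: for k on the inward side the zeros spread to all h, and then for every h
  they spread to all k.\<close>

lemma double_power_series_zero:
  fixes c :: "nat \<Rightarrow> nat \<Rightarrow> real"
  assumes ser: "\<And>h k. \<bar>h\<bar> < \<rho> \<Longrightarrow> \<bar>k\<bar> < \<rho> \<Longrightarrow> ((\<lambda>(i, j). c i j * h ^ i * k ^ j) has_sum f h k) UNIV"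
    and r: "0 < r" "r \<le> \<rho>" and \<sigma>: "\<sigma> = 1 \<or> \<sigma> = -1" and \<tau>: "\<tau> = 1 \<or> \<tau> = -1"
    and zero: "\<And>h k. 0 \<le> h \<Longrightarrow> h < r \<Longrightarrow> 0 \<le> k \<Longrightarrow> k < r \<Longrightarrow> f (\<sigma> * h) (\<tau> * k) = 0"
    and h: "\<bar>h\<bar> < \<rho>" and k: "\<bar>k\<bar> < \<rho>"
  shows "f h k = 0"
proof -
  have sw: "((\<lambda>(j, i). c i j * k ^ j * h ^ i) has_sum f h k) UNIV" if "\<bar>h\<bar> < \<rho>" "\<bar>k\<bar> < \<rho>" for h k
  proof -
    have "((\<lambda>(i, j). c i j * h ^ i * k ^ j) has_sum f h k) (prod.swap ` UNIV)" using ser[OF that] by simp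
    then show ?thesis
      by (subst (asm) has_sum_reindex) (auto simp: o_def case_prod_unfold mult_ac)
  qed
  have 1: "f h (\<tau> * k) = 0" if "\<bar>h\<bar> < \<rho>" "0 \<le> k" "k < r" for h k
    by (rule double_power_series_zero_step[OF ser r \<sigma>]) (use that zero \<tau> r in auto)
  show ?thesis
    by (rule double_power_series_zero_step[where f="\<lambda>k h. f h k" and c="\<lambda>j i. c i j", OF sw r \<tau> h _ k])
      (use 1 h in auto)
qed

lemma sin_shift_power_series:
  fixes \<alpha> x :: real
  obtains p where "\<And>h. (\<lambda>i. norm (p i * h ^ i)) summable_on UNIV"
    "\<And>h. ((\<lambda>i. p i * h ^ i) has_sum sin (\<alpha> * (x + h))) UNIV"
proof -
  define p where "p i = (sin (\<alpha> * x) * cos_coeff i + cos (\<alpha> * x) * sin_coeff i) * \<alpha> ^ i" for i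
  have eq: "p i * h ^ i = sin (\<alpha> * x) * (cos_coeff i *\<^sub>R (\<alpha> * h) ^ i) + cos (\<alpha> * x) * (sin_coeff i *\<^sub>R (\<alpha> * h) ^ i)" for i h
    by (simp add: p_def power_mult_distrib algebra_simps)
  have s: "summable (\<lambda>i. norm (p i * h ^ i))" for h
  proof (rule summable_comparison_test')
    show "summable (\<lambda>i. norm (cos_coeff i *\<^sub>R (\<alpha> * h) ^ i) + norm (sin_coeff i *\<^sub>R (\<alpha> * h) ^ i))"
      by (intro summable_add summable_norm_cos summable_norm_sin)
    fix i
    have "norm (p i * h ^ i) \<le> \<bar>sin (\<alpha> * x)\<bar> * norm (cos_coeff i *\<^sub>R (\<alpha> * h) ^ i) + \<bar>cos (\<alpha> * x)\<bar> * norm (sin_coeff i *\<^sub>R (\<alpha> * h) ^ i)"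
      unfolding eq by (rule order_trans[OF norm_triangle_ineq]) (simp add: abs_mult)
    also have "\<dots> \<le> 1 * norm (cos_coeff i *\<^sub>R (\<alpha> * h) ^ i) + 1 * norm (sin_coeff i *\<^sub>R (\<alpha> * h) ^ i)"
      by (intro add_mono mult_right_mono) auto
    finally show "norm (norm (p i * h ^ i)) \<le> norm (cos_coeff i *\<^sub>R (\<alpha> * h) ^ i) + norm (sin_coeff i *\<^sub>R (\<alpha> * h) ^ i)" by simp
  qed
  have sums: "(\<lambda>i. p i * h ^ i) sums sin (\<alpha> * (x + h))" for h
    unfolding eq distrib_left sin_add by (intro sums_add sums_mult cos_converges sin_converges)
  show thesis
  proof (rule that[of p])
    fix h
    show "((\<lambda>i. p i * h ^ i) has_sum sin (\<alpha> * (x + h))) UNIV"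
      by (rule norm_summable_imp_has_sum[OF s sums])
    show "(\<lambda>i. norm (p i * h ^ i)) summable_on UNIV"
      by (rule norm_summable_imp_summable_on) (use s[of h] in simp)
  qed
qed

lemma has_sum_product_abs:
  fixes f g :: "nat \<Rightarrow> real"
  assumes "(\<lambda>i. norm (f i)) summable_on UNIV" "(\<lambda>i. norm (g i)) summable_on UNIV"
    and "(f has_sum s) UNIV" "(g has_sum t) UNIV"
  shows "((\<lambda>(i, j). f i * g j) has_sum s * t) UNIV"
proof -
  have "(\<lambda>x. norm ((\<lambda>(i, j). f i * g j) x)) summable_on (UNIV \<times> UNIV)"
    unfolding Infinite_Sum.abs_summable_on_Sigma_iff
  proof (intro conjI ballI)
    fix i
    show "(\<lambda>j. norm ((\<lambda>(i, j). f i * g j) (i, j))) summable_on UNIV"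
      using summable_on_cmult_right[OF assms(2), of "\<bar>f i\<bar>"] by (simp add: abs_mult)
  next
    have "(\<lambda>i. norm (f i) * (\<Sum>\<^sub>\<infinity>j. norm (g j))) summable_on UNIV"
      by (rule summable_on_cmult_left[OF assms(1)])
    moreover have "(\<Sum>\<^sub>\<infinity>j. norm (g j)) \<ge> 0" by (rule infsum_nonneg) simp
    ultimately show "(\<lambda>i. norm (\<Sum>\<^sub>\<infinity>j. norm ((\<lambda>(i, j). f i * g j) (i, j)))) summable_on UNIV"
      by (simp add: abs_mult infsum_cmult_right')
  qed
  then have summ: "(\<lambda>(i, j). f i * g j) summable_on (UNIV \<times> UNIV)" by (rule abs_summable_summable)
  have "infsum (\<lambda>(i, j). f i * g j) (UNIV \<times> UNIV) = (\<Sum>\<^sub>\<infinity>i. \<Sum>\<^sub>\<infinity>j. f i * g j)"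
    using infsum_Sigma'_banach[OF summ] by simp
  also have "\<dots> = s * t"
    using infsumI[OF assms(3)] infsumI[OF assms(4)] by (simp add: infsum_cmult_right' infsum_cmult_left')
  finally show ?thesis using has_sum_infsum[OF summ] by simp
qed

lemma wave_power_series:
  obtains c' where "\<And>h k. ((\<lambda>(i, j). c' i j * h ^ i * k ^ j) has_sum wave c \<alpha> \<beta> (z + (h, k))) UNIV"
proof -
  obtain p where p: "\<And>h. (\<lambda>i. norm (p i * h ^ i)) summable_on UNIV"
    "\<And>h. ((\<lambda>i. p i * h ^ i) has_sum sin (\<alpha> * (fst z + h))) UNIV"
    using sin_shift_power_series[of \<alpha> "fst z"] by blast
  obtain q where q: "\<And>h. (\<lambda>i. norm (q i * h ^ i)) summable_on UNIV"
    "\<And>h. ((\<lambda>i. q i * h ^ i) has_sum sin (\<beta> * (snd z + h))) UNIV"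
    using sin_shift_power_series[of \<beta> "snd z"] by blast
  show thesis
  proof (rule that[of "\<lambda>i j. c * (p i * q j)"])
    fix h k
    have "((\<lambda>(i, j). (p i * h ^ i) * (q j * k ^ j)) has_sum sin (\<alpha> * (fst z + h)) * sin (\<beta> * (snd z + k))) UNIV"
      by (rule has_sum_product_abs[OF p(1) q(1) p(2) q(2)])
    from has_sum_cmult_right[OF this, of c]
    show "((\<lambda>(i, j). c * (p i * q j) * h ^ i * k ^ j) has_sum wave c \<alpha> \<beta> (z + (h, k))) UNIV"
      by (simp add: wave_def case_prod_unfold mult_ac)
  qed
qed

lemma wave_real_analytic: "wave c \<alpha> \<beta> real_analytic_on UNIV"
  unfolding real_analytic_on_def
proof
  fix z :: "real \<times> real"
  obtain c' where "\<And>h k. ((\<lambda>(i, j). c' i j * h ^ i * k ^ j) has_sum wave c \<alpha> \<beta> (z + (h, k))) UNIV"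
    using wave_power_series by blast
  then show "\<exists>c'. \<exists>\<rho>>0. \<forall>h k. \<bar>h\<bar> < \<rho> \<longrightarrow> \<bar>k\<bar> < \<rho> \<longrightarrow>
      ((\<lambda>(i, j). c' i j * h ^ i * k ^ j) has_sum wave c \<alpha> \<beta> (z + (h, k))) UNIV"
    by (intro exI[of _ c'] exI[of _ 1]) auto
qed

text \<open>The sign points towards the midpoint, which leaves room for half the length, also at an
  end point.\<close>

lemma interval_inward:
  fixes a x :: real
  assumes "0 < a" "x \<in> {0..a}"
  obtains \<sigma> where "\<sigma> = 1 \<or> \<sigma> = -1" "\<And>h. 0 \<le> h \<Longrightarrow> h < a / 2 \<Longrightarrow> x + \<sigma> * h \<in> {0..a}"
proof (cases "x \<le> a / 2")
  case True
  then show thesis using assms by (intro that[of 1]) auto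
next
  case False
  then show thesis using assms by (intro that[of "-1"]) auto
qed

text \<open>On the closure the extension is known, hence at a side or a corner only on a quadrant
  pointing inward. The difference of the two power series vanishes there and so on a full
  neighbourhood.\<close>

lemma analytic_extension_wave:
  assumes ab: "0 < a" "0 < b"
    and ext: "analytic_extension (rectangle a b) u v"
    and u: "\<And>z. z \<in> closure (rectangle a b) \<Longrightarrow> u z = wave c \<alpha> \<beta> z"
    and z: "z \<in> closure (rectangle a b)"
  shows "\<forall>\<^sub>F w in nhds z. v w = wave c \<alpha> \<beta> w"
proof -
  have v: "v w = wave c \<alpha> \<beta> w" if "w \<in> closure (rectangle a b)" for w
    using ext u that by (auto simp: analytic_extension_def)
  obtain c1 \<rho> where \<rho>: "\<rho> > 0" and c1: "\<And>h k. \<bar>h\<bar> < \<rho> \<Longrightarrow> \<bar>k\<bar> < \<rho> \<Longrightarrow>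
      ((\<lambda>(i, j). c1 i j * h ^ i * k ^ j) has_sum v (z + (h, k))) UNIV"
    using ext z unfolding analytic_extension_def real_analytic_on_def by blast
  obtain c2 where c2: "\<And>h k. ((\<lambda>(i, j). c2 i j * h ^ i * k ^ j) has_sum wave c \<alpha> \<beta> (z + (h, k))) UNIV"
    using wave_power_series by blast
  have z': "fst z \<in> {0..a}" "snd z \<in> {0..b}" using z unfolding closure_rectangle[OF ab] by auto
  obtain \<sigma> where \<sigma>: "\<sigma> = 1 \<or> \<sigma> = -1" "\<And>h. 0 \<le> h \<Longrightarrow> h < a / 2 \<Longrightarrow> fst z + \<sigma> * h \<in> {0..a}"
    using interval_inward[OF ab(1) z'(1)] by metis
  obtain \<tau> where \<tau>: "\<tau> = 1 \<or> \<tau> = -1" "\<And>h. 0 \<le> h \<Longrightarrow> h < b / 2 \<Longrightarrow> snd z + \<tau> * h \<in> {0..b}"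
    using interval_inward[OF ab(2) z'(2)] by metis
  define r where "r = min \<rho> (min (a / 2) (b / 2))"
  have r: "0 < r" "r \<le> \<rho>" using \<rho> ab by (auto simp: r_def)
  have near: "v (z + (h, k)) - wave c \<alpha> \<beta> (z + (h, k)) = 0" if "\<bar>h\<bar> < \<rho>" "\<bar>k\<bar> < \<rho>" for h k
  proof (rule double_power_series_zero[where c="\<lambda>i j. c1 i j - c2 i j" and f="\<lambda>h k. v (z + (h, k)) - wave c \<alpha> \<beta> (z + (h, k))",
        OF _ r \<sigma>(1) \<tau>(1) _ that])
    fix h k :: real assume "\<bar>h\<bar> < \<rho>" "\<bar>k\<bar> < \<rho>"
    from has_sum_add[OF c1[OF this] has_sum_cmult_right[OF c2[of h k], of "-1"]]
    show "((\<lambda>(i, j). (c1 i j - c2 i j) * h ^ i * k ^ j) has_sum v (z + (h, k)) - wave c \<alpha> \<beta> (z + (h, k))) UNIV"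
      by (simp add: case_prod_unfold algebra_simps)
  next
    fix h k assume "0 \<le> h" "h < r" "0 \<le> k" "k < r"
    then have "z + (\<sigma> * h, \<tau> * k) \<in> closure (rectangle a b)"
      using \<sigma>(2)[of h] \<tau>(2)[of k] ab by (cases z) (auto simp: r_def closure_rectangle)
    then show "v (z + (\<sigma> * h, \<tau> * k)) - wave c \<alpha> \<beta> (z + (\<sigma> * h, \<tau> * k)) = 0" using v by simp
  qed
  have "\<forall>\<^sub>F w in nhds z. dist w z < \<rho>" unfolding eventually_nhds_metric using \<rho> by auto
  then show ?thesis
  proof eventually_elim
    case (elim w)
    have "\<bar>fst w - fst z\<bar> < \<rho>" "\<bar>snd w - snd z\<bar> < \<rho>"
      using elim dist_fst_le[of w z] dist_snd_le[of w z] by (auto simp: dist_real_def)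
    from near[OF this] show ?case by (cases w; cases z) simp
  qed
qed

section \<open>The gradient flow\<close>

lemma gradient_wave:
  "gradient (wave c \<alpha> \<beta>) z =
    (c * \<alpha> * (cos (\<alpha> * fst z) * sin (\<beta> * snd z)), c * \<beta> * (sin (\<alpha> * fst z) * cos (\<beta> * snd z)))"
  unfolding gradient_def wave_pd by (simp only: mult.assoc mult.left_commute[of _ \<beta>])

text \<open>The differential equation without confinement to the closure: orbits are first built in
  the whole plane and cut to the rectangle later.\<close>

definition wave_flow_on :: "real \<Rightarrow> real \<Rightarrow> real \<Rightarrow> real set \<Rightarrow> (real \<Rightarrow> real \<times> real) \<Rightarrow> bool" where
  "wave_flow_on c \<alpha> \<beta> I \<gamma> \<longleftrightarrow>
     (\<forall>t\<in>I. (\<gamma> has_vector_derivative - gradient (wave c \<alpha> \<beta>) (\<gamma> t)) (at t within I))"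

lemma has_vector_derivative_prod_iff:
  fixes \<gamma> :: "real \<Rightarrow> real \<times> real"
  shows "(\<gamma> has_vector_derivative (d, e)) (at x within S) \<longleftrightarrow>
    ((\<lambda>t. fst (\<gamma> t)) has_vector_derivative d) (at x within S) \<and> ((\<lambda>t. snd (\<gamma> t)) has_vector_derivative e) (at x within S)"
proof safe
  assume "(\<gamma> has_vector_derivative (d, e)) (at x within S)"
  then show "((\<lambda>t. fst (\<gamma> t)) has_vector_derivative d) (at x within S)" "((\<lambda>t. snd (\<gamma> t)) has_vector_derivative e) (at x within S)"
    unfolding has_vector_derivative_def
    by (auto intro!: derivative_eq_intros)
next
  assume "((\<lambda>t. fst (\<gamma> t)) has_vector_derivative d) (at x within S)" "((\<lambda>t. snd (\<gamma> t)) has_vector_derivative e) (at x within S)"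
  then have "((\<lambda>t. (fst (\<gamma> t), snd (\<gamma> t))) has_derivative (\<lambda>h. (h *\<^sub>R d, h *\<^sub>R e))) (at x within S)"
    unfolding has_vector_derivative_def by (rule has_derivative_Pair)
  then show "(\<gamma> has_vector_derivative (d, e)) (at x within S)" by (simp add: has_vector_derivative_def)
qed

lemma wave_flow_on_iff:
  "wave_flow_on c \<alpha> \<beta> I \<gamma> \<longleftrightarrow> (\<forall>t\<in>I.
     ((\<lambda>t. fst (\<gamma> t)) has_real_derivative - c * \<alpha> * (cos (\<alpha> * fst (\<gamma> t)) * sin (\<beta> * snd (\<gamma> t)))) (at t within I) \<and>
     ((\<lambda>t. snd (\<gamma> t)) has_real_derivative - c * \<beta> * (sin (\<alpha> * fst (\<gamma> t)) * cos (\<beta> * snd (\<gamma> t)))) (at t within I))"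
proof -
  have "- gradient (wave c \<alpha> \<beta>) z =
      (- c * \<alpha> * (cos (\<alpha> * fst z) * sin (\<beta> * snd z)), - c * \<beta> * (sin (\<alpha> * fst z) * cos (\<beta> * snd z)))" for z
    unfolding gradient_wave by simp
  then show ?thesis
    by (simp only: wave_flow_on_def has_vector_derivative_prod_iff has_real_derivative_iff_has_vector_derivative)
qed

lemma wave_flow_on_subset: "wave_flow_on c \<alpha> \<beta> I \<gamma> \<Longrightarrow> J \<subseteq> I \<Longrightarrow> wave_flow_on c \<alpha> \<beta> J \<gamma>"
  unfolding wave_flow_on_def by (auto intro: has_vector_derivative_within_subset)

lemma cos_sin_lipschitz:
  fixes p q p' q' :: real
  shows "\<bar>cos p * sin q - cos p' * sin q'\<bar> \<le> \<bar>p - p'\<bar> + \<bar>q - q'\<bar>"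
proof -
  have c: "\<bar>cos p - cos p'\<bar> \<le> \<bar>p - p'\<bar>"
  proof -
    have "\<bar>cos p - cos p'\<bar> = 2 * (\<bar>sin ((p + p') / 2)\<bar> * \<bar>sin ((p' - p) / 2)\<bar>)"
      by (simp add: cos_diff_cos abs_mult)
    also have "\<dots> \<le> 2 * (1 * \<bar>(p' - p) / 2\<bar>)"
      by (intro mult_left_mono mult_mono abs_sin_x_le_abs_x) auto
    finally show ?thesis by (simp add: abs_minus_commute)
  qed
  have s: "\<bar>sin q - sin q'\<bar> \<le> \<bar>q - q'\<bar>"
  proof -
    have "\<bar>sin q - sin q'\<bar> = 2 * (\<bar>sin ((q - q') / 2)\<bar> * \<bar>cos ((q + q') / 2)\<bar>)"
      by (simp add: sin_diff_sin abs_mult)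
    also have "\<dots> \<le> 2 * (\<bar>(q - q') / 2\<bar> * 1)"
      by (intro mult_left_mono mult_mono abs_sin_x_le_abs_x) auto
    finally show ?thesis by simp
  qed
  have "cos p * sin q - cos p' * sin q' = (cos p - cos p') * sin q + cos p' * (sin q - sin q')"
    by (simp add: algebra_simps)
  also have "\<bar>\<dots>\<bar> \<le> \<bar>cos p - cos p'\<bar> * \<bar>sin q\<bar> + \<bar>cos p'\<bar> * \<bar>sin q - sin q'\<bar>"
    by (rule order_trans[OF abs_triangle_ineq]) (simp add: abs_mult)
  also have "\<dots> \<le> \<bar>p - p'\<bar> * 1 + 1 * \<bar>q - q'\<bar>"
    by (intro add_mono mult_mono c s) auto
  finally show ?thesis by simp
qed

text \<open>Gronwall for the squared distance D: its derivative lies between -M D and M D, so D exp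
  (-M t) decreases and D exp (M t) increases. The first settles forward uniqueness, the second
  backward; both are needed as orbits are followed into the past as well.\<close>

lemma wave_flow_unique:
  assumes lh: "lo \<le> hi" and f1: "wave_flow_on c \<alpha> \<beta> {lo..hi} \<gamma>" and f2: "wave_flow_on c \<alpha> \<beta> {lo..hi} \<delta>"
    and pos: "\<alpha> > 0" "\<beta> > 0"
  shows "\<gamma> lo = \<delta> lo \<longleftrightarrow> \<gamma> hi = \<delta> hi"
proof -
  define X where "X t = fst (\<gamma> t) - fst (\<delta> t)" for t
  define Y where "Y t = snd (\<gamma> t) - snd (\<delta> t)" for t
  define D where "D t = (X t)\<^sup>2 + (Y t)\<^sup>2" for t
  define X' where "X' t = - c * \<alpha> * (cos (\<alpha> * fst (\<gamma> t)) * sin (\<beta> * snd (\<gamma> t)) - cos (\<alpha> * fst (\<delta> t)) * sin (\<beta> * snd (\<delta> t)))" for t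
  define Y' where "Y' t = - c * \<beta> * (cos (\<beta> * snd (\<gamma> t)) * sin (\<alpha> * fst (\<gamma> t)) - cos (\<beta> * snd (\<delta> t)) * sin (\<alpha> * fst (\<delta> t)))" for t
  \<comment> \<open>With u and w the phase differences, the derivative is at most
    \<open>2 * \<bar>c\<bar> * (u + w)\<^sup>2\<close>, which is at most
    \<open>4 * \<bar>c\<bar> * (u\<^sup>2 + w\<^sup>2)\<close>.\<close>
  define M where "M = 4 * \<bar>c\<bar> * (\<alpha>\<^sup>2 + \<beta>\<^sup>2)"
  have dX: "(X has_real_derivative X' t) (at t within {lo..hi})"
    and dY: "(Y has_real_derivative Y' t) (at t within {lo..hi})" if "t \<in> {lo..hi}" for t
  proof -
    from f1[unfolded wave_flow_on_iff] f2[unfolded wave_flow_on_iff] that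
    have *: "((\<lambda>t. fst (\<gamma> t)) has_real_derivative - c * \<alpha> * (cos (\<alpha> * fst (\<gamma> t)) * sin (\<beta> * snd (\<gamma> t)))) (at t within {lo..hi})"
      "((\<lambda>t. snd (\<gamma> t)) has_real_derivative - c * \<beta> * (sin (\<alpha> * fst (\<gamma> t)) * cos (\<beta> * snd (\<gamma> t)))) (at t within {lo..hi})"
      "((\<lambda>t. fst (\<delta> t)) has_real_derivative - c * \<alpha> * (cos (\<alpha> * fst (\<delta> t)) * sin (\<beta> * snd (\<delta> t)))) (at t within {lo..hi})"
      "((\<lambda>t. snd (\<delta> t)) has_real_derivative - c * \<beta> * (sin (\<alpha> * fst (\<delta> t)) * cos (\<beta> * snd (\<delta> t)))) (at t within {lo..hi})"
      by blast+
    show "(X has_real_derivative X' t) (at t within {lo..hi})"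
      using DERIV_diff[OF *(1,3)] by (simp add: X_def[abs_def] X'_def algebra_simps)
    show "(Y has_real_derivative Y' t) (at t within {lo..hi})"
      using DERIV_diff[OF *(2,4)] by (simp add: Y_def[abs_def] Y'_def algebra_simps)
  qed
  have dD: "(D has_real_derivative 2 * X t * X' t + 2 * Y t * Y' t) (at t within {lo..hi})" if "t \<in> {lo..hi}" for t
    unfolding D_def using dX[OF that] dY[OF that] by (auto intro!: derivative_eq_intros)
  have bd: "\<bar>2 * X t * X' t + 2 * Y t * Y' t\<bar> \<le> M * D t" for t
  proof -
    define u where "u = \<alpha> * \<bar>X t\<bar>"
    define w where "w = \<beta> * \<bar>Y t\<bar>"
    have ux: "\<bar>\<alpha> * fst (\<gamma> t) - \<alpha> * fst (\<delta> t)\<bar> = u"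
      using pos by (simp add: u_def X_def right_diff_distrib[symmetric] abs_mult)
    have wy: "\<bar>\<beta> * snd (\<gamma> t) - \<beta> * snd (\<delta> t)\<bar> = w"
      using pos by (simp add: w_def Y_def right_diff_distrib[symmetric] abs_mult)
    have "\<bar>X' t\<bar> = \<bar>c\<bar> * \<alpha> * \<bar>cos (\<alpha> * fst (\<gamma> t)) * sin (\<beta> * snd (\<gamma> t)) - cos (\<alpha> * fst (\<delta> t)) * sin (\<beta> * snd (\<delta> t))\<bar>"
      using pos by (simp add: X'_def abs_mult)
    also have "\<dots> \<le> \<bar>c\<bar> * \<alpha> * (u + w)"
      using cos_sin_lipschitz[of "\<alpha> * fst (\<gamma> t)" "\<beta> * snd (\<gamma> t)" "\<alpha> * fst (\<delta> t)" "\<beta> * snd (\<delta> t)"] pos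
      unfolding ux wy by (intro mult_left_mono) auto
    finally have X': "\<bar>X' t\<bar> \<le> \<bar>c\<bar> * \<alpha> * (u + w)" .
    have "\<bar>Y' t\<bar> = \<bar>c\<bar> * \<beta> * \<bar>cos (\<beta> * snd (\<gamma> t)) * sin (\<alpha> * fst (\<gamma> t)) - cos (\<beta> * snd (\<delta> t)) * sin (\<alpha> * fst (\<delta> t))\<bar>"
      using pos by (simp add: Y'_def abs_mult)
    also have "\<dots> \<le> \<bar>c\<bar> * \<beta> * (w + u)"
      using cos_sin_lipschitz[of "\<beta> * snd (\<gamma> t)" "\<alpha> * fst (\<gamma> t)" "\<beta> * snd (\<delta> t)" "\<alpha> * fst (\<delta> t)"] pos
      unfolding ux wy by (intro mult_left_mono) auto
    finally have Y': "\<bar>Y' t\<bar> \<le> \<bar>c\<bar> * \<beta> * (u + w)" by (simp add: add.commute)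
    have "\<bar>2 * X t * X' t + 2 * Y t * Y' t\<bar> \<le> 2 * \<bar>X t\<bar> * \<bar>X' t\<bar> + 2 * \<bar>Y t\<bar> * \<bar>Y' t\<bar>"
      by (rule order_trans[OF abs_triangle_ineq]) (simp add: abs_mult)
    also have "\<dots> \<le> 2 * \<bar>X t\<bar> * (\<bar>c\<bar> * \<alpha> * (u + w)) + 2 * \<bar>Y t\<bar> * (\<bar>c\<bar> * \<beta> * (u + w))"
      by (intro add_mono mult_left_mono X' Y') auto
    also have "\<dots> = 2 * \<bar>c\<bar> * (u + w)\<^sup>2" by (simp add: u_def w_def power2_eq_square algebra_simps)
    also have "\<dots> \<le> 2 * \<bar>c\<bar> * (2 * (u\<^sup>2 + w\<^sup>2))"
      using sum_squares_bound[of u w] by (intro mult_left_mono) (auto simp: power2_sum)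
    also have "\<dots> = 4 * \<bar>c\<bar> * (\<alpha>\<^sup>2 * (X t)\<^sup>2 + \<beta>\<^sup>2 * (Y t)\<^sup>2)" by (simp add: u_def w_def power_mult_distrib)
    also have "\<dots> \<le> 4 * \<bar>c\<bar> * ((\<alpha>\<^sup>2 + \<beta>\<^sup>2) * (X t)\<^sup>2 + (\<alpha>\<^sup>2 + \<beta>\<^sup>2) * (Y t)\<^sup>2)"
      by (intro mult_left_mono add_mono mult_right_mono) auto
    also have "\<dots> = M * D t" by (simp add: M_def D_def algebra_simps)
    finally show ?thesis .
  qed
  have D0: "D t \<ge> 0" for t by (simp add: D_def)
  have Dc: "continuous_on {lo..hi} D" using dD by (rule DERIV_continuous_on)
  have dD': "(D has_real_derivative 2 * X t * X' t + 2 * Y t * Y' t) (at t)" if "lo < t" "t < hi" for t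
    using dD[of t] that by (simp add: at_within_Icc_at)
  have "(\<lambda>t. D t * exp (- M * t)) hi \<le> (\<lambda>t. D t * exp (- M * t)) lo"
  proof (rule DERIV_nonpos_imp_decreasing_open[OF lh])
    fix t assume t: "lo < t" "t < hi"
    have "((\<lambda>t. D t * exp (- M * t)) has_real_derivative
        ((2 * X t * X' t + 2 * Y t * Y' t) - M * D t) * exp (- M * t)) (at t)"
      by (auto intro!: derivative_eq_intros dD'[OF t] simp: algebra_simps)
    moreover have "((2 * X t * X' t + 2 * Y t * Y' t) - M * D t) * exp (- M * t) \<le> 0"
      using bd[of t] by (intro mult_nonpos_nonneg) auto
    ultimately show "\<exists>y. ((\<lambda>t. D t * exp (- M * t)) has_real_derivative y) (at t) \<and> y \<le> 0" by blast
  qed (intro continuous_intros Dc)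
  then have fw: "D lo = 0 \<Longrightarrow> D hi = 0" using D0[of hi] by (simp add: mult_le_0_iff)
  have "(\<lambda>t. D t * exp (M * t)) lo \<le> (\<lambda>t. D t * exp (M * t)) hi"
  proof (rule DERIV_nonneg_imp_increasing_open[OF lh])
    fix t assume t: "lo < t" "t < hi"
    have "((\<lambda>t. D t * exp (M * t)) has_real_derivative
        ((2 * X t * X' t + 2 * Y t * Y' t) + M * D t) * exp (M * t)) (at t)"
      by (auto intro!: derivative_eq_intros dD'[OF t] simp: algebra_simps)
    moreover have "((2 * X t * X' t + 2 * Y t * Y' t) + M * D t) * exp (M * t) \<ge> 0"
      using bd[of t] by (intro mult_nonneg_nonneg) auto
    ultimately show "\<exists>y. ((\<lambda>t. D t * exp (M * t)) has_real_derivative y) (at t) \<and> 0 \<le> y" by blast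
  qed (intro continuous_intros Dc)
  then have bw: "D hi = 0 \<Longrightarrow> D lo = 0" using D0[of lo] by (simp add: mult_le_0_iff)
  have "D t = 0 \<longleftrightarrow> \<gamma> t = \<delta> t" for t
    by (auto simp: D_def X_def Y_def sum_power2_eq_zero_iff prod_eq_iff)
  then show ?thesis using fw bw by blast
qed

text \<open>Used with crossed exponents, \<open>\<beta>\<^sup>2\<close> for \<alpha> and
  \<open>\<alpha>\<^sup>2\<close> for \<beta>: both functions then have the same logarithmic
  derivative along a trajectory. Both equal 1 at a saddle and 0 at an extremum.\<close>

definition barrier :: "real \<Rightarrow> real \<Rightarrow> real \<Rightarrow> real" where
  "barrier \<alpha> \<kappa> x = \<bar>cos (\<alpha> * x)\<bar> powr \<kappa>"

lemma barrier_continuous: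
  fixes f :: "real \<times> real \<Rightarrow> real"
  shows "\<kappa> > 0 \<Longrightarrow> continuous_on S f \<Longrightarrow> continuous_on S (\<lambda>z. barrier \<alpha> \<kappa> (f z))"
  unfolding barrier_def by (intro continuous_on_powr') (auto intro!: continuous_intros)

lemma barrier_range: "\<kappa> > 0 \<Longrightarrow> 0 \<le> barrier \<alpha> \<kappa> x \<and> barrier \<alpha> \<kappa> x \<le> 1"
  by (simp add: barrier_def powr_le1)

lemma barrier_eq_0_iff: "barrier \<alpha> \<kappa> x = 0 \<longleftrightarrow> cos (\<alpha> * x) = 0"
  by (simp add: barrier_def)

lemma barrier_eq_1_iff:
  assumes "\<kappa> > 0" 
  shows "barrier \<alpha> \<kappa> x = 1 \<longleftrightarrow> sin (\<alpha> * x) = 0"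
proof -
  have "barrier \<alpha> \<kappa> x = 1 \<longleftrightarrow> \<bar>cos (\<alpha> * x)\<bar> = 1"
  proof (cases "\<bar>cos (\<alpha> * x)\<bar> = 1")
    case False
    then have "\<bar>cos (\<alpha> * x)\<bar> < 1" using abs_cos_le_one[of "\<alpha> * x"] by linarith
    then show ?thesis using powr_less_mono2[of \<kappa> "\<bar>cos (\<alpha> * x)\<bar>" 1] assms False by (simp add: barrier_def)
  qed (simp add: barrier_def)
  also have "\<dots> \<longleftrightarrow> (cos (\<alpha> * x))\<^sup>2 = 1" by (simp add: abs_square_eq_1)
  also have "\<dots> \<longleftrightarrow> sin (\<alpha> * x) = 0" by (simp add: cos_squared_eq)
  finally show ?thesis .
qed

text \<open>Along a trajectory both \<open>cos (\<alpha> x)\<close> and \<open>cos (\<beta> y)\<close> solve scalar linear equations, with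
  coefficients \<open>\<alpha>\<^sup>2 u\<close> and \<open>\<beta>\<^sup>2 u\<close>.\<close>

lemma wave_flow_invariant:
  assumes lh: "lo \<le> hi" and f: "wave_flow_on c \<alpha> \<beta> {lo..hi} \<gamma>"
  shows "barrier \<alpha> (\<beta>\<^sup>2) (fst (\<gamma> hi)) * barrier \<beta> (\<alpha>\<^sup>2) (snd (\<gamma> lo)) =
    barrier \<beta> (\<alpha>\<^sup>2) (snd (\<gamma> hi)) * barrier \<alpha> (\<beta>\<^sup>2) (fst (\<gamma> lo))"
proof -
  define x where "x t = fst (\<gamma> t)" for t
  define y where "y t = snd (\<gamma> t)" for t
  define w where "w t = c * (sin (\<alpha> * x t) * sin (\<beta> * y t))" for t
  have d: "(x has_real_derivative - c * \<alpha> * (cos (\<alpha> * x t) * sin (\<beta> * y t))) (at t within {lo..hi})"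
    "(y has_real_derivative - c * \<beta> * (sin (\<alpha> * x t) * cos (\<beta> * y t))) (at t within {lo..hi})"
    if "t \<in> {lo..hi}" for t
    using f that unfolding wave_flow_on_iff x_def y_def by blast+
  have "continuous_on {lo..hi} x" "continuous_on {lo..hi} y"
    using DERIV_continuous_on[OF d(1)] DERIV_continuous_on[OF d(2)] by auto
  then have wc: "continuous_on {lo..hi} w" unfolding w_def by (intro continuous_intros)
  \<comment> \<open>The integral of u along the trajectory; its multiples by
    \<open>\<alpha>\<^sup>2\<close> and \<open>\<beta>\<^sup>2\<close> are the integrating factors
    of the two linear equations.\<close>
  define U where "U t = integral {lo..t} w" for t
  have dU: "(U has_real_derivative w t) (at t within {lo..hi})" if "t \<in> {lo..hi}" for t
    unfolding U_def by (rule integral_has_real_derivative[OF wc that])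
  have dx: "((\<lambda>t. cos (\<alpha> * x t) * exp (- \<alpha>\<^sup>2 * U t)) has_real_derivative 0) (at t within {lo..hi})"
    and dy: "((\<lambda>t. cos (\<beta> * y t) * exp (- \<beta>\<^sup>2 * U t)) has_real_derivative 0) (at t within {lo..hi})"
    if "t \<in> {lo..hi}" for t
    by (auto intro!: derivative_eq_intros d[OF that] dU[OF that] simp: w_def power2_eq_square algebra_simps)
  have mem: "lo \<in> {lo..hi}" "hi \<in> {lo..hi}" using lh by auto
  have U0: "U lo = 0" by (simp add: U_def)
  have "cos (\<alpha> * x hi) * exp (- \<alpha>\<^sup>2 * U hi) = cos (\<alpha> * x lo) * exp (- \<alpha>\<^sup>2 * U lo)"
    using has_field_derivative_zero_constant[OF convex_real_interval(5) dx] mem by metis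
  then have cx: "cos (\<alpha> * x hi) = cos (\<alpha> * x lo) * exp (\<alpha>\<^sup>2 * U hi)"
    by (simp add: U0 exp_minus field_simps)
  have "cos (\<beta> * y hi) * exp (- \<beta>\<^sup>2 * U hi) = cos (\<beta> * y lo) * exp (- \<beta>\<^sup>2 * U lo)"
    using has_field_derivative_zero_constant[OF convex_real_interval(5) dy] mem by metis
  then have cy: "cos (\<beta> * y hi) = cos (\<beta> * y lo) * exp (\<beta>\<^sup>2 * U hi)"
    by (simp add: U0 exp_minus field_simps)
  have "barrier \<alpha> (\<beta>\<^sup>2) (x hi) = barrier \<alpha> (\<beta>\<^sup>2) (x lo) * exp (\<alpha>\<^sup>2 * \<beta>\<^sup>2 * U hi)"
    unfolding barrier_def cx by (simp add: abs_mult powr_mult exp_powr_real mult_ac)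
  moreover have "barrier \<beta> (\<alpha>\<^sup>2) (y hi) = barrier \<beta> (\<alpha>\<^sup>2) (y lo) * exp (\<alpha>\<^sup>2 * \<beta>\<^sup>2 * U hi)"
    unfolding barrier_def cy by (simp add: abs_mult powr_mult exp_powr_real mult_ac)
  ultimately show ?thesis by (simp add: x_def y_def)
qed

section \<open>The flow in terms of explicit solutions\<close>

lemma trajectory_wave_iff:
  "trajectory \<Omega> (wave c \<alpha> \<beta>) z I \<gamma> \<longleftrightarrow>
     is_interval I \<and> 0 \<in> I \<and> \<gamma> 0 = z \<and> (\<forall>t\<in>I. \<gamma> t \<in> closure \<Omega>) \<and> wave_flow_on c \<alpha> \<beta> I \<gamma>"
  by (auto simp: trajectory_def wave_flow_on_def)

lemma interval_min_max_subset: "is_interval I \<Longrightarrow> 0 \<in> I \<Longrightarrow> t \<in> I \<Longrightarrow> {min 0 t..max 0 t} \<subseteq> I" for t :: real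
  by (cases "0 \<le> t") (auto intro: mem_is_interval_1_I[of I 0 t] mem_is_interval_1_I[of I t 0])

text \<open>Uniqueness between 0 and t, in either direction of time, makes the definite description
  in \<open>flow\<close> meaningful, so that any explicit trajectory computes it.\<close>

lemma flow_eqI:
  assumes tr: "trajectory \<Omega> (wave c \<alpha> \<beta>) z I \<gamma>" "t \<in> I" and pos: "\<alpha> > 0" "\<beta> > 0"
  shows "flow \<Omega> (wave c \<alpha> \<beta>) z t = \<gamma> t" "t \<in> flow_interval \<Omega> (wave c \<alpha> \<beta>) z"
proof -
  show "t \<in> flow_interval \<Omega> (wave c \<alpha> \<beta>) z" using tr by (auto simp: flow_interval_def)
  show "flow \<Omega> (wave c \<alpha> \<beta>) z t = \<gamma> t"
    unfolding flow_def
  proof (rule the_equality)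
    show "\<exists>I' \<gamma>'. trajectory \<Omega> (wave c \<alpha> \<beta>) z I' \<gamma>' \<and> t \<in> I' \<and> \<gamma>' t = \<gamma> t" using tr by blast
    fix w assume "\<exists>J \<delta>. trajectory \<Omega> (wave c \<alpha> \<beta>) z J \<delta> \<and> t \<in> J \<and> \<delta> t = w"
    then obtain J \<delta> where J: "trajectory \<Omega> (wave c \<alpha> \<beta>) z J \<delta>" "t \<in> J" "\<delta> t = w" by blast
    have "wave_flow_on c \<alpha> \<beta> {min 0 t..max 0 t} \<gamma>" "wave_flow_on c \<alpha> \<beta> {min 0 t..max 0 t} \<delta>"
      using tr J interval_min_max_subset wave_flow_on_subset unfolding trajectory_wave_iff by metis+
    then have "\<gamma> (min 0 t) = \<delta> (min 0 t) \<longleftrightarrow> \<gamma> (max 0 t) = \<delta> (max 0 t)"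
      by (intro wave_flow_unique[of _ _ c \<alpha> \<beta>]) (use pos in auto)
    moreover have "\<gamma> 0 = \<delta> 0" using tr J by (simp add: trajectory_def)
    ultimately show "w = \<gamma> t" using J(3) by (cases "t \<ge> 0") (auto simp: min_def max_def)
  qed
qed

lemma flow_invariant:
  assumes t: "t \<in> flow_interval \<Omega> (wave c \<alpha> \<beta>) z" and pos: "\<alpha> > 0" "\<beta> > 0"
  shows "barrier \<alpha> (\<beta>\<^sup>2) (fst (flow \<Omega> (wave c \<alpha> \<beta>) z t)) * barrier \<beta> (\<alpha>\<^sup>2) (snd z) =
    barrier \<beta> (\<alpha>\<^sup>2) (snd (flow \<Omega> (wave c \<alpha> \<beta>) z t)) * barrier \<alpha> (\<beta>\<^sup>2) (fst z)"
proof -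
  obtain I \<gamma> where I: "trajectory \<Omega> (wave c \<alpha> \<beta>) z I \<gamma>" "t \<in> I" using t by (auto simp: flow_interval_def)
  have "wave_flow_on c \<alpha> \<beta> {min 0 t..max 0 t} \<gamma>"
    using I interval_min_max_subset wave_flow_on_subset unfolding trajectory_wave_iff by metis
  from wave_flow_invariant[OF _ this]
  have "barrier \<alpha> (\<beta>\<^sup>2) (fst (\<gamma> t)) * barrier \<beta> (\<alpha>\<^sup>2) (snd (\<gamma> 0)) =
    barrier \<beta> (\<alpha>\<^sup>2) (snd (\<gamma> t)) * barrier \<alpha> (\<beta>\<^sup>2) (fst (\<gamma> 0))"
    by (cases "t \<ge> 0") (auto simp: min_def max_def mult.commute)
  moreover have "\<gamma> 0 = z" using I by (simp add: trajectory_def)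
  ultimately show ?thesis using flow_eqI(1)[OF I pos] by simp
qed

text \<open>The conservation law in its cross-multiplied form passes to the limit, where both
  barriers are 1; what remains is equality at the starting point. The product form avoids division
  by barriers that may vanish.\<close>

lemma barrier_eq_of_limit:
  assumes pos: "\<alpha> > 0" "\<beta> > 0" and F: "F \<noteq> bot"
    and ev: "\<forall>\<^sub>F t in F. t \<in> flow_interval \<Omega> (wave c \<alpha> \<beta>) z"
    and lim: "(flow \<Omega> (wave c \<alpha> \<beta>) z \<longlongrightarrow> r) F"
    and r: "sin (\<alpha> * fst r) = 0" "sin (\<beta> * snd r) = 0"
  shows "barrier \<alpha> (\<beta>\<^sup>2) (fst z) = barrier \<beta> (\<alpha>\<^sup>2) (snd z)"
proof -
  let ?f = "flow \<Omega> (wave c \<alpha> \<beta>) z"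
  have "continuous_on UNIV (\<lambda>w::real \<times> real. barrier \<alpha> (\<beta>\<^sup>2) (fst w))" "continuous_on UNIV (\<lambda>w::real \<times> real. barrier \<beta> (\<alpha>\<^sup>2) (snd w))"
    using pos by (auto intro!: barrier_continuous continuous_intros)
  then have c1: "isCont (\<lambda>w. barrier \<alpha> (\<beta>\<^sup>2) (fst w)) r" "isCont (\<lambda>w. barrier \<beta> (\<alpha>\<^sup>2) (snd w)) r"
    by (auto intro: continuous_on_interior)
  have l: "((\<lambda>t. barrier \<alpha> (\<beta>\<^sup>2) (fst (?f t))) \<longlongrightarrow> barrier \<alpha> (\<beta>\<^sup>2) (fst r)) F"
    "((\<lambda>t. barrier \<beta> (\<alpha>\<^sup>2) (snd (?f t))) \<longlongrightarrow> barrier \<beta> (\<alpha>\<^sup>2) (snd r)) F"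
    by (rule isCont_tendsto_compose[OF c1(1) lim], rule isCont_tendsto_compose[OF c1(2) lim])
  have one: "barrier \<alpha> (\<beta>\<^sup>2) (fst r) = 1" "barrier \<beta> (\<alpha>\<^sup>2) (snd r) = 1"
    using barrier_eq_1_iff r pos by auto
  have "((\<lambda>t. barrier \<alpha> (\<beta>\<^sup>2) (fst (?f t)) * barrier \<beta> (\<alpha>\<^sup>2) (snd z)) \<longlongrightarrow> 1 * barrier \<beta> (\<alpha>\<^sup>2) (snd z)) F"
    using tendsto_mult_right[OF l(1)] unfolding one by blast
  moreover have "((\<lambda>t. barrier \<alpha> (\<beta>\<^sup>2) (fst (?f t)) * barrier \<beta> (\<alpha>\<^sup>2) (snd z)) \<longlongrightarrow> 1 * barrier \<alpha> (\<beta>\<^sup>2) (fst z)) F"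
  proof (rule Lim_transform_eventually)
    show "((\<lambda>t. barrier \<beta> (\<alpha>\<^sup>2) (snd (?f t)) * barrier \<alpha> (\<beta>\<^sup>2) (fst z)) \<longlongrightarrow> 1 * barrier \<alpha> (\<beta>\<^sup>2) (fst z)) F"
      using tendsto_mult_right[OF l(2)] unfolding one by blast
    show "\<forall>\<^sub>F t in F. barrier \<beta> (\<alpha>\<^sup>2) (snd (?f t)) * barrier \<alpha> (\<beta>\<^sup>2) (fst z) =
        barrier \<alpha> (\<beta>\<^sup>2) (fst (?f t)) * barrier \<beta> (\<alpha>\<^sup>2) (snd z)"
      using ev by eventually_elim (rule flow_invariant[OF _ pos, symmetric])
  qed
  ultimately have "1 * barrier \<beta> (\<alpha>\<^sup>2) (snd z) = 1 * barrier \<alpha> (\<beta>\<^sup>2) (fst z)"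
    by (rule tendsto_unique[OF F])
  then show ?thesis by simp
qed

lemma filterlim_mult_const:
  fixes \<omega> :: real
  shows "\<omega> > 0 \<Longrightarrow> filterlim (\<lambda>t. \<omega> * t) at_top at_top" "\<omega> > 0 \<Longrightarrow> filterlim (\<lambda>t. \<omega> * t) at_bot at_bot"
    "\<omega> < 0 \<Longrightarrow> filterlim (\<lambda>t. \<omega> * t) at_bot at_top" "\<omega> < 0 \<Longrightarrow> filterlim (\<lambda>t. \<omega> * t) at_top at_bot"
proof -
  have p: "filterlim (\<lambda>t. w * t) at_top at_top" if "w > 0" for w :: real
    by (rule filterlim_tendsto_pos_mult_at_top[OF tendsto_const that filterlim_ident])
  have n: "filterlim (\<lambda>t. w * t) at_bot at_top" if "w < 0" for w :: real
    using p[of "- w"] that by (simp add: filterlim_uminus_at_bot)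
  show "\<omega> > 0 \<Longrightarrow> filterlim (\<lambda>t. \<omega> * t) at_top at_top" by (rule p)
  show "\<omega> < 0 \<Longrightarrow> filterlim (\<lambda>t. \<omega> * t) at_bot at_top" by (rule n)
  show "\<omega> > 0 \<Longrightarrow> filterlim (\<lambda>t. \<omega> * t) at_bot at_bot"
    unfolding filterlim_at_bot_mirror using n[of "- \<omega>"] by simp
  show "\<omega> < 0 \<Longrightarrow> filterlim (\<lambda>t. \<omega> * t) at_top at_bot"
    unfolding filterlim_at_bot_mirror using p[of "- \<omega>"] by simp
qed

lemma cos_sin_npi_shift:
  fixes s \<sigma> :: real
  assumes "\<sigma> = 1 \<or> \<sigma> = -1"
  shows "cos (real i * pi + \<sigma> * s) = (-1) ^ i * cos s" "sin (real i * pi + \<sigma> * s) = (-1) ^ i * \<sigma> * sin s"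
  using assms by (auto simp: cos_add sin_add cos_diff sin_diff cos_npi sin_npi)

lemma cos_sin_npi_shift':
  fixes s :: real
  shows "cos (real i * pi + s) = (-1) ^ i * cos s" "sin (real i * pi + s) = (-1) ^ i * sin s"
  using cos_sin_npi_shift[of 1 i s] by simp_all

text \<open>Each cell is a translated and possibly reflected copy of the model. The parities of i
  and j, the reflection \<sigma> and the amplitude c all enter the time factor \<omega>, whose sign
  decides the direction of time.\<close>

lemma wave_flow_of_saddle_system:
  assumes sys: "saddle_system (\<alpha>\<^sup>2) (\<beta>\<^sup>2) X Y" and pos: "\<alpha> > 0" "\<beta> > 0" and \<sigma>: "\<sigma> = 1 \<or> \<sigma> = -1"
    and \<omega>: "\<omega> = - \<sigma> * (-1) ^ i * (-1) ^ j * c"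
  shows "wave_flow_on c \<alpha> \<beta> UNIV (\<lambda>t. ((real i * pi + \<sigma> * X (\<omega> * t)) / \<alpha>, (real j * pi + Y (\<omega> * t)) / \<beta>))"
  unfolding wave_flow_on_iff
proof (intro ballI conjI)
  fix t :: real
  have X: "((\<lambda>t. X (\<omega> * t)) has_real_derivative \<alpha>\<^sup>2 * (cos (X (\<omega> * t)) * sin (Y (\<omega> * t))) * \<omega>) (at t)"
    and Y: "((\<lambda>t. Y (\<omega> * t)) has_real_derivative \<beta>\<^sup>2 * (sin (X (\<omega> * t)) * cos (Y (\<omega> * t))) * \<omega>) (at t)"
    using sys unfolding saddle_system_def
    by (auto intro!: DERIV_chain2[where g="\<lambda>t. \<omega> * t"] derivative_eq_intros)
  have \<sigma>\<sigma>: "\<sigma> * \<sigma> = 1" using \<sigma> by auto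
  have arg: "\<alpha> * ((real i * pi + \<sigma> * x) / \<alpha>) = real i * pi + \<sigma> * x" "\<beta> * ((real j * pi + y) / \<beta>) = real j * pi + y" for x y
    using pos by simp_all
  have "((\<lambda>t. (real i * pi + \<sigma> * X (\<omega> * t)) / \<alpha>) has_real_derivative
      (\<sigma> * (\<alpha>\<^sup>2 * (cos (X (\<omega> * t)) * sin (Y (\<omega> * t))) * \<omega>)) / \<alpha>) (at t)"
    using pos by (auto intro!: derivative_eq_intros X)
  moreover have "(\<sigma> * (\<alpha>\<^sup>2 * (cos (X (\<omega> * t)) * sin (Y (\<omega> * t))) * \<omega>)) / \<alpha> =
      - c * \<alpha> * (((-1) ^ i * cos (X (\<omega> * t))) * ((-1) ^ j * sin (Y (\<omega> * t))))"
  proof -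
    have "\<sigma> * \<omega> = - (\<sigma> * \<sigma>) * (-1) ^ i * (-1) ^ j * c" unfolding \<omega> by (simp add: mult_ac)
    then have "\<sigma> * \<omega> = - ((-1) ^ i * (-1) ^ j * c)" unfolding \<sigma>\<sigma> by simp
    moreover have "(\<sigma> * (\<alpha>\<^sup>2 * (cos (X (\<omega> * t)) * sin (Y (\<omega> * t))) * \<omega>)) / \<alpha> =
        (\<sigma> * \<omega>) * (\<alpha> * (cos (X (\<omega> * t)) * sin (Y (\<omega> * t))))"
      using pos by (simp add: power2_eq_square)
    ultimately show ?thesis by simp
  qed
  ultimately show "((\<lambda>t. fst ((real i * pi + \<sigma> * X (\<omega> * t)) / \<alpha>, (real j * pi + Y (\<omega> * t)) / \<beta>)) has_real_derivative
      - c * \<alpha> * (cos (\<alpha> * fst ((real i * pi + \<sigma> * X (\<omega> * t)) / \<alpha>, (real j * pi + Y (\<omega> * t)) / \<beta>)) *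
        sin (\<beta> * snd ((real i * pi + \<sigma> * X (\<omega> * t)) / \<alpha>, (real j * pi + Y (\<omega> * t)) / \<beta>)))) (at t within UNIV)"
    unfolding fst_conv snd_conv arg unfolding cos_sin_npi_shift[OF \<sigma>] unfolding cos_sin_npi_shift' by simp
  have "((\<lambda>t. (real j * pi + Y (\<omega> * t)) / \<beta>) has_real_derivative
      (\<beta>\<^sup>2 * (sin (X (\<omega> * t)) * cos (Y (\<omega> * t))) * \<omega>) / \<beta>) (at t)"
    using pos by (auto intro!: derivative_eq_intros Y)
  moreover have "(\<beta>\<^sup>2 * (sin (X (\<omega> * t)) * cos (Y (\<omega> * t))) * \<omega>) / \<beta> =
      - c * \<beta> * (((-1) ^ i * \<sigma> * sin (X (\<omega> * t))) * ((-1) ^ j * cos (Y (\<omega> * t))))"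
    unfolding \<omega> using pos by (simp add: power2_eq_square field_simps)
  ultimately show "((\<lambda>t. snd ((real i * pi + \<sigma> * X (\<omega> * t)) / \<alpha>, (real j * pi + Y (\<omega> * t)) / \<beta>)) has_real_derivative
      - c * \<beta> * (sin (\<alpha> * fst ((real i * pi + \<sigma> * X (\<omega> * t)) / \<alpha>, (real j * pi + Y (\<omega> * t)) / \<beta>)) *
        cos (\<beta> * snd ((real i * pi + \<sigma> * X (\<omega> * t)) / \<alpha>, (real j * pi + Y (\<omega> * t)) / \<beta>)))) (at t within UNIV)"
    unfolding fst_conv snd_conv arg unfolding cos_sin_npi_shift[OF \<sigma>] unfolding cos_sin_npi_shift' by simp
qed

section \<open>Explicit orbits through a given point\<close>

lemma abs_minus_one_power_mult: "\<bar>(-1) ^ i * x\<bar> = \<bar>x\<bar>" for x :: real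
  by (simp add: abs_mult power_abs)

text \<open>Which end is the maximum is left open, since this depends on parities and on the sign of
  c; monotonicity of the wave along the flow will decide it.\<close>

definition joins_extrema :: "real \<Rightarrow> real \<Rightarrow> real \<Rightarrow> (real \<Rightarrow> real \<times> real) \<Rightarrow> bool" where
  "joins_extrema c \<alpha> \<beta> \<gamma> \<longleftrightarrow> wave_flow_on c \<alpha> \<beta> UNIV \<gamma> \<and>
     (\<exists>p q. (\<gamma> \<longlongrightarrow> q) at_top \<and> (\<gamma> \<longlongrightarrow> p) at_bot \<and>
        wave c \<alpha> \<beta> q = - wave c \<alpha> \<beta> p \<and> \<bar>wave c \<alpha> \<beta> p\<bar> = \<bar>c\<bar>)"

lemma joins_extrema_horizontal:
  assumes pos: "\<alpha> > 0" "\<beta> > 0" and c: "c \<noteq> 0"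
    and x: "real i * pi - pi / 2 < \<alpha> * x" "\<alpha> * x < real i * pi + pi / 2"
    and y: "real j * pi < \<beta> * y" "\<beta> * y < real j * pi + pi"
    and less: "barrier \<beta> (\<alpha>\<^sup>2) y < barrier \<alpha> (\<beta>\<^sup>2) x"
  obtains \<gamma> where "\<gamma> 0 = (x, y)" "joins_extrema c \<alpha> \<beta> \<gamma>"
proof -
  define \<xi> where "\<xi> = \<alpha> * x - real i * pi"
  define \<eta> where "\<eta> = \<beta> * y - real j * pi"
  have cx: "\<alpha> * x = real i * pi + \<xi>" and cy: "\<beta> * y = real j * pi + \<eta>" by (simp_all add: \<xi>_def \<eta>_def)
  have "\<bar>cos \<eta>\<bar> powr \<alpha>\<^sup>2 < \<bar>cos \<xi>\<bar> powr \<beta>\<^sup>2"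
    using less unfolding barrier_def cx cy cos_sin_npi_shift' abs_minus_one_power_mult .
  then obtain X Y where XY: "X 0 = \<xi>" "Y 0 = \<eta>" "saddle_system (\<alpha>\<^sup>2) (\<beta>\<^sup>2) X Y"
    "(X \<longlongrightarrow> pi / 2) at_top" "(X \<longlongrightarrow> - pi / 2) at_bot"
    "(Y \<longlongrightarrow> pi / 2) at_top" "(Y \<longlongrightarrow> pi / 2) at_bot"
    using saddle_system_max_to_min[of "\<alpha>\<^sup>2" "\<beta>\<^sup>2" \<xi> \<eta>] x y pos by (auto simp: \<xi>_def \<eta>_def)
  \<comment> \<open>The case \<sigma> = 1 of the time factor: horizontal orbits need no
    reflection.\<close>
  define \<omega> where "\<omega> = - 1 * (-1) ^ i * (-1) ^ j * c"
  have \<omega>: "\<omega> \<noteq> 0" using c by (simp add: \<omega>_def)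
  define \<gamma> where "\<gamma> t = ((real i * pi + 1 * X (\<omega> * t)) / \<alpha>, (real j * pi + Y (\<omega> * t)) / \<beta>)" for t
  \<comment> \<open>The midline of the row; the arguments pi / 2 and - pi / 2 give the two extrema
    at the ends of the cell.\<close>
  define P where "P s = ((real i * pi + 1 * s) / \<alpha>, (real j * pi + pi / 2) / \<beta>)" for s
  have wP: "wave c \<alpha> \<beta> (P s) = c * ((-1) ^ i * sin s * (-1) ^ j)" for s
    using pos by (simp add: P_def wave_def cos_sin_npi_shift')
  have lim: "(\<gamma> \<longlongrightarrow> P s) F" if "((\<lambda>t. X (\<omega> * t)) \<longlongrightarrow> s) F" "((\<lambda>t. Y (\<omega> * t)) \<longlongrightarrow> pi / 2) F" for F s
    unfolding \<gamma>_def P_def using pos by (intro tendsto_intros that) auto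
  have pq: "wave c \<alpha> \<beta> (P (pi / 2)) = - wave c \<alpha> \<beta> (P (- pi / 2))" "\<bar>wave c \<alpha> \<beta> (P (- pi / 2))\<bar> = \<bar>c\<bar>"
    "\<bar>wave c \<alpha> \<beta> (P (pi / 2))\<bar> = \<bar>c\<bar>"
    unfolding wP by (simp_all add: abs_mult power_abs)
  show thesis
  proof (rule that[of \<gamma>])
    show "\<gamma> 0 = (x, y)" using pos XY by (simp add: \<gamma>_def \<xi>_def \<eta>_def)
    have "wave_flow_on c \<alpha> \<beta> UNIV \<gamma>"
      unfolding \<gamma>_def by (rule wave_flow_of_saddle_system[OF XY(3) pos _ \<omega>_def]) simp
    moreover have "\<exists>p q. (\<gamma> \<longlongrightarrow> q) at_top \<and> (\<gamma> \<longlongrightarrow> p) at_bot \<and>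
        wave c \<alpha> \<beta> q = - wave c \<alpha> \<beta> p \<and> \<bar>wave c \<alpha> \<beta> p\<bar> = \<bar>c\<bar>"
    proof (cases "\<omega> > 0")
      case True
      have "(\<gamma> \<longlongrightarrow> P (pi / 2)) at_top" "(\<gamma> \<longlongrightarrow> P (- pi / 2)) at_bot"
        using XY(4-7) filterlim_mult_const(1,2)[OF True] by (auto intro!: lim intro: filterlim_compose)
      then show ?thesis using pq by blast
    next
      case False
      then have "\<omega> < 0" using \<omega> by simp
      have "(\<gamma> \<longlongrightarrow> P (- pi / 2)) at_top" "(\<gamma> \<longlongrightarrow> P (pi / 2)) at_bot"
        using XY(4-7) filterlim_mult_const(3,4)[OF \<open>\<omega> < 0\<close>] by (auto intro!: lim intro: filterlim_compose)
      moreover have "wave c \<alpha> \<beta> (P (- pi / 2)) = - wave c \<alpha> \<beta> (P (pi / 2))" using pq(1) by simp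
      ultimately show ?thesis using pq(3) by blast
    qed
    ultimately show "joins_extrema c \<alpha> \<beta> \<gamma>" by (simp add: joins_extrema_def)
  qed
qed

lemma wave_swap: "wave c \<alpha> \<beta> (prod.swap z) = wave c \<beta> \<alpha> z"
  by (simp add: wave_def mult_ac)

lemma wave_flow_on_swap: "wave_flow_on c \<beta> \<alpha> I \<gamma> \<Longrightarrow> wave_flow_on c \<alpha> \<beta> I (\<lambda>t. prod.swap (\<gamma> t))"
  by (simp add: wave_flow_on_iff mult.commute)

lemma tendsto_swap: "(f \<longlongrightarrow> z) F \<Longrightarrow> ((\<lambda>t. prod.swap (f t)) \<longlongrightarrow> prod.swap z) F"
  unfolding prod.swap_def by (intro tendsto_intros)

lemma joins_extrema_swap:
  assumes "joins_extrema c \<beta> \<alpha> \<gamma>" shows "joins_extrema c \<alpha> \<beta> (\<lambda>t. prod.swap (\<gamma> t))"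
proof -
  obtain p q where pq: "(\<gamma> \<longlongrightarrow> q) at_top" "(\<gamma> \<longlongrightarrow> p) at_bot" "wave c \<beta> \<alpha> q = - wave c \<beta> \<alpha> p" "\<bar>wave c \<beta> \<alpha> p\<bar> = \<bar>c\<bar>"
    and f: "wave_flow_on c \<beta> \<alpha> UNIV \<gamma>"
    using assms unfolding joins_extrema_def by blast
  show ?thesis
    unfolding joins_extrema_def
    using wave_flow_on_swap[OF f] tendsto_swap[OF pq(1)] tendsto_swap[OF pq(2)] pq(3,4)
    by (metis wave_swap)
qed

lemma grid_cell:
  fixes s :: real
  assumes "0 \<le> s" "sin s \<noteq> 0"
  obtains k :: nat where "real k * pi < s" "s < real k * pi + pi"
proof -
  define k where "k = nat \<lfloor>s / pi\<rfloor>"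
  have k: "real k \<le> s / pi" "s / pi < real k + 1" using assms by (auto simp: k_def)
  have "real k * pi \<le> s" "s < real k * pi + pi" using k by (simp_all add: field_simps)
  moreover have "s \<noteq> real k * pi" using assms(2) sin_npi[of k] by auto
  ultimately show thesis by (intro that[of k]) auto
qed

lemma barrier_lt_1_sin: "\<kappa> > 0 \<Longrightarrow> barrier \<alpha> \<kappa> x < 1 \<Longrightarrow> sin (\<alpha> * x) \<noteq> 0"
  using barrier_eq_1_iff[of \<kappa> \<alpha> x] by auto

lemma barrier_pos_cos: "barrier \<alpha> \<kappa> x > 0 \<Longrightarrow> cos (\<alpha> * x) \<noteq> 0"
  by (auto simp: barrier_def)

lemma barrier_less_cell:
  assumes pos: "\<alpha> > 0" "\<beta> > 0" and xy: "0 \<le> x" "0 \<le> y"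
    and less: "barrier \<beta> (\<alpha>\<^sup>2) y < barrier \<alpha> (\<beta>\<^sup>2) x"
  obtains i j :: nat where "real i * pi - pi / 2 < \<alpha> * x" "\<alpha> * x < real i * pi + pi / 2"
    "real j * pi < \<beta> * y" "\<beta> * y < real j * pi + pi"
proof -
  have "barrier \<alpha> (\<beta>\<^sup>2) x > 0" "barrier \<beta> (\<alpha>\<^sup>2) y < 1"
    using less barrier_range[of "\<alpha>\<^sup>2" \<beta> y] barrier_range[of "\<beta>\<^sup>2" \<alpha> x] pos by auto
  \<comment> \<open>The strict inequality excludes cos (\<alpha> x) = 0 and sin (\<beta> y) = 0. The
    shift by pi / 2 makes one grid lemma serve for cells centred at multiples of pi.\<close>
  then have "sin (\<alpha> * x + pi / 2) \<noteq> 0" "sin (\<beta> * y) \<noteq> 0"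
    using barrier_pos_cos barrier_lt_1_sin[of "\<alpha>\<^sup>2"] pos by (auto simp: sin_add)
  moreover have "0 \<le> \<alpha> * x + pi / 2" "0 \<le> \<beta> * y" using pos xy by auto
  ultimately obtain i j :: nat where ij: "real i * pi < \<alpha> * x + pi / 2" "\<alpha> * x + pi / 2 < real i * pi + pi"
    "real j * pi < \<beta> * y" "\<beta> * y < real j * pi + pi" using grid_cell by metis
  show thesis by (rule that[of i j]) (use ij in auto)
qed

lemma ex_joins_extrema_horizontal:
  assumes pos: "\<alpha> > 0" "\<beta> > 0" and c: "c \<noteq> 0" and xy: "0 \<le> x" "0 \<le> y"
    and less: "barrier \<beta> (\<alpha>\<^sup>2) y < barrier \<alpha> (\<beta>\<^sup>2) x"
  obtains \<gamma> where "\<gamma> 0 = (x, y)" "joins_extrema c \<alpha> \<beta> \<gamma>"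
  using barrier_less_cell[OF pos xy less] joins_extrema_horizontal[OF pos c _ _ _ _ less] by metis

text \<open>The two strict inequalities are exchanged by swapping the coordinates together with
  \<alpha> and \<beta>.\<close>

lemma ex_joins_extrema:
  assumes pos: "\<alpha> > 0" "\<beta> > 0" and c: "c \<noteq> 0" and xy: "0 \<le> fst z" "0 \<le> snd z"
    and ne: "barrier \<alpha> (\<beta>\<^sup>2) (fst z) \<noteq> barrier \<beta> (\<alpha>\<^sup>2) (snd z)"
  obtains \<gamma> where "\<gamma> 0 = z" "joins_extrema c \<alpha> \<beta> \<gamma>"
proof (cases "barrier \<beta> (\<alpha>\<^sup>2) (snd z) < barrier \<alpha> (\<beta>\<^sup>2) (fst z)")
  case True
  then show thesis using ex_joins_extrema_horizontal[OF pos c xy True] that by auto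
next
  case False
  then have less: "barrier \<alpha> (\<beta>\<^sup>2) (fst z) < barrier \<beta> (\<alpha>\<^sup>2) (snd z)" using ne by simp
  obtain \<gamma> where "\<gamma> 0 = (snd z, fst z)" "joins_extrema c \<beta> \<alpha> \<gamma>"
    using ex_joins_extrema_horizontal[OF pos(2,1) c xy(2,1) less] by blast
  then show thesis using joins_extrema_swap by (intro that[of "\<lambda>t. prod.swap (\<gamma> t)"]) auto
qed

text \<open>The phase is measured from the vertical grid line nearest to the point, on which the
  limiting saddle lies; a sign decides whether it is reached in the future or in the past.
  Confinement to one nodal cell is part of the conclusion because it will keep the orbit inside the
  rectangle.\<close>

lemma ex_separatrix:
  assumes pos: "\<alpha> > 0" "\<beta> > 0" and c: "c \<noteq> 0" and xy: "0 \<le> x" "0 \<le> y"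
    and eq: "barrier \<beta> (\<alpha>\<^sup>2) y = barrier \<alpha> (\<beta>\<^sup>2) x"
    and ne: "barrier \<alpha> (\<beta>\<^sup>2) x \<noteq> 0" "barrier \<alpha> (\<beta>\<^sup>2) x \<noteq> 1"
  obtains \<gamma> r k j where "\<gamma> 0 = (x, y)" "wave_flow_on c \<alpha> \<beta> UNIV \<gamma>"
    "(\<gamma> \<longlongrightarrow> r) at_top \<or> (\<gamma> \<longlongrightarrow> r) at_bot" "sin (\<alpha> * fst r) = 0" "sin (\<beta> * snd r) = 0"
    "real k * pi < \<alpha> * x" "\<alpha> * x < real k * pi + pi" "real j * pi < \<beta> * y" "\<beta> * y < real j * pi + pi"
    "\<And>t. real k * pi < \<alpha> * fst (\<gamma> t) \<and> \<alpha> * fst (\<gamma> t) < real k * pi + pi"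
    "\<And>t. real j * pi < \<beta> * snd (\<gamma> t) \<and> \<beta> * snd (\<gamma> t) < real j * pi + pi"
proof -
  have "sin (\<alpha> * x) \<noteq> 0" "sin (\<beta> * y) \<noteq> 0" "cos (\<alpha> * x) \<noteq> 0"
    using eq ne barrier_eq_1_iff[of "\<beta>\<^sup>2" \<alpha> x] barrier_eq_1_iff[of "\<alpha>\<^sup>2" \<beta> y] barrier_eq_0_iff[of \<alpha> "\<beta>\<^sup>2" x] pos by auto
  moreover have "0 \<le> \<alpha> * x" "0 \<le> \<beta> * y" using pos xy by auto
  ultimately obtain k j :: nat where kj: "real k * pi < \<alpha> * x" "\<alpha> * x < real k * pi + pi"
    "real j * pi < \<beta> * y" "\<beta> * y < real j * pi + pi" using grid_cell by metis
  have half: "\<alpha> * x \<noteq> real k * pi + pi / 2" using \<open>cos (\<alpha> * x) \<noteq> 0\<close> by (auto simp: cos_sin_npi_shift')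
  \<comment> \<open>In the left half of cell k the origin is its left side, in the right half its
    right side k + 1 with the direction reversed.\<close>
  obtain i \<sigma> \<xi> where i: "\<alpha> * x = real i * pi + \<sigma> * \<xi>" "0 < \<xi>" "\<xi> < pi / 2" "\<sigma> = 1 \<or> \<sigma> = -1"
    "\<And>s. 0 < s \<Longrightarrow> s < pi / 2 \<Longrightarrow> real k * pi < real i * pi + \<sigma> * s \<and> real i * pi + \<sigma> * s < real k * pi + pi"
  proof (cases "\<alpha> * x < real k * pi + pi / 2")
    case True
    show thesis by (rule that[of k 1 "\<alpha> * x - real k * pi"]) (use True kj in auto)
  next
    case False
    show thesis by (rule that[of "Suc k" "-1" "real k * pi + pi - \<alpha> * x"]) (use False half kj in \<open>auto simp: algebra_simps\<close>)
  qed
  define \<eta> where "\<eta> = \<beta> * y - real j * pi"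
  have cy: "\<beta> * y = real j * pi + \<eta>" by (simp add: \<eta>_def)
  have "\<bar>cos \<eta>\<bar> powr \<alpha>\<^sup>2 = \<bar>cos \<xi>\<bar> powr \<beta>\<^sup>2"
    using eq unfolding barrier_def i(1) cy unfolding cos_sin_npi_shift[OF i(4)] unfolding cos_sin_npi_shift' abs_minus_one_power_mult .
  then obtain X Y e where XY: "X 0 = \<xi>" "Y 0 = \<eta>" "saddle_system (\<alpha>\<^sup>2) (\<beta>\<^sup>2) X Y"
    "\<And>t. 0 < X t" "\<And>t. X t < pi / 2" "\<And>t. 0 < Y t" "\<And>t. Y t < pi"
    "(X \<longlongrightarrow> 0) at_bot" "(Y \<longlongrightarrow> e) at_bot" "e = 0 \<or> e = pi"
    using saddle_system_separatrix[of "\<alpha>\<^sup>2" "\<beta>\<^sup>2" \<xi> \<eta>] i(2,3) kj pos by (auto simp: \<eta>_def)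
  define \<omega> where "\<omega> = - \<sigma> * (-1) ^ i * (-1) ^ j * c"
  have \<omega>: "\<omega> \<noteq> 0" using c i(4) by (auto simp: \<omega>_def)
  define \<gamma> where "\<gamma> t = ((real i * pi + \<sigma> * X (\<omega> * t)) / \<alpha>, (real j * pi + Y (\<omega> * t)) / \<beta>)" for t
  define r where "r = ((real i * pi + \<sigma> * 0) / \<alpha>, (real j * pi + e) / \<beta>)"
  have lim: "(\<gamma> \<longlongrightarrow> r) F" if "filterlim (\<lambda>t. \<omega> * t) at_bot F" for F
    unfolding \<gamma>_def r_def using pos
    by (intro tendsto_intros filterlim_compose[OF XY(8) that] filterlim_compose[OF XY(9) that]) auto
  show thesis
  proof (rule that[of \<gamma> r k j])
    show "\<gamma> 0 = (x, y)"
      using pos XY by (simp add: \<gamma>_def i(1)[symmetric] cy[symmetric])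
    show "wave_flow_on c \<alpha> \<beta> UNIV \<gamma>"
      unfolding \<gamma>_def by (rule wave_flow_of_saddle_system[OF XY(3) pos i(4) \<omega>_def])
    show "(\<gamma> \<longlongrightarrow> r) at_top \<or> (\<gamma> \<longlongrightarrow> r) at_bot"
      using lim filterlim_mult_const(2,3) \<omega> by (cases "\<omega> > 0") auto
    show "sin (\<alpha> * fst r) = 0" "sin (\<beta> * snd r) = 0"
      using pos XY(10) by (auto simp: r_def sin_npi cos_sin_npi_shift')
    fix t
    show "real k * pi < \<alpha> * fst (\<gamma> t) \<and> \<alpha> * fst (\<gamma> t) < real k * pi + pi"
      using i(5)[OF XY(4,5)] pos by (simp add: \<gamma>_def)
    show "real j * pi < \<beta> * snd (\<gamma> t) \<and> \<beta> * snd (\<gamma> t) < real j * pi + pi"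
      using XY(6,7) pos by (simp add: \<gamma>_def)
  qed (use kj in auto)
qed

section \<open>Separatrices and the Neumann domains\<close>

lemma first_exit:
  fixes \<delta> :: "real \<Rightarrow> real \<times> real"
  assumes cont: "continuous_on UNIV \<delta>" and \<Omega>: "open \<Omega>" "\<delta> 0 \<in> \<Omega>" and out: "0 \<le> t1" "\<delta> t1 \<notin> \<Omega>"
  obtains s where "0 < s" "\<delta> s \<in> frontier \<Omega>" "\<And>t. 0 \<le> t \<Longrightarrow> t \<le> s \<Longrightarrow> \<delta> t \<in> closure \<Omega>"
proof -
  define S where "S = {0..t1} \<inter> \<delta> -` (- \<Omega>)"
  have "closed S" unfolding S_def
    using \<Omega>(1) by (intro closed_Int closed_vimage cont) auto
  moreover have "bounded S" unfolding S_def by (rule bounded_subset[OF bounded_closed_interval]) auto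
  ultimately have cS: "compact S" by (simp add: compact_eq_bounded_closed)
  have "S \<noteq> {}" using out by (auto simp: S_def)
  from compact_attains_inf[OF cS this] obtain s where s: "s \<in> S" "\<And>t. t \<in> S \<Longrightarrow> s \<le> t" by auto
  have s0: "0 < s" using s(1) \<Omega>(2) by (cases "s = 0") (auto simp: S_def)
  have "\<delta> ` {0..<s} \<subseteq> closure \<Omega>"
  proof
    fix z assume "z \<in> \<delta> ` {0..<s}"
    then obtain t where t: "z = \<delta> t" "0 \<le> t" "t < s" by auto
    then have "t \<notin> S" using s(2)[of t] by auto
    then have "\<delta> t \<in> \<Omega>" using t s(1) by (auto simp: S_def)
    then show "z \<in> closure \<Omega>" using t(1) closure_subset by blast
  qed
  then have "\<delta> ` closure {0..<s} \<subseteq> closure \<Omega>"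
    by (intro image_closure_subset continuous_on_subset[OF cont]) auto
  then have cl: "\<delta> t \<in> closure \<Omega>" if "0 \<le> t" "t \<le> s" for t
    using s0 that by (simp add: closure_atLeastLessThan image_subset_iff)
  show thesis
  proof (rule that[OF s0 _ cl])
    show "\<delta> s \<in> frontier \<Omega>"
      using cl[of s] s0 s(1) \<Omega>(1) by (auto simp: frontier_def interior_open S_def)
  qed
qed

lemma wave_flow_on_continuous: "wave_flow_on c \<alpha> \<beta> UNIV \<gamma> \<Longrightarrow> continuous_on UNIV \<gamma>"
  unfolding wave_flow_on_def
  by (intro continuous_at_imp_continuous_on ballI has_vector_derivative_continuous) auto

text \<open>The orbit is cut at its first exit, so that the piece used as trajectory stays in the
  closure and ends on the frontier. An exit in the past is reduced to one in the future by reversing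
  time.\<close>

lemma exit_in_G_set:
  assumes pos: "\<alpha> > 0" "\<beta> > 0" and f: "wave_flow_on c \<alpha> \<beta> UNIV \<gamma>" and \<Omega>: "open \<Omega>" "\<gamma> 0 \<in> \<Omega>"
    and out: "\<gamma> t1 \<notin> \<Omega>"
  shows "\<gamma> 0 \<in> G_set \<Omega> (wave c \<alpha> \<beta>)"
proof -
  have cont: "continuous_on UNIV \<gamma>" by (rule wave_flow_on_continuous[OF f])
  have *: "\<gamma> 0 \<in> G_set \<Omega> (wave c \<alpha> \<beta>)"
    if I: "is_interval I" "0 \<in> I" "s \<in> I" "\<gamma> s \<in> frontier \<Omega>" "\<forall>t\<in>I. \<gamma> t \<in> closure \<Omega>" for I s
  proof -
    have "trajectory \<Omega> (wave c \<alpha> \<beta>) (\<gamma> 0) I \<gamma>"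
      using I wave_flow_on_subset[OF f subset_UNIV] by (simp add: trajectory_wave_iff)
    from flow_eqI[OF this I(3) pos] show ?thesis
      using I(4) \<Omega>(2) by (auto simp: G_set_def intro!: bexI[of _ s])
  qed
  show ?thesis
  proof (cases "0 \<le> t1")
    case True
    obtain s where s: "0 < s" "\<gamma> s \<in> frontier \<Omega>" "\<And>t. 0 \<le> t \<Longrightarrow> t \<le> s \<Longrightarrow> \<gamma> t \<in> closure \<Omega>"
      using first_exit[OF cont \<Omega> True out] by metis
    show ?thesis by (rule *[of "{0..s}" s]) (use s in auto)
  next
    case False
    have "continuous_on UNIV (\<lambda>t. \<gamma> (- t))"
      by (rule continuous_on_compose2[OF cont]) (auto intro!: continuous_intros)
    then obtain s where s: "0 < s" "\<gamma> (- s) \<in> frontier \<Omega>" "\<And>t. 0 \<le> t \<Longrightarrow> t \<le> s \<Longrightarrow> \<gamma> (- t) \<in> closure \<Omega>"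
      using first_exit[of "\<lambda>t. \<gamma> (- t)" \<Omega> "- t1"] \<Omega> out False by auto
    show ?thesis
    proof (rule *[of "{- s..0}" "- s"])
      show "\<forall>t\<in>{- s..0}. \<gamma> t \<in> closure \<Omega>" using s(3)[of "- t" for t] by force
    qed (use s in auto)
  qed
qed

lemma wave_abs_le: "\<bar>wave c \<alpha> \<beta> z\<bar> \<le> \<bar>c\<bar>"
proof -
  have "\<bar>wave c \<alpha> \<beta> z\<bar> = \<bar>c\<bar> * (\<bar>sin (\<alpha> * fst z)\<bar> * \<bar>sin (\<beta> * snd z)\<bar>)" by (simp add: wave_def abs_mult)
  also have "\<dots> \<le> \<bar>c\<bar> * (1 * 1)" by (intro mult_left_mono mult_mono) auto
  finally show ?thesis by simp
qed

lemma wave_isCont: "isCont (wave c \<alpha> \<beta>) z"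
  unfolding wave_def by (intro continuous_intros)

lemma wave_decreasing:
  assumes f: "wave_flow_on c \<alpha> \<beta> UNIV \<gamma>" and st: "s \<le> t"
  shows "wave c \<alpha> \<beta> (\<gamma> t) \<le> wave c \<alpha> \<beta> (\<gamma> s)"
proof (rule DERIV_nonpos_imp_nonincreasing[OF st])
  fix r :: real
  define x where "x t = fst (\<gamma> t)" for t
  define y where "y t = snd (\<gamma> t)" for t
  let ?dx = "cos (\<alpha> * x r) * sin (\<beta> * y r)" and ?dy = "sin (\<alpha> * x r) * cos (\<beta> * y r)"
  have d: "(x has_real_derivative - c * \<alpha> * ?dx) (at r)" "(y has_real_derivative - c * \<beta> * ?dy) (at r)"
    using f unfolding wave_flow_on_iff x_def y_def by blast+
  have "((\<lambda>t. c * (sin (\<alpha> * x t) * sin (\<beta> * y t))) has_real_derivative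
      - ((c * \<alpha> * ?dx)\<^sup>2 + (c * \<beta> * ?dy)\<^sup>2)) (at r)"
    by (auto intro!: derivative_eq_intros d simp: power2_eq_square algebra_simps)
  then have "((\<lambda>t. wave c \<alpha> \<beta> (\<gamma> t)) has_real_derivative - ((c * \<alpha> * ?dx)\<^sup>2 + (c * \<beta> * ?dy)\<^sup>2)) (at r)"
    by (simp add: wave_def x_def y_def)
  moreover have "- ((c * \<alpha> * ?dx)\<^sup>2 + (c * \<beta> * ?dy)\<^sup>2) \<le> 0" by simp
  ultimately show "\<exists>d. ((\<lambda>t. wave c \<alpha> \<beta> (\<gamma> t)) has_real_derivative d) (at r) \<and> d \<le> 0" by blast
qed

text \<open>An orbit that leaves the region crosses the frontier. One that never leaves has both
  limits in the closure, and these are global extrema of the wave.\<close>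

lemma joins_extrema_G_or_W:
  assumes pos: "\<alpha> > 0" "\<beta> > 0" and \<gamma>: "joins_extrema c \<alpha> \<beta> \<gamma>" and \<Omega>: "open \<Omega>" "\<gamma> 0 \<in> \<Omega>"
  shows "\<gamma> 0 \<in> G_set \<Omega> (wave c \<alpha> \<beta>) \<union> W_set \<Omega> (wave c \<alpha> \<beta>)"
proof (cases "\<forall>t. \<gamma> t \<in> \<Omega>")
  case False
  then obtain t where "\<gamma> t \<notin> \<Omega>" by blast
  moreover have "wave_flow_on c \<alpha> \<beta> UNIV \<gamma>" using \<gamma> by (simp add: joins_extrema_def)
  ultimately have "\<gamma> 0 \<in> G_set \<Omega> (wave c \<alpha> \<beta>)" using exit_in_G_set[of \<alpha> \<beta> c \<gamma> \<Omega> t] pos \<Omega> by simp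
  then show ?thesis ..
next
  case True
  let ?w = "wave c \<alpha> \<beta>"
  obtain p q where pq: "(\<gamma> \<longlongrightarrow> q) at_top" "(\<gamma> \<longlongrightarrow> p) at_bot" "?w q = - ?w p" "\<bar>?w p\<bar> = \<bar>c\<bar>"
    and f: "wave_flow_on c \<alpha> \<beta> UNIV \<gamma>"
    using \<gamma> unfolding joins_extrema_def by blast
  have lq: "((\<lambda>t. ?w (\<gamma> t)) \<longlongrightarrow> ?w q) at_top" by (rule isCont_tendsto_compose[OF wave_isCont pq(1)])
  have lp: "((\<lambda>t. ?w (\<gamma> t)) \<longlongrightarrow> ?w p) at_bot" by (rule isCont_tendsto_compose[OF wave_isCont pq(2)])
  have "\<forall>\<^sub>F t in at_top. ?w (\<gamma> t) \<le> ?w (\<gamma> 0)"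
    using eventually_ge_at_top[of "0::real"] by eventually_elim (rule wave_decreasing[OF f])
  then have "?w q \<le> ?w (\<gamma> 0)" by (rule tendsto_upperbound[OF lq]) simp
  moreover have "\<forall>\<^sub>F t in at_bot. ?w (\<gamma> 0) \<le> ?w (\<gamma> t)"
    using eventually_le_at_bot[of "0::real"] by eventually_elim (rule wave_decreasing[OF f])
  then have "?w (\<gamma> 0) \<le> ?w p" by (rule tendsto_lowerbound[OF lp]) simp
  \<comment> \<open>The values are opposite and of modulus \<open>\<bar>c\<bar>\<close>; the wave
    decreases along the orbit, so the backward limit carries the larger one.\<close>
  ultimately have wpq: "?w p = \<bar>c\<bar>" "?w q = - \<bar>c\<bar>" using pq(3,4) by auto
  have cl: "\<gamma> t \<in> closure \<Omega>" for t using True closure_subset by blast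
  have qcl: "q \<in> closure \<Omega>" and pcl: "p \<in> closure \<Omega>"
    using Lim_in_closed_set[OF closed_closure always_eventually _ pq(1)]
      Lim_in_closed_set[OF closed_closure always_eventually _ pq(2)] cl by simp_all
  have "trajectory \<Omega> ?w (\<gamma> 0) UNIV \<gamma>"
    using f cl by (simp add: trajectory_wave_iff)
  from flow_eqI[OF this UNIV_I pos] have fl: "flow \<Omega> ?w (\<gamma> 0) = \<gamma>" "flow_interval \<Omega> ?w (\<gamma> 0) = UNIV" by auto
  have "q \<in> local_minima \<Omega> ?w" unfolding local_minima_def
    using qcl wpq wave_abs_le[of c \<alpha> \<beta>] by (auto intro!: always_eventually simp: abs_le_iff minus_le_iff)
  moreover have "p \<in> local_maxima \<Omega> ?w" unfolding local_maxima_def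
    using pcl wpq wave_abs_le[of c \<alpha> \<beta>] by (auto intro!: always_eventually simp: abs_le_iff)
  moreover have "\<gamma> 0 \<in> stable_set \<Omega> ?w q" "\<gamma> 0 \<in> unstable_set \<Omega> ?w p"
    using cl pq(1,2) by (auto simp: stable_set_def unstable_set_def fl)
  ultimately show ?thesis using \<Omega>(2) by (auto simp: W_set_def)
qed

section \<open>The level set of the barriers and the dependence on the extension\<close>

lemma cos_affine_not_locally_const:
  fixes k d x0 C :: real
  assumes ev: "\<forall>\<^sub>F x in nhds x0. cos (k * x + d) = C"
  shows "k = 0"
proof (rule ccontr)
  assume k: "k \<noteq> 0"
  \<comment> \<open>Constancy near x0 holds near each nearby point as well; so the sine vanishes
    around x0 and can be differentiated once more, which makes the cosine vanish too.\<close>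
  have "\<forall>\<^sub>F x in nhds x0. \<forall>\<^sub>F x' in nhds x. cos (k * x' + d) = C"
    using ev by (simp only: eventually_eventually)
  then have ev0: "\<forall>\<^sub>F x in nhds x0. sin (k * x + d) = 0"
  proof eventually_elim
    case (elim x)
    have "((\<lambda>x. cos (k * x + d)) has_real_derivative - sin (k * x + d) * k) (at x)"
      by (auto intro!: derivative_eq_intros)
    then have "((\<lambda>x. C) has_real_derivative - sin (k * x + d) * k) (at x)"
      using DERIV_cong_ev[OF refl elim refl] by simp
    from DERIV_unique[OF this DERIV_const] show ?case using k by simp
  qed
  have "((\<lambda>x. sin (k * x + d)) has_real_derivative cos (k * x0 + d) * k) (at x0)"
    by (auto intro!: derivative_eq_intros)
  then have "((\<lambda>x. 0) has_real_derivative cos (k * x0 + d) * k) (at x0)"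
    using DERIV_cong_ev[OF refl ev0 refl] by simp
  from DERIV_unique[OF this DERIV_const] have "cos (k * x0 + d) = 0" using k by simp
  moreover have "sin (k * x0 + d) = 0" using ev0 by (rule eventually_nhds_x_imp_x)
  ultimately show False using sin_cos_squared_add[of "k * x0 + d"] by simp
qed

text \<open>It contains the extrema besides the saddles and their separatrices, because there both
  barriers are 0.\<close>

definition separatrix_set :: "real \<Rightarrow> real \<Rightarrow> (real \<times> real) set" where
  "separatrix_set \<alpha> \<beta> = {z. barrier \<alpha> (\<beta>\<^sup>2) (fst z) = barrier \<beta> (\<alpha>\<^sup>2) (snd z)}"

lemma closed_separatrix_set: "\<alpha> > 0 \<Longrightarrow> \<beta> > 0 \<Longrightarrow> closed (separatrix_set \<alpha> \<beta>)"
  unfolding separatrix_set_def by (intro closed_Collect_eq barrier_continuous continuous_intros) auto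

lemma interior_separatrix_set:
  assumes pos: "\<alpha> > 0" "\<beta> > 0" shows "interior (separatrix_set \<alpha> \<beta>) = {}"
proof (rule ccontr)
  assume "interior (separatrix_set \<alpha> \<beta>) \<noteq> {}"
  then obtain x0 y0 where z: "(x0, y0) \<in> interior (separatrix_set \<alpha> \<beta>)" by auto
  have "\<forall>\<^sub>F x in nhds x0. (x, y0) \<in> interior (separatrix_set \<alpha> \<beta>)"
    by (rule eventually_nhds_slice(1)[OF open_interior z])
  \<comment> \<open>With y frozen, \<open>\<bar>cos (\<alpha> * x)\<bar>\<close> would be locally
    constant. Passing to the double angle removes the absolute value.\<close>
  then have "\<forall>\<^sub>F x in nhds x0. cos (2 * \<alpha> * x + 0) = 2 * (barrier \<beta> (\<alpha>\<^sup>2) y0 powr (1 / \<beta>\<^sup>2))\<^sup>2 - 1"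
  proof eventually_elim
    case (elim x)
    then have "barrier \<alpha> (\<beta>\<^sup>2) x = barrier \<beta> (\<alpha>\<^sup>2) y0"
      using interior_subset by (force simp: separatrix_set_def)
    then have "barrier \<beta> (\<alpha>\<^sup>2) y0 powr (1 / \<beta>\<^sup>2) = \<bar>cos (\<alpha> * x)\<bar>"
      using pos by (simp add: barrier_def[of \<alpha>] powr_powr flip: \<open>barrier \<alpha> (\<beta>\<^sup>2) x = barrier \<beta> (\<alpha>\<^sup>2) y0\<close>)
    then show ?case using cos_double_cos[of "\<alpha> * x"] by (simp add: mult.assoc)
  qed
  then have "2 * \<alpha> = 0" by (rule cos_affine_not_locally_const)
  then show False using pos by simp
qed

definition neumann_region :: "(real \<times> real) set \<Rightarrow> (real \<times> real \<Rightarrow> real) \<Rightarrow> (real \<times> real) set" where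
  "neumann_region \<Omega> v = (G_set \<Omega> v \<union> W_set \<Omega> v \<union> interior (L_set \<Omega> v))
     - (\<Union>r\<in>saddle_points \<Omega> v. frontier (L_at \<Omega> v r))"

text \<open>Extrema and gradients are taken at points of the closure, and trajectories never leave
  it; hence only the germs there matter. This permits replacing the chosen extension by the
  wave.\<close>

lemma neumann_region_cong:
  assumes ev: "\<And>z. z \<in> closure \<Omega> \<Longrightarrow> \<forall>\<^sub>F w in nhds z. v w = v' w"
  shows "neumann_region \<Omega> v = neumann_region \<Omega> v'"
proof -
  have grad: "gradient v z = gradient v' z" if z: "z \<in> closure \<Omega>" for z
  proof -
    obtain S where S: "open S" "z \<in> S" "\<And>w. w \<in> S \<Longrightarrow> v w = v' w"
      using ev[OF z] unfolding eventually_nhds by metis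
    show ?thesis unfolding gradient_def using pd_cong[OF S] by simp
  qed
  have eq: "v z = v' z" if "z \<in> closure \<Omega>" for z using ev[OF that] by (rule eventually_nhds_x_imp_x)
  have min: "local_minima \<Omega> v = local_minima \<Omega> v'"
    unfolding local_minima_def
  proof (rule Collect_cong, rule conj_cong[OF refl])
    fix z assume z: "z \<in> closure \<Omega>"
    show "(\<forall>\<^sub>F w in nhds z. v z \<le> v w) = (\<forall>\<^sub>F w in nhds z. v' z \<le> v' w)"
      by (rule eventually_cong[OF ev[OF z]]) (simp add: eq[OF z])
  qed
  have max: "local_maxima \<Omega> v = local_maxima \<Omega> v'"
    unfolding local_maxima_def
  proof (rule Collect_cong, rule conj_cong[OF refl])
    fix z assume z: "z \<in> closure \<Omega>"
    show "(\<forall>\<^sub>F w in nhds z. v w \<le> v z) = (\<forall>\<^sub>F w in nhds z. v' w \<le> v' z)"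
      by (rule eventually_cong[OF ev[OF z]]) (simp add: eq[OF z])
  qed
  have saddle: "saddle_points \<Omega> v = saddle_points \<Omega> v'"
    unfolding saddle_points_def min max using grad by auto
  have "trajectory \<Omega> v z I \<gamma> = trajectory \<Omega> v' z I \<gamma>" for z I \<gamma>
    unfolding trajectory_def by (simp add: grad cong: conj_cong)
  then have traj: "trajectory \<Omega> v = trajectory \<Omega> v'" by (intro ext)
  have fl: "flow \<Omega> v = flow \<Omega> v'" "flow_interval \<Omega> v = flow_interval \<Omega> v'"
    by (intro ext, simp add: flow_def flow_interval_def traj)+
  have st: "stable_set \<Omega> v = stable_set \<Omega> v'" "unstable_set \<Omega> v = unstable_set \<Omega> v'"
    by (intro ext, simp add: stable_set_def unstable_set_def fl)+
  have "L_at \<Omega> v = L_at \<Omega> v'" by (intro ext) (simp add: L_at_def st)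
  then show ?thesis
    by (simp add: neumann_region_def G_set_def W_set_def L_set_def fl st min max saddle)
qed

lemma neumann_domains_eq_components:
  assumes ab: "0 < a" "0 < b"
    and u: "\<And>z. z \<in> closure (rectangle a b) \<Longrightarrow> u z = wave c \<alpha> \<beta> z"
  shows "neumann_domains (rectangle a b) u = components (neumann_region (rectangle a b) (wave c \<alpha> \<beta>))"
proof -
  define v where "v = (SOME v. analytic_extension (rectangle a b) u v)"
  have "analytic_extension (rectangle a b) u (wave c \<alpha> \<beta>)"
    unfolding analytic_extension_def using wave_real_analytic u by (auto intro!: exI[of _ UNIV])
  from someI[of "analytic_extension (rectangle a b) u", OF this]
  have "analytic_extension (rectangle a b) u v" by (simp add: v_def)
  then have "neumann_region (rectangle a b) v = neumann_region (rectangle a b) (wave c \<alpha> \<beta>)"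
    by (intro neumann_region_cong analytic_extension_wave[OF ab _ u])
  then show ?thesis by (simp add: neumann_domains_def neumann_region_def v_def Let_def)
qed

section \<open>Critical points of the wave\<close>

lemma wave_extremum:
  assumes "cos (\<alpha> * fst z) = 0" "cos (\<beta> * snd z) = 0" "z \<in> closure \<Omega>"
  shows "z \<in> local_minima \<Omega> (wave c \<alpha> \<beta>) \<union> local_maxima \<Omega> (wave c \<alpha> \<beta>)"
proof -
  have s: "\<bar>sin t\<bar> = 1" if "cos t = 0" for t :: real
    using that sin_cos_squared_add[of t] by (simp add: abs_square_eq_1[symmetric])
  have "\<bar>wave c \<alpha> \<beta> z\<bar> = \<bar>c\<bar>"
    using s[OF assms(1)] s[OF assms(2)] by (simp add: wave_def abs_mult)
  then consider "wave c \<alpha> \<beta> z = \<bar>c\<bar>" | "wave c \<alpha> \<beta> z = - \<bar>c\<bar>" by linarith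
  then show ?thesis
  proof cases
    case 1
    have "wave c \<alpha> \<beta> w \<le> wave c \<alpha> \<beta> z" for w using wave_abs_le[of c \<alpha> \<beta> w] 1 by linarith
    then show ?thesis using assms(3) by (simp add: local_maxima_def)
  next
    case 2
    have "wave c \<alpha> \<beta> z \<le> wave c \<alpha> \<beta> w" for w using wave_abs_le[of c \<alpha> \<beta> w] 2 by linarith
    then show ?thesis using assms(3) by (simp add: local_minima_def)
  qed
qed

lemma wave_saddle_points:
  assumes pos: "\<alpha> > 0" "\<beta> > 0" and c: "c \<noteq> 0"
  shows "saddle_points \<Omega> (wave c \<alpha> \<beta>) = {z \<in> closure \<Omega>. sin (\<alpha> * fst z) = 0 \<and> sin (\<beta> * snd z) = 0}"
proof (intro equalityI subsetI)
  fix z assume z: "z \<in> saddle_points \<Omega> (wave c \<alpha> \<beta>)"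
  then have cl: "z \<in> closure \<Omega>" and g: "gradient (wave c \<alpha> \<beta>) z = 0"
    and ne: "z \<notin> local_minima \<Omega> (wave c \<alpha> \<beta>) \<union> local_maxima \<Omega> (wave c \<alpha> \<beta>)"
    unfolding saddle_points_def by auto
  have e: "cos (\<alpha> * fst z) = 0 \<or> sin (\<beta> * snd z) = 0" "sin (\<alpha> * fst z) = 0 \<or> cos (\<beta> * snd z) = 0"
    using g pos c by (auto simp: gradient_wave zero_prod_def)
  have nz: "\<not> (cos t = 0 \<and> sin t = 0)" for t :: real using sin_zero_abs_cos_one[of t] by auto
  have "\<not> (cos (\<alpha> * fst z) = 0 \<and> cos (\<beta> * snd z) = 0)" using wave_extremum cl ne by blast
  then show "z \<in> {z \<in> closure \<Omega>. sin (\<alpha> * fst z) = 0 \<and> sin (\<beta> * snd z) = 0}"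
    using e nz[of "\<alpha> * fst z"] nz[of "\<beta> * snd z"] cl by auto
next
  fix z assume z: "z \<in> {z \<in> closure \<Omega>. sin (\<alpha> * fst z) = 0 \<and> sin (\<beta> * snd z) = 0}"
  then have s: "sin (\<alpha> * fst z) = 0" "sin (\<beta> * snd z) = 0" by auto
  define C where "C = c * (cos (\<alpha> * fst z) * cos (\<beta> * snd z))"
  have C: "C \<noteq> 0" using sin_zero_abs_cos_one[OF s(1)] sin_zero_abs_cos_one[OF s(2)] c by (auto simp: C_def)
  have wz: "wave c \<alpha> \<beta> z = 0" using s by (simp add: wave_def)
  \<comment> \<open>Restriction to the two diagonals through the common zero of the sines; there the
    wave has opposite signs.\<close>
  have w: "wave c \<alpha> \<beta> (z + (h, \<sigma> * h)) = C * (sin (\<alpha> * h) * sin (\<beta> * (\<sigma> * h)))" for h \<sigma>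
    using s by (simp add: wave_def C_def distrib_left sin_add)
  have lim: "filterlim (\<lambda>h. z + (h, \<sigma> * h)) (nhds z) (at_right (0::real))" for \<sigma>
  proof -
    have "((\<lambda>h. z + (h, \<sigma> * h)) \<longlongrightarrow> z + (0, \<sigma> * 0)) (at_right (0::real))" by (intro tendsto_intros)
    then show ?thesis by (simp add: zero_prod_def[symmetric])
  qed
  have sp: "\<forall>\<^sub>F h in at_right (0::real). sin (k * h) > 0" if "k > 0" for k
  proof -
    have "((\<lambda>h. k * h) \<longlongrightarrow> k * 0) (at_right (0::real))" by (intro tendsto_intros)
    then have "\<forall>\<^sub>F h in at_right (0::real). k * h < pi" by (rule order_tendstoD) simp
    then show ?thesis using eventually_at_right_less
      by eventually_elim (use that in \<open>simp add: sin_gt_zero\<close>)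
  qed
  \<comment> \<open>A property of all nearby values holds on both diagonals at once, hence for
    opposite nonzero numbers. Taking a weak sign condition for P excludes either kind of
    extremum.\<close>
  have signs: "\<exists>h. P (C * h) \<and> P (C * - h) \<and> h > 0"
    if "\<forall>\<^sub>F w in nhds z. P (wave c \<alpha> \<beta> w)" for P
  proof -
    have "\<forall>\<^sub>F h in at_right 0. P (wave c \<alpha> \<beta> (z + (h, 1 * h)))" "\<forall>\<^sub>F h in at_right 0. P (wave c \<alpha> \<beta> (z + (h, -1 * h)))"
      by (rule eventually_compose_filterlim[OF that lim])+
    then have "\<forall>\<^sub>F h in at_right (0::real). P (C * (sin (\<alpha> * h) * sin (\<beta> * h))) \<and> P (C * - (sin (\<alpha> * h) * sin (\<beta> * h))) \<and> sin (\<alpha> * h) * sin (\<beta> * h) > 0"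
      using sp[OF pos(1)] sp[OF pos(2)]
    proof eventually_elim
      case (elim h)
      then show ?case using w[of h 1] w[of h "-1"] by simp
    qed
    then show ?thesis using eventually_happens'[OF trivial_limit_at_right_real] by blast
  qed
  have "z \<notin> local_minima \<Omega> (wave c \<alpha> \<beta>)"
  proof
    assume "z \<in> local_minima \<Omega> (wave c \<alpha> \<beta>)"
    then obtain h where "0 \<le> C * h" "0 \<le> C * - h" "h > 0"
      using signs[of "\<lambda>y. 0 \<le> y"] wz by (auto simp: local_minima_def)
    then show False using C by (simp add: zero_le_mult_iff mult_le_0_iff)
  qed
  moreover have "z \<notin> local_maxima \<Omega> (wave c \<alpha> \<beta>)"
  proof
    assume "z \<in> local_maxima \<Omega> (wave c \<alpha> \<beta>)"
    then obtain h where "C * h \<le> 0" "C * - h \<le> 0" "h > 0"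
      using signs[of "\<lambda>y. y \<le> 0"] wz by (auto simp: local_maxima_def)
    then show False using C by (simp add: zero_le_mult_iff mult_le_0_iff)
  qed
  moreover have "gradient (wave c \<alpha> \<beta>) z = 0" using s by (simp add: gradient_wave zero_prod_def)
  ultimately show "z \<in> saddle_points \<Omega> (wave c \<alpha> \<beta>)" using z by (simp add: saddle_points_def)
qed

section \<open>The Neumann region as the complement of the level set\<close>

lemma L_at_subset_separatrix_set:
  assumes pos: "\<alpha> > 0" "\<beta> > 0" and c: "c \<noteq> 0" and r: "r \<in> saddle_points \<Omega> (wave c \<alpha> \<beta>)"
  shows "closure (L_at \<Omega> (wave c \<alpha> \<beta>) r) \<subseteq> separatrix_set \<alpha> \<beta>"
proof (rule closure_minimal[OF _ closed_separatrix_set[OF pos]], rule subsetI)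
  have s: "sin (\<alpha> * fst r) = 0" "sin (\<beta> * snd r) = 0" using r wave_saddle_points[OF pos c] by auto
  fix z assume "z \<in> L_at \<Omega> (wave c \<alpha> \<beta>) r"
  then consider "z \<in> stable_set \<Omega> (wave c \<alpha> \<beta>) r" | "z \<in> unstable_set \<Omega> (wave c \<alpha> \<beta>) r"
    by (auto simp: L_at_def)
  then show "z \<in> separatrix_set \<alpha> \<beta>"
  proof cases
    case 1
    then have I: "{0..} \<subseteq> flow_interval \<Omega> (wave c \<alpha> \<beta>) z" and l: "(flow \<Omega> (wave c \<alpha> \<beta>) z \<longlongrightarrow> r) at_top"
      by (auto simp: stable_set_def)
    have "\<forall>\<^sub>F t in at_top. t \<in> flow_interval \<Omega> (wave c \<alpha> \<beta>) z"
      using eventually_ge_at_top[of "0::real"] by eventually_elim (use I in auto)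
    from barrier_eq_of_limit[OF pos _ this l s] show ?thesis by (simp add: separatrix_set_def)
  next
    case 2
    then have I: "{..0} \<subseteq> flow_interval \<Omega> (wave c \<alpha> \<beta>) z" and l: "(flow \<Omega> (wave c \<alpha> \<beta>) z \<longlongrightarrow> r) at_bot"
      by (auto simp: unstable_set_def)
    have "\<forall>\<^sub>F t in at_bot. t \<in> flow_interval \<Omega> (wave c \<alpha> \<beta>) z"
      using eventually_le_at_bot[of "0::real"] by eventually_elim (use I in auto)
    from barrier_eq_of_limit[OF pos _ this l s] show ?thesis by (simp add: separatrix_set_def)
  qed
qed

lemma stationary_flow:
  assumes pos: "\<alpha> > 0" "\<beta> > 0" and z: "z \<in> closure \<Omega>" "gradient (wave c \<alpha> \<beta>) z = 0"
  shows "flow \<Omega> (wave c \<alpha> \<beta>) z = (\<lambda>t. z)" "flow_interval \<Omega> (wave c \<alpha> \<beta>) z = UNIV"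
proof -
  have "trajectory \<Omega> (wave c \<alpha> \<beta>) z UNIV (\<lambda>t. z)"
    using z by (simp add: trajectory_def)
  from flow_eqI[OF this UNIV_I pos]
  show "flow \<Omega> (wave c \<alpha> \<beta>) z = (\<lambda>t. z)" "flow_interval \<Omega> (wave c \<alpha> \<beta>) z = UNIV" by auto
qed

text \<open>The orbit of an extremum is constant. It does not reach the frontier, and membership in
  \<open>W_set\<close> would make the point a local minimum and a local maximum at once, so that the
  wave would be locally constant.\<close>

lemma extremum_not_in_G_W:
  assumes pos: "\<alpha> > 0" "\<beta> > 0" and c: "c \<noteq> 0" and \<Omega>: "open \<Omega>"
    and z: "z \<in> \<Omega>" "cos (\<alpha> * fst z) = 0" "cos (\<beta> * snd z) = 0"
  shows "z \<notin> G_set \<Omega> (wave c \<alpha> \<beta>) \<union> W_set \<Omega> (wave c \<alpha> \<beta>)"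
proof -
  have zc: "z \<in> closure \<Omega>" using z closure_subset by blast
  have g: "gradient (wave c \<alpha> \<beta>) z = 0" using z by (simp add: gradient_wave zero_prod_def)
  note fl = stationary_flow[OF pos zc g]
  have "z \<notin> frontier \<Omega>" using z \<Omega> by (simp add: frontier_def interior_open)
  then have "z \<notin> G_set \<Omega> (wave c \<alpha> \<beta>)" by (simp add: G_set_def fl)
  moreover have "z \<notin> W_set \<Omega> (wave c \<alpha> \<beta>)"
  proof
    assume "z \<in> W_set \<Omega> (wave c \<alpha> \<beta>)"
    then obtain p q where pq: "q \<in> local_minima \<Omega> (wave c \<alpha> \<beta>)" "p \<in> local_maxima \<Omega> (wave c \<alpha> \<beta>)"
      "((\<lambda>t::real. z) \<longlongrightarrow> q) at_top" "((\<lambda>t::real. z) \<longlongrightarrow> p) at_bot"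
      by (auto simp: W_set_def stable_set_def unstable_set_def fl)
    then have "q = z" "p = z" by (auto simp: tendsto_const_iff)
    then have "\<forall>\<^sub>F w in nhds z. wave c \<alpha> \<beta> z \<le> wave c \<alpha> \<beta> w" "\<forall>\<^sub>F w in nhds z. wave c \<alpha> \<beta> w \<le> wave c \<alpha> \<beta> z"
      using pq by (auto simp: local_minima_def local_maxima_def)
    then have ev: "\<forall>\<^sub>F w in nhds z. wave c \<alpha> \<beta> w = wave c \<alpha> \<beta> z" by eventually_elim simp
    have "filterlim (\<lambda>x. (x, snd z)) (nhds z) (nhds (fst z))"
    proof -
      have "((\<lambda>x. (x, snd z)) \<longlongrightarrow> (fst z, snd z)) (nhds (fst z))" by (intro tendsto_intros filterlim_ident)
      then show ?thesis by simp
    qed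
    from eventually_compose_filterlim[OF ev this]
    have "\<forall>\<^sub>F x in nhds (fst z). cos (\<alpha> * x + (- pi / 2)) = sin (\<alpha> * fst z)"
    proof eventually_elim
      case (elim x)
      have "sin (\<beta> * snd z) \<noteq> 0" using z(3) sin_cos_squared_add[of "\<beta> * snd z"] by auto
      then have "sin (\<alpha> * x) = sin (\<alpha> * fst z)" using elim c by (simp add: wave_def)
      then show ?case by (simp add: cos_diff)
    qed
    then have "\<alpha> = 0" by (rule cos_affine_not_locally_const)
    then show False using pos by simp
  qed
  ultimately show ?thesis by simp
qed

text \<open>Where both barriers are 1 the point is itself a saddle and belongs to its own stable
  set. Otherwise its separatrix stays in one nodal cell, therefore in the rectangle, and the limit
  is a saddle in the closure.\<close>

lemma separatrix_point_in_L_at: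
  fixes m n :: nat
  assumes ab: "0 < a" "0 < b" and \<alpha>\<beta>: "\<alpha> = real m * pi / a" "\<beta> = real n * pi / b" and mn: "1 \<le> m" "1 \<le> n" and c: "c \<noteq> 0"
    and z: "z \<in> rectangle a b" "z \<in> separatrix_set \<alpha> \<beta>" and ne: "barrier \<alpha> (\<beta>\<^sup>2) (fst z) \<noteq> 0"
  shows "\<exists>r \<in> saddle_points (rectangle a b) (wave c \<alpha> \<beta>). z \<in> L_at (rectangle a b) (wave c \<alpha> \<beta>) r"
proof -
  let ?\<Omega> = "rectangle a b" and ?w = "wave c \<alpha> \<beta>"
  have pos: "\<alpha> > 0" "\<beta> > 0" using ab mn by (auto simp: \<alpha>\<beta>)
  have zc: "z \<in> closure ?\<Omega>" using z closure_subset by blast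
  have eq: "barrier \<beta> (\<alpha>\<^sup>2) (snd z) = barrier \<alpha> (\<beta>\<^sup>2) (fst z)" using z by (simp add: separatrix_set_def)
  have zx: "0 < fst z" "fst z < a" "0 < snd z" "snd z < b" using z(1) by (auto simp: rectangle_def)
  show ?thesis
  proof (cases "barrier \<alpha> (\<beta>\<^sup>2) (fst z) = 1")
    case True
    then have s: "sin (\<alpha> * fst z) = 0" "sin (\<beta> * snd z) = 0"
      using barrier_eq_1_iff[of "\<beta>\<^sup>2" \<alpha> "fst z"] barrier_eq_1_iff[of "\<alpha>\<^sup>2" \<beta> "snd z"] eq pos by auto
    have "gradient ?w z = 0" using s by (simp add: gradient_wave zero_prod_def)
    note fl = stationary_flow[OF pos zc this]
    have "z \<in> stable_set ?\<Omega> ?w z" using zc by (simp add: stable_set_def fl)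
    moreover have "z \<in> saddle_points ?\<Omega> ?w" using wave_saddle_points[OF pos c] s zc by simp
    ultimately show ?thesis by (auto simp: L_at_def)
  next
    case False
    obtain \<gamma> r k j where \<gamma>: "\<gamma> 0 = (fst z, snd z)" "wave_flow_on c \<alpha> \<beta> UNIV \<gamma>"
      "(\<gamma> \<longlongrightarrow> r) at_top \<or> (\<gamma> \<longlongrightarrow> r) at_bot" "sin (\<alpha> * fst r) = 0" "sin (\<beta> * snd r) = 0"
      "real k * pi < \<alpha> * fst z" "\<alpha> * fst z < real k * pi + pi" "real j * pi < \<beta> * snd z" "\<beta> * snd z < real j * pi + pi"
      "\<And>t. real k * pi < \<alpha> * fst (\<gamma> t) \<and> \<alpha> * fst (\<gamma> t) < real k * pi + pi"
      "\<And>t. real j * pi < \<beta> * snd (\<gamma> t) \<and> \<beta> * snd (\<gamma> t) < real j * pi + pi"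
      by (rule ex_separatrix[OF pos c _ _ eq ne False]) (use zx in auto)
    \<comment> \<open>The far side of the rectangle is itself a grid line, so a cell that begins
      before it cannot extend beyond it.\<close>
    have inside: "0 < x \<and> x < l" if "real i * pi < \<kappa> * x0" "x0 < l" "real i * pi < \<kappa> * x" "\<kappa> * x < real i * pi + pi"
      "\<kappa> = real N * pi / l" "0 < l" "1 \<le> N" for i N :: nat and x x0 l \<kappa> :: real
    proof -
      have \<kappa>: "\<kappa> > 0" "\<kappa> * l = real N * pi" using that by auto
      have "real i * pi < real N * pi" using that(1,2) \<kappa> mult_strict_left_mono[of x0 l \<kappa>] by linarith
      then have "real i + 1 \<le> real N" by simp
      then have "(real i + 1) * pi \<le> real N * pi" by (intro mult_right_mono) auto
      then have "\<kappa> * x < \<kappa> * l" using that(4) \<kappa> by (simp add: distrib_right)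
      moreover have "\<kappa> * 0 < \<kappa> * x" using that(3) by (smt (verit) mult_nonneg_nonneg mult_zero_right of_nat_0_le_iff pi_ge_zero)
      ultimately show ?thesis using \<kappa>(1) by (simp only: mult_less_cancel_left_pos)
    qed
    have in_\<Omega>: "\<gamma> t \<in> ?\<Omega>" for t
    proof -
      have "0 < fst (\<gamma> t) \<and> fst (\<gamma> t) < a"
        by (rule inside[OF \<gamma>(6) zx(2) _ _ \<alpha>\<beta>(1) ab(1) mn(1)]) (use \<gamma>(10)[of t] in auto)
      moreover have "0 < snd (\<gamma> t) \<and> snd (\<gamma> t) < b"
        by (rule inside[OF \<gamma>(8) zx(4) _ _ \<alpha>\<beta>(2) ab(2) mn(2)]) (use \<gamma>(11)[of t] in auto)
      ultimately show ?thesis by (simp add: rectangle_def mem_Times_iff)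
    qed
    then have cl: "\<gamma> t \<in> closure ?\<Omega>" for t using closure_subset by blast
    have "trajectory ?\<Omega> ?w z UNIV \<gamma>" using \<gamma>(1,2) cl by (simp add: trajectory_wave_iff)
    from flow_eqI[OF this UNIV_I pos] have fl: "flow ?\<Omega> ?w z = \<gamma>" "flow_interval ?\<Omega> ?w z = UNIV" by auto
    have "r \<in> closure ?\<Omega>"
      using \<gamma>(3) Lim_in_closed_set[OF closed_closure always_eventually, of \<gamma> ?\<Omega> at_top r]
        Lim_in_closed_set[OF closed_closure always_eventually, of \<gamma> ?\<Omega> at_bot r] cl by auto
    then have "r \<in> saddle_points ?\<Omega> ?w" using wave_saddle_points[OF pos c] \<gamma>(4,5) by simp
    moreover have "z \<in> L_at ?\<Omega> ?w r"
      using \<gamma>(3) zc by (auto simp: L_at_def stable_set_def unstable_set_def fl)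
    ultimately show ?thesis by blast
  qed
qed

text \<open>Empty interior of the level set does the work twice: the interior of
  \<open>L_set\<close> contributes nothing, and every point of \<open>L_at\<close> is on its
  frontier. Off the level set no frontier can pass, since the closure of each \<open>L_at\<close> is
  contained in it.\<close>

lemma neumann_region_wave:
  fixes m n :: nat
  assumes ab: "0 < a" "0 < b" and \<alpha>\<beta>: "\<alpha> = real m * pi / a" "\<beta> = real n * pi / b" and mn: "1 \<le> m" "1 \<le> n" and c: "c \<noteq> 0"
  shows "neumann_region (rectangle a b) (wave c \<alpha> \<beta>) = rectangle a b - separatrix_set \<alpha> \<beta>"
proof (intro equalityI subsetI)
  let ?\<Omega> = "rectangle a b" and ?w = "wave c \<alpha> \<beta>"
  have pos: "\<alpha> > 0" "\<beta> > 0" using ab mn by (auto simp: \<alpha>\<beta>)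
  note sub = L_at_subset_separatrix_set[OF pos c]
  have "L_set ?\<Omega> ?w \<subseteq> separatrix_set \<alpha> \<beta>" unfolding L_set_def using sub by blast
  from interior_mono[OF this] have intL: "interior (L_set ?\<Omega> ?w) = {}"
    unfolding interior_separatrix_set[OF pos] by simp
  {
    fix z assume z: "z \<in> ?\<Omega> - separatrix_set \<alpha> \<beta>"
    then have zx: "0 < fst z" "fst z < a" "0 < snd z" "snd z < b" by (auto simp: rectangle_def)
    obtain \<gamma> where \<gamma>: "\<gamma> 0 = z" "joins_extrema c \<alpha> \<beta> \<gamma>"
      using ex_joins_extrema[OF pos c, of z] zx z by (auto simp: separatrix_set_def)
    have "z \<in> G_set ?\<Omega> ?w \<union> W_set ?\<Omega> ?w"
      using joins_extrema_G_or_W[OF pos \<gamma>(2) open_rectangle] \<gamma>(1) z by auto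
    moreover have "z \<notin> frontier (L_at ?\<Omega> ?w r)" if "r \<in> saddle_points ?\<Omega> ?w" for r
      using sub[OF that] z by (auto simp: frontier_def)
    ultimately show "z \<in> neumann_region ?\<Omega> ?w" by (auto simp: neumann_region_def)
  }
  fix z assume "z \<in> neumann_region ?\<Omega> ?w"
  then have GW: "z \<in> G_set ?\<Omega> ?w \<union> W_set ?\<Omega> ?w"
    and fr: "\<And>r. r \<in> saddle_points ?\<Omega> ?w \<Longrightarrow> z \<notin> frontier (L_at ?\<Omega> ?w r)"
    by (auto simp: neumann_region_def intL)
  have z\<Omega>: "z \<in> ?\<Omega>" using GW by (auto simp: G_set_def W_set_def)
  moreover have "z \<notin> separatrix_set \<alpha> \<beta>"
  proof
    assume zs: "z \<in> separatrix_set \<alpha> \<beta>"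
    show False
    proof (cases "barrier \<alpha> (\<beta>\<^sup>2) (fst z) = 0")
      case True
      then have "barrier \<beta> (\<alpha>\<^sup>2) (snd z) = 0" using zs by (simp add: separatrix_set_def)
      then show False
        using extremum_not_in_G_W[OF pos c open_rectangle z\<Omega>] GW True by (simp add: barrier_eq_0_iff)
    next
      case False
      obtain r where r: "r \<in> saddle_points ?\<Omega> ?w" "z \<in> L_at ?\<Omega> ?w r"
        using separatrix_point_in_L_at[OF ab \<alpha>\<beta> mn c z\<Omega> zs False] by blast
      have "interior (L_at ?\<Omega> ?w r) \<subseteq> interior (separatrix_set \<alpha> \<beta>)"
        using sub[OF r(1)] closure_subset by (intro interior_mono) blast
      then have "z \<in> frontier (L_at ?\<Omega> ?w r)"
        using r(2) closure_subset interior_separatrix_set[OF pos] by (auto simp: frontier_def)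
      then show False using fr[OF r(1)] by simp
    qed
  qed
  ultimately show "z \<in> ?\<Omega> - separatrix_set \<alpha> \<beta>" by simp
qed

section \<open>Counting components\<close>

text \<open>Each member is relatively clopen in the union, hence a maximal connected subset.
  Injectivity allows counting the components by their indices.\<close>

lemma components_of_disjoint_open_family:
  assumes op: "\<And>i. i \<in> I \<Longrightarrow> open (S i)" and con: "\<And>i. i \<in> I \<Longrightarrow> connected (S i)"
    and ne: "\<And>i. i \<in> I \<Longrightarrow> S i \<noteq> {}"
    and disj: "\<And>i j. i \<in> I \<Longrightarrow> j \<in> I \<Longrightarrow> i \<noteq> j \<Longrightarrow> S i \<inter> S j = {}"
  shows "components (\<Union>i\<in>I. S i) = S ` I" and "inj_on S I"
proof -
  show "inj_on S I"
  proof (rule inj_onI)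
    fix i j assume "i \<in> I" "j \<in> I" "S i = S j"
    then show "i = j" using disj[of i j] ne[of i] by auto
  qed
  have comp: "S i \<in> components (\<Union>i\<in>I. S i)" if i: "i \<in> I" for i
    unfolding in_components_maximal
  proof (intro conjI allI impI)
    show "S i \<noteq> {}" "S i \<subseteq> (\<Union>i\<in>I. S i)" "connected (S i)" using i ne con by auto
    fix D assume D: "D \<noteq> {} \<and> S i \<subseteq> D \<and> D \<subseteq> (\<Union>i\<in>I. S i) \<and> connected D"
    define R where "R = (\<Union>j\<in>I - {i}. S j)"
    have "open R" "open (S i)" using op i by (auto simp: R_def)
    moreover have "S i \<inter> R = {}" using disj[OF i] by (auto simp: R_def)
    moreover have "D \<subseteq> S i \<union> R" using D by (auto simp: R_def)
    ultimately have "S i \<inter> D = {} \<or> R \<inter> D = {}"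
      using D connectedD[of D "S i" R] by auto
    then show "D = S i" using D ne[OF i] \<open>D \<subseteq> S i \<union> R\<close> by auto
  qed
  show "components (\<Union>i\<in>I. S i) = S ` I"
  proof
    show "S ` I \<subseteq> components (\<Union>i\<in>I. S i)" using comp by auto
    show "components (\<Union>i\<in>I. S i) \<subseteq> S ` I"
    proof
      fix C assume C: "C \<in> components (\<Union>i\<in>I. S i)"
      then obtain x where "x \<in> C" using in_components_nonempty by blast
      then obtain i where i: "i \<in> I" "x \<in> S i" using in_components_subset[OF C] by blast
      then have "C \<inter> S i \<noteq> {}" using \<open>x \<in> C\<close> by blast
      then have "C = S i" using components_eq[OF C comp[OF i(1)]] by simp
      then show "C \<in> S ` I" using i(1) by simp
    qed
  qed
qed

text \<open>In phases it surrounds the segment of length pi centred at (i pi, j pi + pi / 2), whose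
  ends are extrema. In the first and the last column the rectangle cuts off one half.\<close>

definition lens :: "real \<Rightarrow> real \<Rightarrow> real \<Rightarrow> real \<Rightarrow> nat \<Rightarrow> nat \<Rightarrow> (real \<times> real) set" where
  "lens a b \<alpha> \<beta> i j = {z \<in> rectangle a b.
     real i * pi - pi / 2 < \<alpha> * fst z \<and> \<alpha> * fst z < real i * pi + pi / 2 \<and>
     real j * pi < \<beta> * snd z \<and> \<beta> * snd z < real j * pi + pi \<and>
     barrier \<beta> (\<alpha>\<^sup>2) (snd z) < barrier \<alpha> (\<beta>\<^sup>2) (fst z)}"

lemma open_lens: "\<alpha> > 0 \<Longrightarrow> \<beta> > 0 \<Longrightarrow> open (lens a b \<alpha> \<beta> i j)"
proof -
  assume pos: "\<alpha> > 0" "\<beta> > 0"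
  have "lens a b \<alpha> \<beta> i j = rectangle a b \<inter> {z. real i * pi - pi / 2 < \<alpha> * fst z} \<inter> {z. \<alpha> * fst z < real i * pi + pi / 2} \<inter>
     {z. real j * pi < \<beta> * snd z} \<inter> {z. \<beta> * snd z < real j * pi + pi} \<inter>
     {z. barrier \<beta> (\<alpha>\<^sup>2) (snd z) < barrier \<alpha> (\<beta>\<^sup>2) (fst z)}"
    by (auto simp: lens_def)
  then show ?thesis
    using pos by (auto intro!: open_Int open_rectangle open_Collect_less barrier_continuous continuous_intros)
qed

lemma abs_cos_le_toward_half_pi:
  fixes \<eta> \<eta>' :: real
  assumes "0 < \<eta>" "\<eta> < pi" "\<eta>' \<in> closed_segment \<eta> (pi / 2)"
  shows "\<bar>cos \<eta>'\<bar> \<le> \<bar>cos \<eta>\<bar>"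
proof (cases "\<eta> \<le> pi / 2")
  case True
  then have *: "\<eta> \<le> \<eta>'" "\<eta>' \<le> pi / 2" using assms by (auto simp: closed_segment_eq_real_ivl)
  then have "cos \<eta>' \<le> cos \<eta>" "0 \<le> cos \<eta>'" using assms by (auto intro!: cos_monotone_0_pi_le cos_ge_zero)
  then show ?thesis by simp
next
  case False
  then have *: "\<eta>' \<le> \<eta>" "pi / 2 \<le> \<eta>'" using assms by (auto simp: closed_segment_eq_real_ivl split: if_splits)
  then have "cos \<eta> \<le> cos \<eta>'" using assms by (intro cos_monotone_0_pi_le) auto
  moreover have "cos \<eta>' \<le> cos (pi / 2)" using * assms by (intro cos_monotone_0_pi_le) auto
  ultimately show ?thesis by simp
qed

lemma closed_segment_scaled:
  fixes x y t k d :: real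
  assumes "k > 0" "t \<in> closed_segment x y"
  shows "k * t - d \<in> closed_segment (k * x - d) (k * y - d)"
  using assms by (auto simp: closed_segment_eq_real_ivl mult_le_cancel_left_pos split: if_splits)

text \<open>Moving vertically towards the midline only lowers the barrier in y, so each vertical
  segment to the midline stays in the lens. On the midline that barrier is 0 and the barrier in x is
  positive throughout the column.\<close>

lemma connected_lens:
  assumes ab: "0 < a" "0 < b" and \<beta>: "\<beta> * b = real n * pi" and pos: "\<alpha> > 0" "\<beta> > 0" and j: "j < n"
  shows "connected (lens a b \<alpha> \<beta> i j)"
proof -
  let ?L = "lens a b \<alpha> \<beta> i j"
  define y0 where "y0 = (real j * pi + pi / 2) / \<beta>"
  have by0: "\<beta> * y0 = real j * pi + pi / 2" using pos by (simp add: y0_def)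
  have b0: "barrier \<beta> (\<alpha>\<^sup>2) y0 = 0" by (simp add: barrier_eq_0_iff by0 cos_sin_npi_shift')
  have jn: "real j + 1 \<le> real n" using j by simp
  have y0: "0 < y0" "y0 < b"
  proof -
    show "0 < y0" unfolding y0_def using pos by (intro divide_pos_pos) (auto intro: add_nonneg_pos)
    have "real j * pi + pi / 2 < (real j + 1) * pi" by (simp add: distrib_right)
    also have "\<dots> \<le> real n * pi" using jn by (intro mult_right_mono) auto
    finally have "\<beta> * y0 < \<beta> * b" unfolding by0 \<beta> .
    then show "y0 < b" using pos by simp
  qed
  have vert: "connected_component ?L (x, y) (x, y0)" if z: "(x, y) \<in> ?L" for x y
    unfolding connected_component_def
  proof (intro exI conjI)
    show "connected (closed_segment (x, y) (x, y0))" by simp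
    show "closed_segment (x, y) (x, y0) \<subseteq> ?L"
    proof
      fix w assume "w \<in> closed_segment (x, y) (x, y0)"
      then obtain y' where w: "w = (x, y')" and y': "y' \<in> closed_segment y y0"
        using closed_segment_PairD[of "fst w" "snd w" x y x y0] by (cases w) auto
      have "0 < y'" "y' < b"
        using y' y0 z by (auto simp: lens_def rectangle_def closed_segment_eq_real_ivl split: if_splits)
      define \<eta> where "\<eta> = \<beta> * y - real j * pi"
      define \<eta>' where "\<eta>' = \<beta> * y' - real j * pi"
      have \<eta>: "0 < \<eta>" "\<eta> < pi" using z by (auto simp: lens_def \<eta>_def)
      have seg: "\<eta>' \<in> closed_segment \<eta> (pi / 2)"
        using closed_segment_scaled[OF pos(2) y', of "real j * pi"] by (simp add: \<eta>_def \<eta>'_def by0)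
      then have \<eta>': "0 < \<eta>'" "\<eta>' < pi" using \<eta> by (auto simp: closed_segment_eq_real_ivl split: if_splits)
      have "\<bar>cos \<eta>'\<bar> \<le> \<bar>cos \<eta>\<bar>" by (rule abs_cos_le_toward_half_pi[OF \<eta> seg])
      moreover have "\<bar>cos (\<beta> * y)\<bar> = \<bar>cos \<eta>\<bar>" "\<bar>cos (\<beta> * y')\<bar> = \<bar>cos \<eta>'\<bar>"
        using cos_sin_npi_shift'(1)[of j \<eta>] cos_sin_npi_shift'(1)[of j \<eta>']
        by (simp_all add: \<eta>_def \<eta>'_def abs_mult power_abs)
      ultimately have "barrier \<beta> (\<alpha>\<^sup>2) y' \<le> barrier \<beta> (\<alpha>\<^sup>2) y"
        unfolding barrier_def using pos by (intro powr_mono2) auto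
      then show "w \<in> ?L" using z \<open>0 < y'\<close> \<open>y' < b\<close> \<eta>' by (auto simp: lens_def rectangle_def w \<eta>'_def)
    qed
  qed auto
  have horiz: "connected_component ?L (x, y0) (x', y0)" if z: "(x, y0) \<in> ?L" "(x', y0) \<in> ?L" for x x'
    unfolding connected_component_def
  proof (intro exI conjI)
    show "connected (closed_segment (x, y0) (x', y0))" by simp
    show "closed_segment (x, y0) (x', y0) \<subseteq> ?L"
    proof
      fix w assume "w \<in> closed_segment (x, y0) (x', y0)"
      then obtain t where w: "w = (t, y0)" and t: "t \<in> closed_segment x x'"
        using closed_segment_PairD[of "fst w" "snd w" x y0 x' y0] by (cases w) auto
      have t0: "0 < t" "t < a"
        using t z by (auto simp: lens_def rectangle_def closed_segment_eq_real_ivl split: if_splits)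
      have "\<alpha> * t - 0 \<in> closed_segment (\<alpha> * x - 0) (\<alpha> * x' - 0)" by (rule closed_segment_scaled[OF pos(1) t])
      then have ti: "real i * pi - pi / 2 < \<alpha> * t" "\<alpha> * t < real i * pi + pi / 2"
        using z by (auto simp: lens_def closed_segment_eq_real_ivl split: if_splits)
      have "cos (\<alpha> * t - real i * pi) > 0" using ti by (intro cos_gt_zero_pi) auto
      then have "cos (\<alpha> * t) \<noteq> 0" using cos_sin_npi_shift'(1)[of i "\<alpha> * t - real i * pi"] by auto
      then have "barrier \<alpha> (\<beta>\<^sup>2) t > 0" by (simp add: barrier_def)
      then show "w \<in> ?L" using z t0 ti by (auto simp: lens_def rectangle_def w b0)
    qed
  qed auto
  show ?thesis
    unfolding connected_iff_connected_component
  proof (intro ballI)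
    fix z w assume z: "z \<in> ?L" and w: "w \<in> ?L"
    have vz: "connected_component ?L (fst z, snd z) (fst z, y0)" and vw: "connected_component ?L (fst w, snd w) (fst w, y0)"
      using vert[of "fst z" "snd z"] vert[of "fst w" "snd w"] z w by simp_all
    have "connected_component ?L (fst z, y0) (fst w, y0)"
      using connected_component_in[OF vz] connected_component_in[OF vw] horiz by blast
    then show "connected_component ?L z w"
      using vz vw by (metis connected_component_sym connected_component_trans prod.collapse)
  qed
qed

lemma lens_nonempty:
  fixes m n :: nat
  assumes \<alpha>: "\<alpha> * a = real m * pi" and \<beta>: "\<beta> * b = real n * pi" and pos: "\<alpha> > 0" "\<beta> > 0" and mn: "1 \<le> m"
    and i: "i \<le> m" and j: "j < n"
  shows "lens a b \<alpha> \<beta> i j \<noteq> {}"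
proof -
  \<comment> \<open>In the outermost columns the centre i pi lies on the boundary of the rectangle.
    The witness is shifted by pi / 4, to the right except in the last column.\<close>
  define s where "s = (if i < m then real i * pi + pi / 4 else real i * pi - pi / 4)"
  define y where "y = (real j * pi + pi / 2) / \<beta>"
  have "0 < s \<and> s < real m * pi"
  proof (cases "i < m")
    case True
    then have "real i + 1 \<le> real m" by simp
    then have "(real i + 1) * pi \<le> real m * pi" by (intro mult_right_mono) auto
    then have "real i * pi + pi \<le> real m * pi" "0 \<le> real i * pi" by (simp_all add: distrib_right)
    moreover have "s = real i * pi + pi / 4" using True by (simp add: s_def)
    ultimately show ?thesis by (intro conjI) (use pi_gt_zero in linarith)+
  next
    case False
    then have "1 * pi \<le> real i * pi" using i mn by (intro mult_right_mono) auto
    moreover have im: "i = m" using False i by simp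
    ultimately have "pi \<le> real m * pi" by simp
    moreover have "s = real m * pi - pi / 4" using im by (simp add: s_def)
    ultimately show ?thesis by (intro conjI) (use pi_gt_zero in linarith)+
  qed
  moreover have "\<alpha> * (s / \<alpha>) = s" using pos by simp
  ultimately have "\<alpha> * 0 < \<alpha> * (s / \<alpha>)" "\<alpha> * (s / \<alpha>) < \<alpha> * a" unfolding \<alpha> by simp_all
  then have x: "0 < s / \<alpha>" "s / \<alpha> < a" using pos by (simp_all only: mult_less_cancel_left_pos)
  have "real j + 1 \<le> real n" using j by simp
  then have "(real j + 1) * pi \<le> real n * pi" by (intro mult_right_mono) auto
  then have "real j * pi + pi \<le> real n * pi" "0 \<le> real j * pi" by (simp_all add: distrib_right)
  moreover have "\<beta> * y = real j * pi + pi / 2" using pos by (simp add: y_def)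
  ultimately have "\<beta> * 0 < \<beta> * y \<and> \<beta> * y < \<beta> * b"
    unfolding \<beta> by (intro conjI) (use pi_gt_zero in linarith)+
  then have "\<beta> * 0 < \<beta> * y" "\<beta> * y < \<beta> * b" by auto
  then have y: "0 < y" "y < b" using pos by (simp_all only: mult_less_cancel_left_pos)
  have "cos (s - real i * pi) > 0" by (rule cos_gt_zero_pi) (simp_all add: s_def less_trans[OF _ pi_gt_zero])
  then have "cos s \<noteq> 0" using cos_sin_npi_shift'(1)[of i "s - real i * pi"] by auto
  then have "barrier \<alpha> (\<beta>\<^sup>2) (s / \<alpha>) > 0" using pos by (simp add: barrier_def)
  moreover have "barrier \<beta> (\<alpha>\<^sup>2) y = 0" using pos by (simp add: barrier_eq_0_iff y_def cos_sin_npi_shift')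
  ultimately have "(s / \<alpha>, y) \<in> lens a b \<alpha> \<beta> i j"
    using x y pos by (auto simp: lens_def rectangle_def s_def y_def less_trans[OF _ pi_gt_zero])
  then show ?thesis by blast
qed

lemma mult_pi_less_imp: "real i * pi < real j * pi + pi \<Longrightarrow> i \<le> j"
proof -
  assume "real i * pi < real j * pi + pi"
  then have "real i * pi < (real j + 1) * pi" by (simp add: distrib_right)
  then have "real i < real j + 1" by simp
  then show ?thesis by simp
qed

lemma lens_disjoint:
  assumes "z \<in> lens a b \<alpha> \<beta> i j" "z \<in> lens a b \<alpha> \<beta> i' j'"
  shows "i = i' \<and> j = j'"
proof -
  have "real i * pi < real i' * pi + pi" "real i' * pi < real i * pi + pi"
    "real j * pi < real j' * pi + pi" "real j' * pi < real j * pi + pi"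
    using assms by (auto simp: lens_def)
  then show ?thesis using mult_pi_less_imp by (meson le_antisym)
qed

lemma lens_cover:
  assumes \<alpha>: "\<alpha> * a = real m * pi" and \<beta>: "\<beta> * b = real n * pi" and pos: "\<alpha> > 0" "\<beta> > 0"
    and z: "z \<in> rectangle a b" and less: "barrier \<beta> (\<alpha>\<^sup>2) (snd z) < barrier \<alpha> (\<beta>\<^sup>2) (fst z)"
  obtains i j where "i \<le> m" "j < n" "z \<in> lens a b \<alpha> \<beta> i j"
proof -
  have zx: "0 < fst z" "fst z < a" "0 < snd z" "snd z < b" using z by (auto simp: rectangle_def)
  obtain i j :: nat where ij: "real i * pi - pi / 2 < \<alpha> * fst z" "\<alpha> * fst z < real i * pi + pi / 2"
    "real j * pi < \<beta> * snd z" "\<beta> * snd z < real j * pi + pi"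
    using barrier_less_cell[OF pos _ _ less] zx by auto
  have "\<alpha> * fst z < real m * pi" "\<beta> * snd z < real n * pi"
    using zx pos unfolding \<alpha>[symmetric] \<beta>[symmetric] by auto
  then have "real i * pi < real m * pi + pi" "real j * pi < real n * pi" using ij pi_gt_zero by linarith+
  then have "i \<le> m" "j < n" using mult_pi_less_imp by auto
  moreover have "z \<in> lens a b \<alpha> \<beta> i j" using z less ij by (auto simp: lens_def)
  ultimately show thesis by (rule that)
qed

lemma rectangle_swap: "prod.swap z \<in> rectangle b a \<longleftrightarrow> z \<in> rectangle a b"
  by (cases z) (auto simp: rectangle_def)

lemma components_off_separatrix_set:
  fixes m n :: nat
  assumes ab: "0 < a" "0 < b" and \<alpha>: "\<alpha> * a = real m * pi" and \<beta>: "\<beta> * b = real n * pi"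
    and pos: "\<alpha> > 0" "\<beta> > 0" and mn: "1 \<le> m" "1 \<le> n"
  shows "finite (components (rectangle a b - separatrix_set \<alpha> \<beta>))"
    and "card (components (rectangle a b - separatrix_set \<alpha> \<beta>)) = 2 * m * n + m + n"
proof -
  \<comment> \<open>Vertical lenses are horizontal ones of the transposed rectangle; the index pair
    keeps the order column, row and is therefore exchanged inside \<open>lens\<close>.\<close>
  define S where "S k = (case k of Inl (i, j) \<Rightarrow> lens a b \<alpha> \<beta> i j | Inr (i, j) \<Rightarrow> prod.swap -` lens b a \<beta> \<alpha> j i)"
    for k :: "nat \<times> nat + nat \<times> nat"
  \<comment> \<open>Horizontal lenses are centred on vertical grid lines, the two sides of the
    rectangle included, whence \<open>{..m}\<close> against \<open>{..<n}\<close>; for vertical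
    lenses the roles are exchanged.\<close>
  define I where "I = ({..m} \<times> {..<n}) <+> ({..<m} \<times> {..n})"
  have swap: "prod.swap -` X = prod.swap ` X" for X :: "(real \<times> real) set" by force
  have op: "open (S k)" if "k \<in> I" for k
    using open_lens[OF pos] open_lens[OF pos(2,1)]
    by (auto simp: S_def split: sum.split prod.split intro!: open_vimage continuous_on_swap)
  have con: "connected (S k)" if "k \<in> I" for k
    using connected_lens[OF ab \<beta> pos] connected_lens[OF ab(2,1) \<alpha> pos(2,1)] that unfolding swap S_def
    by (auto simp: I_def intro!: connected_continuous_image continuous_on_swap)
  have ne: "S k \<noteq> {}" if "k \<in> I" for k
    using lens_nonempty[OF \<alpha> \<beta> pos mn(1)] lens_nonempty[OF \<beta> \<alpha> pos(2,1) mn(2)] that unfolding swap S_def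
    by (auto simp: I_def)
  have disj: "S k \<inter> S l = {}" if "k \<in> I" "l \<in> I" "k \<noteq> l" for k l
  proof (rule ccontr)
    assume "S k \<inter> S l \<noteq> {}"
    then obtain z where z: "z \<in> S k" "z \<in> S l" by blast
    show False
    proof (cases k; cases l)
      fix p q assume kl: "k = Inl p" "l = Inl q"
      obtain i j i' j' where pq: "p = (i, j)" "q = (i', j')" by (cases p; cases q)
      have "z \<in> lens a b \<alpha> \<beta> i j" "z \<in> lens a b \<alpha> \<beta> i' j'" using z by (simp_all add: S_def kl pq)
      from lens_disjoint[OF this] show False using that(3) by (simp add: kl pq)
    next
      fix p q assume kl: "k = Inr p" "l = Inr q"
      obtain i j i' j' where pq: "p = (i, j)" "q = (i', j')" by (cases p; cases q)
      have "prod.swap z \<in> lens b a \<beta> \<alpha> j i" "prod.swap z \<in> lens b a \<beta> \<alpha> j' i'" using z by (simp_all add: S_def kl pq)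
      from lens_disjoint[OF this] show False using that(3) by (simp add: kl pq)
    next
      fix p q assume "k = Inl p" "l = Inr q"
      then show False using z by (cases p; cases q) (simp add: S_def lens_def)
    next
      fix p q assume "k = Inr p" "l = Inl q"
      then show False using z by (cases p; cases q) (simp add: S_def lens_def)
    qed
  qed
  have "(\<Union>k\<in>I. S k) = rectangle a b - separatrix_set \<alpha> \<beta>"
  proof (intro equalityI subsetI)
    fix z assume "z \<in> (\<Union>k\<in>I. S k)"
    then obtain k where "k \<in> I" "z \<in> S k" by blast
    then show "z \<in> rectangle a b - separatrix_set \<alpha> \<beta>"
      using rectangle_swap[of z b a] by (cases k) (auto simp: S_def lens_def separatrix_set_def)
  next
    fix z assume z: "z \<in> rectangle a b - separatrix_set \<alpha> \<beta>"
    then consider "barrier \<beta> (\<alpha>\<^sup>2) (snd z) < barrier \<alpha> (\<beta>\<^sup>2) (fst z)" | "barrier \<alpha> (\<beta>\<^sup>2) (fst z) < barrier \<beta> (\<alpha>\<^sup>2) (snd z)"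
      by (force simp: separatrix_set_def)
    then show "z \<in> (\<Union>k\<in>I. S k)"
    proof cases
      case 1
      obtain i j where "i \<le> m" "j < n" "z \<in> lens a b \<alpha> \<beta> i j"
        using lens_cover[OF \<alpha> \<beta> pos _ 1] z by blast
      then show ?thesis by (intro UN_I[of "Inl (i, j)"]) (auto simp: I_def S_def)
    next
      case 2
      have "prod.swap z \<in> rectangle b a" using z rectangle_swap by blast
      then obtain j i where "j \<le> n" "i < m" "prod.swap z \<in> lens b a \<beta> \<alpha> j i"
        using lens_cover[OF \<beta> \<alpha> pos(2,1), of "prod.swap z"] 2 by auto
      then show ?thesis by (intro UN_I[of "Inr (i, j)"]) (auto simp: I_def S_def)
    qed
  qed
  then have eq: "components (rectangle a b - separatrix_set \<alpha> \<beta>) = S ` I" and inj: "inj_on S I"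
    using components_of_disjoint_open_family[of I S] op con ne disj by auto
  have "finite I" by (simp add: I_def)
  then show "finite (components (rectangle a b - separatrix_set \<alpha> \<beta>))" by (simp add: eq)
  have "card (S ` I) = card I" by (rule card_image[OF inj])
  also have "\<dots> = Suc m * n + m * Suc n" unfolding I_def by (subst card_Plus) (auto simp: card_cartesian_product)
  also have "\<dots> = 2 * m * n + m + n" by simp
  finally show "card (components (rectangle a b - separatrix_set \<alpha> \<beta>)) = 2 * m * n + m + n" by (simp add: eq)
qed

lemma neumann_domains_mode:
  assumes ab: "0 < a" "0 < b" and mn: "1 \<le> m" "1 \<le> n" and c: "c \<noteq> 0"
  shows "ecard (neumann_domains (rectangle a b) (mode a b m n c)) = ereal (real (2 * m * n + m + n))"
proof -
  define \<alpha> where "\<alpha> = real m * pi / a"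
  define \<beta> where "\<beta> = real n * pi / b"
  have pos: "\<alpha> > 0" "\<beta> > 0" "\<alpha> * a = real m * pi" "\<beta> * b = real n * pi" using ab mn by (auto simp: \<alpha>_def \<beta>_def)
  have "neumann_domains (rectangle a b) (mode a b m n c) = components (neumann_region (rectangle a b) (wave c \<alpha> \<beta>))"
    by (rule neumann_domains_eq_components[OF ab]) (simp add: mode_closure[OF ab] \<alpha>_def \<beta>_def)
  also have "neumann_region (rectangle a b) (wave c \<alpha> \<beta>) = rectangle a b - separatrix_set \<alpha> \<beta>"
    by (rule neumann_region_wave[OF ab \<alpha>_def \<beta>_def mn c])
  finally show ?thesis
    using components_off_separatrix_set[OF ab pos(3,4,1,2) mn] by (simp add: ecard_def)
qed

section \<open>Nodal domains as grid cells\<close>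

lemma nodal_domains_mode:
  assumes ab: "0 < a" "0 < b" and mn: "1 \<le> m" "1 \<le> n" and c: "c \<noteq> 0"
  shows "ecard (nodal_domains (rectangle a b) (mode a b m n c)) = ereal (real (m * n))"
proof -
  define \<alpha> where "\<alpha> = real m * pi / a"
  define \<beta> where "\<beta> = real n * pi / b"
  have pos: "\<alpha> > 0" "\<beta> > 0" "\<alpha> * a = real m * pi" "\<beta> * b = real n * pi" using ab mn by (auto simp: \<alpha>_def \<beta>_def)
  define S where "S = (\<lambda>(i, j). {real i * pi / \<alpha><..<(real i * pi + pi) / \<alpha>} \<times> {real j * pi / \<beta><..<(real j * pi + pi) / \<beta>})"
  define I where "I = {..<m} \<times> {..<n}"
  have mem: "z \<in> S (i, j) \<longleftrightarrow> real i * pi < \<alpha> * fst z \<and> \<alpha> * fst z < real i * pi + pi \<and>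
      real j * pi < \<beta> * snd z \<and> \<beta> * snd z < real j * pi + pi" for z i j
    using pos by (cases z) (auto simp: S_def field_simps)
  have op: "open (S k)" for k by (cases k) (auto simp: S_def intro!: open_Times)
  have con: "connected (S k)" for k by (cases k) (auto simp: S_def intro!: connected_Times)
  have "((real i * pi + pi / 2) / \<alpha>, (real j * pi + pi / 2) / \<beta>) \<in> S (i, j)" for i j
    using pos unfolding mem by simp
  then have ne: "S k \<noteq> {}" for k by (metis empty_iff surj_pair)
  have disj: "S k \<inter> S l = {}" if "k \<noteq> l" for k l
  proof (rule ccontr)
    assume "S k \<inter> S l \<noteq> {}"
    then obtain z where z: "z \<in> S k" "z \<in> S l" by blast
    obtain i j i' j' where kl: "k = (i, j)" "l = (i', j')" by (cases k; cases l)
    have "real i * pi < real i' * pi + pi" "real i' * pi < real i * pi + pi"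
      "real j * pi < real j' * pi + pi" "real j' * pi < real j * pi + pi"
      using z unfolding kl mem by auto
    then have "i = i' \<and> j = j'" using mult_pi_less_imp by (meson le_antisym)
    then show False using that kl by simp
  qed
  have "rectangle a b - mode a b m n c -` {0} = (\<Union>k\<in>I. S k)"
  proof (intro equalityI subsetI)
    fix z assume z: "z \<in> rectangle a b - mode a b m n c -` {0}"
    then have "sin (\<alpha> * fst z) \<noteq> 0" "sin (\<beta> * snd z) \<noteq> 0" by (auto simp: mode_def wave_def \<alpha>_def \<beta>_def)
    moreover have zx: "0 < fst z" "fst z < a" "0 < snd z" "snd z < b" using z by (auto simp: rectangle_def)
    moreover have "0 \<le> \<alpha> * fst z" "0 \<le> \<beta> * snd z" using pos zx by auto
    ultimately obtain i j :: nat where ij: "real i * pi < \<alpha> * fst z" "\<alpha> * fst z < real i * pi + pi"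
      "real j * pi < \<beta> * snd z" "\<beta> * snd z < real j * pi + pi" using grid_cell by metis
    have "\<alpha> * fst z < real m * pi" "\<beta> * snd z < real n * pi"
      using zx pos(1,2) unfolding pos(3,4)[symmetric] by auto
    then have "real i * pi < real m * pi" "real j * pi < real n * pi" using ij by linarith+
    then show "z \<in> (\<Union>k\<in>I. S k)" using ij mem by (intro UN_I[of "(i, j)"]) (auto simp: I_def)
  next
    fix z assume "z \<in> (\<Union>k\<in>I. S k)"
    then obtain i j where ij: "i < m" "j < n" "z \<in> S (i, j)" by (auto simp: I_def)
    note z = ij(3)[unfolded mem]
    have "real i + 1 \<le> real m" "real j + 1 \<le> real n" using ij by auto
    then have "(real i + 1) * pi \<le> real m * pi" "(real j + 1) * pi \<le> real n * pi" by (auto intro: mult_right_mono)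
    then have "\<alpha> * fst z < \<alpha> * a" "\<beta> * snd z < \<beta> * b"
      using z unfolding pos(3,4) distrib_right by linarith+
    moreover have "\<alpha> * 0 < \<alpha> * fst z" "\<beta> * 0 < \<beta> * snd z"
      using z by (auto intro: order_le_less_trans[of 0 "real i * pi"] order_le_less_trans[of 0 "real j * pi"])
    ultimately have "0 < fst z" "fst z < a" "0 < snd z" "snd z < b"
      by (simp_all only: mult_less_cancel_left_pos[OF pos(1)] mult_less_cancel_left_pos[OF pos(2)])
    then have "z \<in> rectangle a b" by (simp add: rectangle_def mem_Times_iff)
    moreover have "sin (\<alpha> * fst z) \<noteq> 0"
      using cos_sin_npi_shift'(2)[of i "\<alpha> * fst z - real i * pi"] sin_gt_zero[of "\<alpha> * fst z - real i * pi"] z by auto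
    moreover have "sin (\<beta> * snd z) \<noteq> 0"
      using cos_sin_npi_shift'(2)[of j "\<beta> * snd z - real j * pi"] sin_gt_zero[of "\<beta> * snd z - real j * pi"] z by auto
    ultimately show "z \<in> rectangle a b - mode a b m n c -` {0}"
      using c by (simp add: mode_def wave_def \<alpha>_def[symmetric] \<beta>_def[symmetric])
  qed
  then have eq: "nodal_domains (rectangle a b) (mode a b m n c) = S ` I" and inj: "inj_on S I"
    using components_of_disjoint_open_family[of I S] op con ne disj by (auto simp: nodal_domains_def)
  have "card (S ` I) = m * n" using card_image[OF inj] by (simp add: I_def card_cartesian_product)
  then show ?thesis by (simp add: eq ecard_def I_def)
qed

section \<open>The asymptotic constants\<close>

text \<open>The majorant may exceed L at every index as long as it tends to L; the lower half needs
  good indices beyond every K.\<close>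

lemma limsup_eq_of_bound_and_frequently:
  fixes f g :: "nat \<Rightarrow> real"
  assumes le: "\<forall>\<^sub>F k in sequentially. f k \<le> g k" and g: "g \<longlonglongrightarrow> L"
    and freq: "\<And>e K. e > 0 \<Longrightarrow> \<exists>k\<ge>K. f k > L - e"
  shows "limsup (\<lambda>k. ereal (f k)) = ereal L"
proof (rule antisym)
  have "limsup (\<lambda>k. ereal (f k)) \<le> limsup (\<lambda>k. ereal (g k))"
    using le by (intro Limsup_mono) (auto elim: eventually_mono)
  also have "\<dots> = ereal L" using g by (intro lim_imp_Limsup) auto
  finally show "limsup (\<lambda>k. ereal (f k)) \<le> ereal L" .
  show "ereal L \<le> limsup (\<lambda>k. ereal (f k))"
  proof (rule ccontr)
    assume "\<not> ?thesis"
    then obtain r where r: "limsup (\<lambda>k. ereal (f k)) < ereal r" "r < L"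
      using ereal_dense2[of "limsup (\<lambda>k. ereal (f k))" "ereal L"] by (auto simp: not_le)
    from Limsup_lessD[OF r(1)] have "\<forall>\<^sub>F k in sequentially. f k < r" by simp
    then obtain K where "\<And>k. k \<ge> K \<Longrightarrow> f k < r" by (auto simp: eventually_sequentially)
    moreover obtain k where "k \<ge> K" "f k > L - (L - r)" using freq[of "L - r" K] r(2) by auto
    ultimately show False by force
  qed
qed

lemma square_sum_ge_twice_prod: "2 * x * y \<le> x\<^sup>2 + y\<^sup>2" for x y :: real
  using sum_squares_bound[of x y] by simp

theorem proposition7p1:
  fixes a b :: real and ev :: "nat \<Rightarrow> real" and u :: "nat \<Rightarrow> real \<times> real \<Rightarrow> real"
  assumes "0 < a" and "0 < b" and "a\<^sup>2 / b\<^sup>2 \<notin> \<rat>"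
    and "dirichlet_spectrum (rectangle a b) ev"
    and "\<And>k. 1 \<le> k \<Longrightarrow> dirichlet_eigenfunction (rectangle a b) (ev k) (u k)"
  shows "neumann_const (rectangle a b) u = 2 * pleijel_const (rectangle a b) u \<and>
         2 * pleijel_const (rectangle a b) u = ereal (4 / pi)"
proof -
  note ab = assms(1,2) and irr = assms(3)
  note spec = spectrum_enumeration[OF ab irr assms(4)]
  obtain M N where MN: "\<And>k. 1 \<le> k \<Longrightarrow> 1 \<le> M k \<and> 1 \<le> N k \<and> ev k = mode_ev a b (M k) (N k)"
    using spec(1) by metis
  \<comment> \<open>The radius with \<open>ev k = pi\<^sup>2 * (R k)\<^sup>2\<close> for k from 1
    on; the closed quarter ellipse of this radius holds exactly k lattice points.\<close>
  define R where "R k = sqrt ((real (M k) / a)\<^sup>2 + (real (N k) / b)\<^sup>2)" for k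
  have R: "R k > 0" "card (lattice_points a b (R k)) = k" if "1 \<le> k" for k
  proof -
    show "R k > 0" using MN[OF that] ab by (auto simp: R_def intro!: add_pos_nonneg)
    show "card (lattice_points a b (R k)) = k"
      using spec(3)[OF that, of "M k" "N k"] MN[OF that] by (simp add: R_def)
  qed
  have R2: "(R k)\<^sup>2 = (real (M k) / a)\<^sup>2 + (real (N k) / b)\<^sup>2" for k by (simp add: R_def)
  have up: "real k \<le> pi * a * b * (R k)\<^sup>2 / 4" and lo: "pi * a * b * (R k)\<^sup>2 / 4 - (a + b) * R k \<le> real k"
    if "1 \<le> k" for k
    using lattice_points_bounds(2,3)[OF ab R(1)[OF that]] unfolding R(2)[OF that] by auto
  have dom: "u k \<in> mode a b (M k) (N k) ` {c. c \<noteq> 0}" if k: "1 \<le> k" for k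
  proof -
    have e: "dirichlet_eigenfunction (rectangle a b) (mode_ev a b (M k) (N k)) (u k)"
      using assms(5)[OF k] MN[OF k] by simp
    obtain c where "c \<noteq> 0" "u k = mode a b (M k) (N k) c"
      using eigenfunction_is_mode[OF ab irr _ _ e] MN[OF k] by blast
    then show ?thesis by auto
  qed
  define f1 where "f1 k = real (M k * N k) / real k" for k
  define f2 where "f2 k = real (2 * M k * N k + M k + N k) / real k" for k
  have nodal: "ecard (nodal_domains (rectangle a b) (u k)) / ereal (real k) = ereal (f1 k)" if k: "1 \<le> k" for k
    using dom[OF k] nodal_domains_mode[OF ab, of "M k" "N k"] MN[OF k] k by (auto simp: f1_def)
  have neumann: "ecard (neumann_domains (rectangle a b) (u k)) / ereal (real k) = ereal (f2 k)" if k: "1 \<le> k" for k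
    using dom[OF k] neumann_domains_mode[OF ab, of "M k" "N k"] MN[OF k] k by (auto simp: f2_def)
  \<comment> \<open>\<open>u k\<close> is an eigenfunction from index 1 on, so the sequences are
    identified eventually.\<close>
  have pl: "pleijel_const (rectangle a b) u = limsup (\<lambda>k. ereal (f1 k))"
    unfolding pleijel_const_def
    by (rule Limsup_eq, rule eventually_mono[OF eventually_ge_at_top[of 1]]) (rule nodal)
  have ne: "neumann_const (rectangle a b) u = limsup (\<lambda>k. ereal (f2 k))"
    unfolding neumann_const_def
    by (rule Limsup_eq, rule eventually_mono[OF eventually_ge_at_top[of 1]]) (rule neumann)
  have Rinf: "filterlim R at_top sequentially"
  proof (rule filterlim_at_top_mono)
    show "filterlim (\<lambda>k. sqrt (4 / (pi * a * b) * real k)) at_top sequentially"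
      using ab by (intro filterlim_compose[OF sqrt_at_top] filterlim_tendsto_pos_mult_at_top[OF tendsto_const]
          filterlim_real_sequentially) auto
    show "\<forall>\<^sub>F k in sequentially. sqrt (4 / (pi * a * b) * real k) \<le> R k"
      using eventually_ge_at_top[of 1]
    proof eventually_elim
      case (elim k)
      have "4 / (pi * a * b) * real k \<le> (R k)\<^sup>2" using up[OF elim] ab by (simp add: field_simps)
      then show ?case using R(1)[OF elim] by (intro real_le_lsqrt) auto
    qed
  qed
  have Rinv: "(\<lambda>k. (a + b) / R k) \<longlonglongrightarrow> 0"
    by (rule tendsto_divide_0[OF tendsto_const]) (rule filterlim_at_top_imp_at_infinity[OF Rinf])
  \<comment> \<open>The lower lattice bound divided by R^2: the perimeter term then tends to 0, and
    D tends to the area constant.\<close>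
  define D where "D k = pi * a * b / 4 - (a + b) / R k" for k
  have Dlim: "D \<longlonglongrightarrow> pi * a * b / 4" unfolding D_def using tendsto_diff[OF tendsto_const Rinv] by simp
  have Dpos: "\<forall>\<^sub>F k in sequentially. D k > 0"
    using order_tendstoD(1)[OF Dlim, of 0] ab by simp
  have prod_le: "real (M k * N k) \<le> (a * b / 2) * (R k)\<^sup>2" for k
  proof -
    have "2 * (real (M k) / a) * (real (N k) / b) \<le> (R k)\<^sup>2" unfolding R2 by (rule square_sum_ge_twice_prod)
    then show ?thesis using ab by (simp add: field_simps)
  qed
  \<comment> \<open>Stated as a multiple of R^2 with a factor tending to 0, so that m + n passes
    through \<open>quot\<close> together with the main term.\<close>
  have MN_le: "real (M k) + real (N k) \<le> (a + b) / R k * (R k)\<^sup>2" if "1 \<le> k" for k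
  proof -
    have "real (M k) / a \<le> R k" "real (N k) / b \<le> R k" unfolding R_def by (rule real_le_rsqrt, simp)+
    then have "real (M k) \<le> a * R k" "real (N k) \<le> b * R k" using ab by (simp_all add: field_simps)
    moreover have "(a + b) / R k * (R k)\<^sup>2 = (a + b) * R k" by (simp add: power2_eq_square)
    ultimately show ?thesis by (simp add: distrib_right)
  qed
  have k_ge: "D k * (R k)\<^sup>2 \<le> real k" if "1 \<le> k" for k
    using lo[OF that] R(1)[OF that] by (simp add: D_def power2_eq_square left_diff_distrib)
  have quot: "x / real k \<le> y / D k" if "1 \<le> k" "D k > 0" "0 \<le> y" "x \<le> y * (R k)\<^sup>2" for x y k
  proof -
    have "x / real k \<le> (y * (R k)\<^sup>2) / real k" using that by (intro divide_right_mono) auto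
    also have "\<dots> \<le> (y * (R k)\<^sup>2) / (D k * (R k)\<^sup>2)"
      using that k_ge[OF that(1)] R(1)[OF that(1)] by (intro divide_left_mono mult_pos_pos) auto
    also have "\<dots> = y / D k" using R(1)[OF that(1)] by simp
    finally show ?thesis .
  qed
  have freq: "\<exists>k\<ge>K. 1 \<le> k \<and> f1 k > 2 / pi - e" if e: "e > 0" for e K
  proof -
    \<comment> \<open>Equality in the mean inequality would require m / a = n / b, impossible for
      positive integers as a / b is irrational. Rounding l a / b up solves it asymptotically, with a
      positive index for l at least 1.\<close>
    define p where "p l = nat \<lceil>real l * (a / b)\<rceil>" for l
    define r where "r l = real (p l) / real l" for l
    have rlim: "r \<longlonglongrightarrow> a / b"
    proof (rule tendsto_sandwich)
      have p: "real l * (a / b) \<le> real (p l)" "real (p l) \<le> real l * (a / b) + 1" for l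
      proof -
        have "0 \<le> real l * (a / b)" using ab by simp
        then show "real l * (a / b) \<le> real (p l)" "real (p l) \<le> real l * (a / b) + 1" unfolding p_def by linarith+
      qed
      show "\<forall>\<^sub>F l in sequentially. a / b \<le> r l"
        using eventually_gt_at_top[of 0] by eventually_elim (use p in \<open>simp add: r_def field_simps\<close>)
      show "\<forall>\<^sub>F l in sequentially. r l \<le> a / b + 1 / real l"
        using eventually_gt_at_top[of 0]
      proof eventually_elim
        case (elim l)
        have "r l \<le> (real l * (a / b) + 1) / real l" unfolding r_def using p by (intro divide_right_mono) auto
        also have "\<dots> = a / b + 1 / real l" using elim by (simp add: add_divide_distrib)
        finally show ?case .
      qed
      show "(\<lambda>l. a / b + 1 / real l) \<longlonglongrightarrow> a / b"
        using tendsto_add[OF tendsto_const lim_1_over_n] by simp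
    qed simp
    \<comment> \<open>With m / n = r and n = l this is m n divided by the upper area bound for k,
      since R^2 is l^2 times the inner denominator. At r = a / b its value is 2 / pi.\<close>
    have "(\<lambda>l. 4 / (pi * a * b) * (r l / ((r l)\<^sup>2 / a\<^sup>2 + 1 / b\<^sup>2))) \<longlonglongrightarrow> 4 / (pi * a * b) * ((a / b) / ((a / b)\<^sup>2 / a\<^sup>2 + 1 / b\<^sup>2))"
      using ab by (intro tendsto_intros rlim) (auto simp: field_simps)
    moreover have "4 / (pi * a * b) * ((a / b) / ((a / b)\<^sup>2 / a\<^sup>2 + 1 / b\<^sup>2)) = 2 / pi"
      using ab by (simp add: field_simps power2_eq_square)
    ultimately have "\<forall>\<^sub>F l in sequentially. 2 / pi - e < 4 / (pi * a * b) * (r l / ((r l)\<^sup>2 / a\<^sup>2 + 1 / b\<^sup>2))"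
      using e by (simp add: order_tendstoD(1))
    from eventually_conj[OF this eventually_ge_at_top[of "max 1 K"]]
    obtain l where l: "2 / pi - e < 4 / (pi * a * b) * (r l / ((r l)\<^sup>2 / a\<^sup>2 + 1 / b\<^sup>2))" "max 1 K \<le> l"
      using eventually_happens'[OF sequentially_bot] by blast
    have "real l * (a / b) > 0" using l ab by simp
    then have pl: "1 \<le> p l" unfolding p_def by linarith
    obtain k where k: "1 \<le> k" "ev k = mode_ev a b (p l) l" using spec(2)[OF pl] l(2) by auto
    have MNk: "M k = p l" "N k = l" using mode_ev_inj[OF ab irr] MN[OF k(1)] k(2) by metis+
    \<comment> \<open>The l points of the column up to (p l, l) already lie in the ellipse, so k is
      at least l and can be pushed beyond K.\<close>
    have "(\<lambda>q. (p l, q)) ` {1..l} \<subseteq> lattice_points a b (R k)"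
    proof safe
      fix q assume q: "q \<in> {1..l}"
      then have "(real q / b)\<^sup>2 \<le> (real l / b)\<^sup>2" using ab by (intro power_mono divide_right_mono) auto
      then show "(p l, q) \<in> lattice_points a b (R k)" using q pl by (simp add: lattice_points_def R2 MNk)
    qed
    then have "card ((\<lambda>q. (p l, q)) ` {1..l}) \<le> k"
      using card_mono[OF lattice_points_bounds(1)[OF ab R(1)[OF k(1)]]] R(2)[OF k(1)] by metis
    moreover have "card ((\<lambda>q. (p l, q)) ` {1..l}) = l" by (subst card_image) (auto simp: inj_on_def)
    ultimately have "K \<le> k" using l(2) by simp
    have l0: "real l > 0" using l(2) by simp
    have "4 / (pi * a * b) * (r l / ((r l)\<^sup>2 / a\<^sup>2 + 1 / b\<^sup>2)) = real (M k * N k) / (pi * a * b * (R k)\<^sup>2 / 4)"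
    proof -
      have "(R k)\<^sup>2 = (real l)\<^sup>2 * ((r l)\<^sup>2 / a\<^sup>2 + 1 / b\<^sup>2)"
        unfolding R2 MNk r_def using l0 by (simp add: power_divide distrib_left)
      moreover have "real (M k * N k) = (real l)\<^sup>2 * r l" unfolding MNk r_def using l0 by (simp add: power2_eq_square)
      moreover have "(real l)\<^sup>2 > 0" using l0 by simp
      ultimately show ?thesis by (simp add: mult_ac)
    qed
    also have "\<dots> \<le> real (M k * N k) / real k"
      using up[OF k(1)] k(1) ab R(1)[OF k(1)] by (intro divide_left_mono mult_pos_pos) auto
    finally have "2 / pi - e < f1 k" using l(1) by (simp add: f1_def)
    then show ?thesis using \<open>K \<le> k\<close> k(1) by blast
  qed
  have "limsup (\<lambda>k. ereal (f1 k)) = ereal (2 / pi)"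
  proof (rule limsup_eq_of_bound_and_frequently)
    show "\<forall>\<^sub>F k in sequentially. f1 k \<le> (a * b / 2) / D k"
      using Dpos eventually_ge_at_top[of 1]
      by eventually_elim (unfold f1_def, rule quot, use prod_le ab in auto)
    have "(\<lambda>k. (a * b / 2) / D k) \<longlonglongrightarrow> (a * b / 2) / (pi * a * b / 4)"
      using ab by (intro tendsto_intros Dlim) auto
    then show "(\<lambda>k. (a * b / 2) / D k) \<longlonglongrightarrow> 2 / pi" using ab by simp
  qed (use freq in blast)
  moreover have "limsup (\<lambda>k. ereal (f2 k)) = ereal (4 / pi)"
  proof (rule limsup_eq_of_bound_and_frequently)
    show "\<forall>\<^sub>F k in sequentially. f2 k \<le> (a * b + (a + b) / R k) / D k"
      using Dpos eventually_ge_at_top[of 1]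
    proof eventually_elim
      case (elim k)
      have "real (2 * M k * N k + M k + N k) \<le> (a * b + (a + b) / R k) * (R k)\<^sup>2"
        using prod_le[of k] MN_le[OF elim(2)] by (simp add: distrib_right)
      then show ?case unfolding f2_def using elim R(1)[OF elim(2)] ab by (intro quot) auto
    qed
    have "(\<lambda>k. (a * b + (a + b) / R k) / D k) \<longlonglongrightarrow> (a * b + 0) / (pi * a * b / 4)"
      using ab by (intro tendsto_intros Dlim Rinv) auto
    then show "(\<lambda>k. (a * b + (a + b) / R k) / D k) \<longlonglongrightarrow> 4 / pi" using ab by simp
    fix e :: real and K :: nat assume "e > 0"
    then obtain k where k: "k \<ge> K" "1 \<le> k" "f1 k > 2 / pi - e / 2" using freq[of "e / 2" K] by auto
    \<comment> \<open>The excess m + n is nonnegative, so the good indices for the nodal quotient,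
      taken with e / 2, serve for the Neumann quotient with e.\<close>
    have "2 * f1 k \<le> f2 k" unfolding f1_def f2_def by (simp add: divide_right_mono)
    then show "\<exists>k\<ge>K. f2 k > 4 / pi - e" using k by (intro exI[of _ k]) auto
  qed
  moreover have "2 * ereal (2 / pi) = ereal (2 * (2 / pi))"
    by (metis numeral_eq_ereal times_ereal.simps(1))
  ultimately show ?thesis unfolding pl ne by simp
qed

end
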